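(* Let $n\ge 2$, $N\ge 1$, and let $\varphi$ be an $N$-function of class $C^1([0,\infty))\cap C^2((0,\infty))$ with $\varphi'(t)\sim t\varphi''(t)$ for $t>0$. Let $f:\mathbb{R}^{Nn}\to\mathbb{R}$ be a function. Then the following hold. (i) If $f$ is $C^2$ outside a large ball, then $f$ is asymptotically $W^{1,\varphi}$-quasiconvex if and only if there exists a uniformly strictly $W^{1,\varphi}$-quasiconvex function $g:\mathbb{R}^{Nn}\to\mathbb{R}$ which is $C^2$ outside a large ball and satisfies $$\lim_{|z|\to\infty}\frac{|D^2f(z)-D^2g(z)|}{\varphi''(|z|)}=0.$$ (ii) If $f$ is locally bounded from below, then $f$ is asymptotically $W^{1,\varphi}$-quasiconvex if and only if there exist a constant $M>0$ and a uniformly strictly $W^{1,\varphi}$-quasiconvex function $g:\mathbb{R}^{Nn}\to\mathbb{R}$ such that $f(z)=g(z)$ for $|z|>M$ and $g\le f$ on $\mathbb{R}^{Nn}$. (iii) If $f$ is locally bounded from above, then $f$ is asymptotically $W^{1,\varphi}$-quasiconvex if and only if there exist a constant $M>0$ and a uniformly strictly $W^{1,\varphi}$-quasiconvex function $g:\mathbb{R}^{Nn}\to\mathbb{R}$ such that $f(z)=g(z)$ for $|z|>M$ and $g\ge f$ on $\mathbb{R}^{Nn}$. (iv) If $f$ is Borel measurable and satisfies $|f(z)|\le C(1+\varphi(|z|))$ for all $z\in\mathbb{R}^{Nn}$ and some constant $C>0$, then $f$ is asymptotically $W^{1,\varphi}$-quasiconvex if and only if there exist positive constants $M,k,L$ such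 that $$\frac{1}{|B_1|}\int_{B_1} f(z+D\xi)\,dx\ \ge\ f(z)+k\,\frac{1}{|B_1|}\int_{B_1}\varphi_{|z|}(|D\xi|)\,dx$$ for all $|z|>M$ and all $\xi\in C^\infty_c(B_1,\mathbb{R}^N)$, and $$|f(z_2)-f(z_1)|\le L\,|z_1-z_2|\,\varphi'(1+|z_1|+|z_2|)$$ for all $z_1,z_2\in\mathbb{R}^{Nn}$ with $|z_1|,|z_2|>M$.
   Context: $\mathbb{R}^{Nn}$ is the space of $N\times n$ matrices; $B_1$ is the unit ball of $\mathbb{R}^n$. An $N$-function is a function $\varphi:[0,\infty)\to[0,\infty)$ with $\varphi(0)=0$ having a right-continuous nondecreasing derivative $\varphi'$ with $\varphi'(0)=0$, $\varphi'(t)>0$ for $t>0$ and $\lim_{t\to\infty}\varphi'(t)=\infty$. The notation $h_1\sim h_2$ means that there are constants $c_1,c_2>0$ with $c_1h_1\le h_2\le c_2h_1$ on the whole domain. For $a\ge 0$ the shifted function is $\varphi_a(t)=\int_0^t\varphi'(a+s)\frac{s}{a+s}\,ds$, $t\ge0$ (so $\varphi_a(t)\sim t^2\varphi''(a+t)$). A continuous function $g:\mathbb{R}^{Nn}\to\mathbb{R}$ is uniformly strictly $W^{1,\varphi}$-quasiconvex if there is $k>0$ such that $\frac{1}{|B_1|}\int_{B_1}g(z+D\xi)\,dx\ge g(z)+k\frac{1}{|B_1|}\int_{B_1}\varphi_{1+|z|}(|D\xi|)\,dx$ for all $\xi\in C^1_c(B_1,\mathbb{R}^N)$ and all $z\in\mathbb{R}^{Nn}$.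 A function $f:\mathbb{R}^{Nn}\to\mathbb{R}$ is asymptotically $W^{1,\varphi}$-quasiconvex if there exist a constant $M>0$ and a uniformly strictly $W^{1,\varphi}$-quasiconvex function $g$ such that $f(z)=g(z)$ for $|z|>M$. *)

theory Defs
  imports "HOL-Analysis.Analysis"
begin

text \<open>The space of \<open>N \<times> n\<close> matrices is \<open>real ^ 'n ^ 'm\<close> with \<open>CARD('m) = N\<close> rows; its library norm is
  the Euclidean (Frobenius) norm.\<close>

text \<open>\<open>f\<close> is of class \<open>C\<^sup>k\<close> on \<open>S\<close>: all iterated directional derivatives of order at most \<open>k\<close> exist and
  are continuous, which in finite dimension is the usual notion. It is meant for sets on which
  derivatives within \<open>S\<close> are unique: below, open sets and the half-line \<open>{0..}\<close>, where the derivative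
  at \<open>0\<close> is one-sided.\<close>

primrec Ck_on :: "nat \<Rightarrow> ('a::euclidean_space \<Rightarrow> 'b::real_normed_vector) \<Rightarrow> 'a set \<Rightarrow> bool" where
  "Ck_on 0 f S \<longleftrightarrow> continuous_on S f"
| "Ck_on (Suc k) f S \<longleftrightarrow> f differentiable_on S \<and>
     (\<forall>v. Ck_on k (\<lambda>x. frechet_derivative f (at x within S) v) S)"

text \<open>A function on \<open>[0,\<infinity>)\<close> is a function on \<open>real\<close> whose values at negative arguments are never used.
  For \<open>t > 0\<close> its derivatives are the library's \<open>deriv \<phi> t\<close> and \<open>deriv (deriv \<phi>) t\<close>; only at \<open>t = 0\<close>
  is a one-sided derivative needed.\<close>

definition N_function :: "(real \<Rightarrow> real) \<Rightarrow> bool" where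
  "N_function \<phi> \<longleftrightarrow> \<phi> 0 = 0 \<and> (\<forall>t\<ge>0. \<phi> t \<ge> 0) \<and>
     (\<exists>\<phi>'. (\<forall>t\<ge>0. (\<phi> has_real_derivative \<phi>' t) (at t within {0..})) \<and>
           (\<forall>t\<ge>0. continuous (at_right t) \<phi>') \<and> mono_on {0..} \<phi>' \<and>
           \<phi>' 0 = 0 \<and> (\<forall>t>0. \<phi>' t > 0) \<and> filterlim \<phi>' at_top at_top)"

definition comparable_on :: "'a set \<Rightarrow> ('a \<Rightarrow> real) \<Rightarrow> ('a \<Rightarrow> real) \<Rightarrow> bool" where
  "comparable_on S h1 h2 \<longleftrightarrow>
     (\<exists>c1>0. \<exists>c2>0. \<forall>t\<in>S. c1 * h1 t \<le> h2 t \<and> h2 t \<le> c2 * h1 t)"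

text \<open>For \<open>a = 0\<close> the integrand at the single point \<open>s = 0\<close> is a junk value without influence.\<close>

definition shifted :: "(real \<Rightarrow> real) \<Rightarrow> real \<Rightarrow> real \<Rightarrow> real" where
  "shifted \<phi> a t = (LBINT s:{0..t}. deriv \<phi> (a + s) * (s / (a + s)))"

definition ball_average :: "(real ^ 'n \<Rightarrow> real) \<Rightarrow> real" where
  "ball_average h = (1 / measure lborel (ball (0 :: real ^ 'n) 1)) * (LBINT x:ball 0 1. h x)"

text \<open>Elements of \<open>C\<^sup>k\<^sub>c(B\<^sub>1)\<close> and \<open>C\<^sup>\<infinity>\<^sub>c(B\<^sub>1)\<close> are represented by their extension by zero to the whole
  space; the support is compact because it is a closed subset of the unit ball.\<close>

definition Ckc_ball :: "nat \<Rightarrow> (real ^ 'n \<Rightarrow> real ^ 'm) set" where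
  "Ckc_ball k = {\<xi>. Ck_on k \<xi> UNIV \<and> closure {x. \<xi> x \<noteq> 0} \<subseteq> ball 0 1}"

definition Cinfc_ball :: "(real ^ 'n \<Rightarrow> real ^ 'm) set" where
  "Cinfc_ball = (\<Inter>k. Ckc_ball k)"

definition unif_strictly_quasiconvex ::
  "(real \<Rightarrow> real) \<Rightarrow> (real ^ 'n ^ 'm \<Rightarrow> real) \<Rightarrow> bool" where
  "unif_strictly_quasiconvex \<phi> g \<longleftrightarrow> continuous_on UNIV g \<and>
     (\<exists>k>0. \<forall>\<xi>\<in>Ckc_ball 1. \<forall>z.
        ball_average (\<lambda>x. g (z + jacobian \<xi> (at x)))
          \<ge> g z + k * ball_average (\<lambda>x. shifted \<phi> (1 + norm z) (norm (jacobian \<xi> (at x)))))"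

definition asymp_quasiconvex ::
  "(real \<Rightarrow> real) \<Rightarrow> (real ^ 'n ^ 'm \<Rightarrow> real) \<Rightarrow> bool" where
  "asymp_quasiconvex \<phi> f \<longleftrightarrow>
     (\<exists>M>0. \<exists>g. unif_strictly_quasiconvex \<phi> g \<and> (\<forall>z. norm z > M \<longrightarrow> f z = g z))"

definition C2_outside_large_ball :: "('a::euclidean_space \<Rightarrow> real) \<Rightarrow> bool" where
  "C2_outside_large_ball f \<longleftrightarrow> (\<exists>R>0. Ck_on 2 f (- cball 0 R))"

text \<open>The array of all second partial derivatives, so that its norm is the Euclidean norm of \<open>D\<^sup>2f\<close>.\<close>

definition D2 :: "(real ^ 'n ^ 'm \<Rightarrow> real) \<Rightarrow> real ^ 'n ^ 'm \<Rightarrow> real ^ 'n ^ 'm ^ 'n ^ 'm" where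
  "D2 f z = (\<chi> i j k l. frechet_derivative
       (\<lambda>w. frechet_derivative f (at w) (axis i (axis j 1))) (at z) (axis k (axis l 1)))"

definition locally_bdd_below :: "('a::metric_space \<Rightarrow> real) \<Rightarrow> bool" where
  "locally_bdd_below f \<longleftrightarrow> (\<forall>z. \<exists>e>0. bdd_below (f ` ball z e))"

definition locally_bdd_above :: "('a::metric_space \<Rightarrow> real) \<Rightarrow> bool" where
  "locally_bdd_above f \<longleftrightarrow> (\<forall>z. \<exists>e>0. bdd_above (f ` ball z e))"

end

theory Submission
  imports Defs
begin

text \<open>
  The hypothesis on \<open>\<phi>\<close> makes \<open>\<phi>'\<close> doubling, so \<open>\<phi>\<^sub>a(t)\<close> is comparable to
  \<open>t\<^sup>2 \<phi>'(a + t) / (a + t)\<close>. Since gradients of test functions have average zero, adding \<open>W\<close>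
  to a uniformly strictly quasiconvex function is harmless as soon as
  \<open>\<bar>W(z + y) - W(z) - DW(z)y\<bar>\<close> is a small multiple of \<open>\<phi>\<^bsub>1+\<bar>z\<bar>\<^esub>(\<bar>y\<bar>)\<close>. If \<open>D\<^sup>2u\<close> is
  \<open>o(\<phi>''(\<bar>z\<bar>))\<close>, this holds for \<open>W = \<eta>\<^sub>R u\<close> with a cut-off \<open>\<eta>\<^sub>R\<close> that vanishes on a large ball
  of radius \<open>R\<close> and equals \<open>1\<close> far out. Taking \<open>u = f - g\<close> gives (i), and constant \<open>u\<close> gives (ii) and (iii).

  For (iv), a test function with gradient \<open>h + D\<zeta>\<close> on \<open>B\<^sub>r\<close> and gradient of size \<open>\<bar>h\<bar> / (1 - r)\<close>
  in the remaining layer yields the Lipschitz estimate directly from quasiconvexity, without passing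
  through rank-one convexity. Conversely, one subtracts from \<open>f\<close> (made continuous and larger inside a
  ball) a small multiple of the strictly convex potential \<open>V(z) = \<phi>(sqrt (1 + \<bar>z\<bar>\<^sup>2))\<close> and adds that multiple
  back to the quasiconvex envelope \<open>z \<mapsto> inf\<^sub>\<zeta>\<close> of the averages of \<open>F(z + D\<zeta>)\<close>. The layer construction
  shows that this envelope is finite and locally Lipschitz, and a Vitali packing with finitely many
  near-optimal test functions shows that it is quasiconvex.
\<close>

section \<open>Orlicz functions and their shifts\<close>

text \<open>The obstacle in (iv) is the ball on which nothing useful is known about f. An envelope
  repairs plain quasiconvexity and leaves a function unchanged at every point where it is already
  quasiconvex, but it cannot be trusted to keep the strict surplus. Hence the detour through V:
  since gradients average to zero, the average of V(z + D\<xi>) minus V(z) is comparable from both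
  sides with the average of the shifted function, so subtracting a small multiple of V spends the
  strictness that is given outside the ball, and adding it back after the repair supplies strictness
  at all z. In (i) the smallness of the second derivative of u has to be turned into smallness of u
  and Du, because the cut-off is differentiated too. This is done by integrating along rays; the
  constants of integration are absorbed because \<phi>' and \<phi> tend to infinity.\<close>

locale orlicz =
  fixes \<phi> :: "real \<Rightarrow> real" and c1 c2 :: real
  assumes zero: "\<phi> 0 = 0" and nonneg: "\<And>t. t \<ge> 0 \<Longrightarrow> \<phi> t \<ge> 0"
    and cont: "continuous_on {0..} \<phi>"
    and d1: "\<And>t. t > 0 \<Longrightarrow> (\<phi> has_real_derivative deriv \<phi> t) (at t)"
    and d2: "\<And>t. t > 0 \<Longrightarrow> (deriv \<phi> has_real_derivative deriv (deriv \<phi>) t) (at t)"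
    and pos: "\<And>t. t > 0 \<Longrightarrow> deriv \<phi> t > 0"
    and c1: "c1 > 0" and c2: "c2 > 0"
    and lower: "\<And>t. t > 0 \<Longrightarrow> c1 * deriv \<phi> t \<le> t * deriv (deriv \<phi>) t"
    and upper: "\<And>t. t > 0 \<Longrightarrow> t * deriv (deriv \<phi>) t \<le> c2 * deriv \<phi> t"
    and lim: "filterlim (deriv \<phi>) at_top at_top"
begin

lemma second_pos: "t > 0 \<Longrightarrow> deriv (deriv \<phi>) t > 0"
  using lower[of t] pos[of t] c1 by (smt (verit) mult_pos_pos zero_less_mult_pos)

lemma deriv_mono: "0 < s \<Longrightarrow> s \<le> t \<Longrightarrow> deriv \<phi> s \<le> deriv \<phi> t"
  by (rule DERIV_nonneg_imp_nondecreasing[of s t]) (auto intro!: exI d2 less_imp_le second_pos)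

lemma mono: "0 \<le> s \<Longrightarrow> s \<le> t \<Longrightarrow> \<phi> s \<le> \<phi> t"
  by (rule DERIV_nonneg_imp_increasing_open[of s t])
    (auto intro!: exI[of _ "deriv \<phi> _"] d1 less_imp_le[OF pos] continuous_on_subset[OF cont])

text \<open>The upper bound t \<phi>''(t) \<le> c2 \<phi>'(t) says that
  \<open>t powr (-c2) * deriv \<phi> t\<close> is nonincreasing, so going from t to s costs at most
  the factor (s/t)^c2.\<close>

lemma doubling:
  assumes "0 < t" "t \<le> s" "s \<le> N * t"
  shows "deriv \<phi> s \<le> N powr c2 * deriv \<phi> t"
proof -
  have "- (s powr (-c2) * deriv \<phi> s) \<ge> - (t powr (-c2) * deriv \<phi> t)"
  proof (rule DERIV_nonneg_imp_nondecreasing[OF assms(2)])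
    fix x assume "t \<le> x" "x \<le> s"
    then have x: "x > 0" using assms by simp
    have "((\<lambda>x. - (x powr (-c2) * deriv \<phi> x)) has_real_derivative
        - (x powr (-c2) * deriv (deriv \<phi>) x + (- c2 * x powr (-c2-1)) * deriv \<phi> x)) (at x)"
      using x by (auto intro!: derivative_eq_intros d2)
    moreover have "x powr (-c2) = x powr (-c2-1) * x"
      using x by (simp add: powr_diff)
    then have "- (x powr (-c2) * deriv (deriv \<phi>) x + (- c2 * x powr (-c2-1)) * deriv \<phi> x)
       = x powr (-c2-1) * (c2 * deriv \<phi> x - x * deriv (deriv \<phi>) x)"
      by (simp add: algebra_simps)
    moreover have "\<dots> \<ge> 0" using upper[OF x] by simp
    ultimately show "\<exists>y. ((\<lambda>x. - (x powr (-c2) * deriv \<phi> x)) has_real_derivative y) (at x) \<and> y \<ge> 0"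
      by metis
  qed
  then have "s powr (-c2) * deriv \<phi> s \<le> t powr (-c2) * deriv \<phi> t" by simp
  then have "deriv \<phi> s \<le> (s / t) powr c2 * deriv \<phi> t"
    using assms by (simp add: powr_minus powr_divide field_simps)
  also have "\<dots> \<le> N powr c2 * deriv \<phi> t"
    using assms pos[of t] c2 by (intro mult_right_mono powr_mono2) (auto simp: field_simps)
  finally show ?thesis .
qed

lemma le_mult_deriv: "t > 0 \<Longrightarrow> \<phi> t \<le> t * deriv \<phi> t"
proof -
  assume t: "t > 0"
  have "\<exists>x>0. x < t \<and> \<phi> t - \<phi> 0 = deriv \<phi> x * (t - 0)"
  proof -
    obtain l x where lx: "0 < x" "x < t" "DERIV \<phi> x :> l" "\<phi> t - \<phi> 0 = (t - 0) * l"
      using MVT[of 0 t \<phi>] t d1 continuous_on_subset[OF cont, of "{0..t}"]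
      by (metis atLeastAtMost_iff atLeast_iff real_differentiable_def subsetI)
    then show ?thesis using DERIV_unique[OF lx(3) d1[OF lx(1)]] by auto
  qed
  then obtain x where "0 < x" "x < t" "\<phi> t - \<phi> 0 = deriv \<phi> x * (t - 0)" by blast
  then show ?thesis using deriv_mono[of x t] t zero by (simp add: mult_left_mono)
qed

text \<open>The mean value theorem is applied on [t/2, t] instead of [0, t]: the intermediate point
  is then at least t/2 and doubling brings \<phi>' back to t. With \<open>le_mult_deriv\<close> this
  makes \<phi>(t) comparable to t \<phi>'(t).\<close>

lemma mult_deriv_le: "t > 0 \<Longrightarrow> t * deriv \<phi> t \<le> 2 * 2 powr c2 * \<phi> t"
proof -
  assume t: "t > 0"
  obtain x where x: "t/2 < x" "x < t" "\<phi> t - \<phi> (t/2) = (t - t/2) * deriv \<phi> x"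
    using MVT2[of "t/2" t \<phi> "deriv \<phi>"] t d1 by fastforce
  have "deriv \<phi> t \<le> 2 powr c2 * deriv \<phi> x" using x t by (intro doubling) auto
  then have "t * deriv \<phi> t \<le> t * (2 powr c2 * deriv \<phi> x)" using t by simp
  also have "\<dots> = 2 * 2 powr c2 * (\<phi> t - \<phi> (t/2))"
    unfolding x(3) by simp
  also have "\<dots> \<le> 2 * 2 powr c2 * \<phi> t" using nonneg[of "t/2"] t by simp
  finally show ?thesis .
qed

text \<open>Up to the constants c1 and c2 this is t^2 \<phi>''(a + t), the natural size of a
  second-order Taylor remainder over a step of length t from a point of norm about a.\<close>

definition weight :: "real \<Rightarrow> real \<Rightarrow> real" where
  "weight a t = t\<^sup>2 * deriv \<phi> (a + t) / (a + t)"

lemma weight_nonneg: "a > 0 \<Longrightarrow> t \<ge> 0 \<Longrightarrow> weight a t \<ge> 0"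
  using pos[of "a+t"] by (simp add: weight_def)

lemma integrand_cont: "a > 0 \<Longrightarrow> continuous_on {0..t} (\<lambda>s. deriv \<phi> (a + s) * (s / (a + s)))"
proof -
  assume a: "a > 0"
  have "continuous_on {0<..} (deriv \<phi>)"
    using DERIV_continuous_on[of "{0<..}" "deriv \<phi>" "deriv (deriv \<phi>)"] d2
    by (meson greaterThan_iff has_field_derivative_at_within)
  then have "continuous_on {0..t} (\<lambda>s. deriv \<phi> (a + s))"
    using a by (rule_tac continuous_on_compose2[of "{0<..}"]) (auto intro!: continuous_intros)
  then show ?thesis using a by (auto intro!: continuous_intros)
qed

lemma integrand_integrable:
  "a > 0 \<Longrightarrow> set_integrable lborel {0..t} (\<lambda>s. deriv \<phi> (a + s) * (s / (a + s)))"
  unfolding set_integrable_def using borel_integrable_compact[OF compact_Icc integrand_cont] by blast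

lemma integrand_mono:
  assumes "a > 0" "0 \<le> s" "s \<le> t"
  shows "deriv \<phi> (a + s) * (s / (a + s)) \<le> deriv \<phi> (a + t) * (t / (a + t))"
  using assms pos[of "a+t"] by (intro mult_mono deriv_mono) (auto simp: field_simps)

lemma integrand_nonneg: "a > 0 \<Longrightarrow> 0 \<le> s \<Longrightarrow> 0 \<le> deriv \<phi> (a + s) * (s / (a + s))"
  using pos[of "a+s"] by simp

lemma shifted_nonneg: "a > 0 \<Longrightarrow> 0 \<le> shifted \<phi> a t"
  unfolding shifted_def set_lebesgue_integral_def
  using integrand_nonneg[of a] by (intro Bochner_Integration.integral_nonneg) (auto simp: indicator_def)

lemma shifted_le_weight:
  assumes "a > 0" "t \<ge> 0" shows "shifted \<phi> a t \<le> weight a t"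
proof -
  have "shifted \<phi> a t \<le> (LBINT s:{0..t}. deriv \<phi> (a + t) * (t / (a + t)))"
    unfolding shifted_def using assms
    by (intro set_integral_mono integrand_integrable integrand_mono) (auto simp: set_integrable_def)
  also have "\<dots> = weight a t"
    using assms by (simp add: weight_def power2_eq_square set_lebesgue_integral_def)
  finally show ?thesis .
qed

text \<open>The integrand is nondecreasing, so [t/2, t] already contributes t/2 times its value at
  t/2, and doubling moves that value to t. The factor 4 is made of the half interval and of s = t/2
  in the numerator.\<close>

lemma weight_le_shifted:
  assumes "a > 0" "t \<ge> 0" shows "weight a t \<le> 4 * 2 powr c2 * shifted \<phi> a t"
proof (cases "t = 0")
  case True then show ?thesis using assms by (simp add: weight_def shifted_nonneg)
next
  case False
  then have t: "t > 0" using assms by simp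
  let ?h = "\<lambda>s. deriv \<phi> (a + s) * (s / (a + s))"
  have "(t/2) * ?h (t/2) = (\<integral>s. indicator {t/2..t} s *\<^sub>R ?h (t/2) \<partial>lborel)"
    using t by simp
  also have "\<dots> \<le> (\<integral>s. indicator {0..t} s *\<^sub>R ?h s \<partial>lborel)"
  proof (rule integral_mono)
    show "integrable lborel (\<lambda>s. indicator {t/2..t} s *\<^sub>R ?h (t/2))"
      by (intro integrable_scaleR_left integrable_real_indicator) (auto simp: emeasure_lborel_Icc_eq)
    show "integrable lborel (\<lambda>s. indicator {0..t} s *\<^sub>R ?h s)"
      using integrand_integrable[of a t] assms by (simp add: set_integrable_def)
  qed (use assms t integrand_mono[of a "t/2"] integrand_nonneg[of a] in \<open>auto simp: indicator_def\<close>)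
  also have "\<dots> = shifted \<phi> a t" by (simp add: shifted_def set_lebesgue_integral_def)
  finally have *: "(t/2) * ?h (t/2) \<le> shifted \<phi> a t" .
  have "deriv \<phi> (a+t) \<le> 2 powr c2 * deriv \<phi> (a + t/2)" using assms t by (intro doubling) auto
  then have "weight a t \<le> t\<^sup>2 * (2 powr c2 * deriv \<phi> (a + t/2)) / (a + t)"
    using assms unfolding weight_def by (intro divide_right_mono mult_left_mono) auto
  also have "\<dots> \<le> t\<^sup>2 * (2 powr c2 * deriv \<phi> (a + t/2)) / (a + t/2)"
    using assms t pos[of "a+t/2"] by (intro divide_left_mono) auto
  also have "\<dots> = 4 * 2 powr c2 * ((t/2) * ?h (t/2))"
    using assms t by (simp add: power2_eq_square field_simps)
  also have "\<dots> \<le> 4 * 2 powr c2 * shifted \<phi> a t" by (rule mult_left_mono[OF *]) simp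
  finally show ?thesis .
qed

lemma shifted_mono: "a > 0 \<Longrightarrow> s \<le> t \<Longrightarrow> shifted \<phi> a s \<le> shifted \<phi> a t"
  unfolding shifted_def set_lebesgue_integral_def
  using integrand_integrable[of a s] integrand_integrable[of a t] integrand_nonneg[of a]
  by (intro integral_mono) (auto simp: set_integrable_def indicator_def)

lemma shifted_measurable: "a > 0 \<Longrightarrow> shifted \<phi> a \<in> borel_measurable borel"
  by (intro borel_measurable_mono monoI shifted_mono)

text \<open>Bridge between the shift |z| in the inequality of (iv) and the shift 1 + |z| in uniform
  strict quasiconvexity: for a \<ge> 1 the numbers a + t and 1 + a + t differ by a factor of at most
  2.\<close>

lemma weight_suc:
  assumes "a \<ge> 1" "t \<ge> 0"
  shows "weight a t \<le> 2 * weight (1 + a) t" "weight (1 + a) t \<le> 2 powr c2 * weight a t"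
proof -
  have "deriv \<phi> (a+t) \<le> deriv \<phi> (1+a+t)" using assms by (intro deriv_mono) auto
  then have "t\<^sup>2 * deriv \<phi> (a + t) / (a + t) \<le> t\<^sup>2 * deriv \<phi> (1+a + t) / (a + t)"
    using assms by (intro divide_right_mono mult_left_mono) auto
  also have "\<dots> \<le> t\<^sup>2 * deriv \<phi> (1+a + t) / ((1+a + t)/2)"
    using assms pos[of "1+a+t"] by (intro divide_left_mono) auto
  finally show "weight a t \<le> 2 * weight (1 + a) t" by (simp add: weight_def ac_simps)
  have "deriv \<phi> (1+a+t) \<le> 2 powr c2 * deriv \<phi> (a+t)" using assms by (intro doubling) auto
  then have "t\<^sup>2 * deriv \<phi> (1+a + t) / (1+a + t) \<le> t\<^sup>2 * (2 powr c2 * deriv \<phi> (a + t)) / (1+a + t)"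
    using assms by (intro divide_right_mono mult_left_mono) auto
  also have "\<dots> \<le> t\<^sup>2 * (2 powr c2 * deriv \<phi> (a + t)) / (a + t)"
    using assms pos[of "a+t"] by (intro divide_left_mono) auto
  finally show "weight (1 + a) t \<le> 2 powr c2 * weight a t" by (simp add: weight_def ac_simps)
qed

end

text \<open>The existentially quantified one-sided derivative of an N-function agrees with
  \<open>deriv\<close> on the open half-line, where the locale states its estimates; at 0 only the
  value and continuity survive.\<close>

lemma N_function_orlicz:
  assumes "N_function \<phi>" and C2: "Ck_on 2 \<phi> {0<..}"
    and cmp: "comparable_on {0<..} (deriv \<phi>) (\<lambda>t. t * deriv (deriv \<phi>) t)"
  shows "\<exists>c1 c2. orlicz \<phi> c1 c2"
proof -
  obtain \<phi>' where p: "\<phi> 0 = 0" "\<And>t. t \<ge> 0 \<Longrightarrow> \<phi> t \<ge> 0"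
    "\<And>t. t\<ge>0 \<Longrightarrow> (\<phi> has_real_derivative \<phi>' t) (at t within {0..})"
    "\<And>t. t > 0 \<Longrightarrow> \<phi>' t > 0" "filterlim \<phi>' at_top at_top"
    using assms(1) unfolding N_function_def by auto
  have D: "(\<phi> has_real_derivative \<phi>' t) (at t)" if "t > 0" for t
  proof -
    have "at t within {0..} = at t" using that by (intro at_within_interior) auto
    then show ?thesis using p(3)[of t] that by simp
  qed
  then have eq: "deriv \<phi> t = \<phi>' t" if "t > 0" for t using that DERIV_imp_deriv by blast
  have "(\<lambda>x. frechet_derivative \<phi> (at x within {0<..}) 1) differentiable_on {0<..}"
    using C2 by (simp add: numeral_2_eq_2)
  then have diff: "(\<lambda>x. frechet_derivative \<phi> (at x within {0<..}) 1) differentiable at t" if "t > 0" for t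
    using that by (simp add: differentiable_on_def at_within_open[OF _ open_greaterThan])
  have fd: "frechet_derivative \<phi> (at x within {0<..}) 1 = deriv \<phi> x" if "x > 0" for x
  proof -
    have "(\<phi> has_derivative times (\<phi>' x)) (at x)" using D[OF that] by (simp add: has_field_derivative_def)
    then have "times (\<phi>' x) = frechet_derivative \<phi> (at x)" by (rule frechet_derivative_at)
    then have "frechet_derivative \<phi> (at x) 1 = \<phi>' x" by (metis mult.right_neutral)
    then show ?thesis using that eq by (simp add: at_within_open[OF _ open_greaterThan])
  qed
  have d2: "(deriv \<phi> has_real_derivative deriv (deriv \<phi>) t) (at t)" if "t > 0" for t
  proof -
    have "(deriv \<phi>) differentiable at t"
      using diff[OF that] fd that unfolding differentiable_def
      by (meson has_derivative_transform_within_open open_greaterThan greaterThan_iff)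
    then show ?thesis by (metis DERIV_deriv_iff_real_differentiable)
  qed
  obtain c1 c2 where c: "c1 > 0" "c2 > 0" "\<And>t. t > 0 \<Longrightarrow> c1 * deriv \<phi> t \<le> t * deriv (deriv \<phi>) t \<and> t * deriv (deriv \<phi>) t \<le> c2 * deriv \<phi> t"
    using cmp unfolding comparable_on_def by auto
  have "continuous_on {0..} \<phi>" using p(3) by (meson DERIV_continuous_on atLeast_iff)
  moreover have "filterlim (deriv \<phi>) at_top at_top"
    using p(5) by (rule filterlim_cong[THEN iffD1, rotated 3, OF _])
      (auto intro!: eventually_mono[OF eventually_gt_at_top[of 0]] simp: eq)
  ultimately have "orlicz \<phi> c1 c2"
    using p D c d2 eq by unfold_locales auto
  then show ?thesis by blast
qed

section \<open>Cut-off functions and Bregman estimates\<close>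

text \<open>From exponent 2 on the two branches fit together at 0: the difference quotient there is
  at most |h|^(n+1) in absolute value.\<close>

lemma DERIV_pos_part_power:
  fixes x :: real
  shows "((\<lambda>x. max 0 x ^ Suc (Suc n)) has_real_derivative real (Suc (Suc n)) * max 0 x ^ Suc n) (at x)"
proof (cases x "0::real" rule: linorder_cases)
  case less
  have "((\<lambda>x. 0::real) has_real_derivative 0) (at x)" by simp
  then have "((\<lambda>x. max 0 x ^ Suc (Suc n)) has_real_derivative 0) (at x)"
    by (rule has_field_derivative_transform_within_open[of _ _ _ "{..<0}"]) (use less in auto)
  then show ?thesis using less by simp
next
  case greater
  have "((\<lambda>x. x ^ Suc (Suc n)) has_real_derivative real (Suc (Suc n)) * x ^ Suc n) (at x)"
    using DERIV_pow[of "Suc (Suc n)" x] by simp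
  then have "((\<lambda>x. max 0 x ^ Suc (Suc n)) has_real_derivative real (Suc (Suc n)) * x ^ Suc n) (at x)"
    by (rule has_field_derivative_transform_within_open[of _ _ _ "{0<..}"]) (use greater in \<open>auto simp: max_def\<close>)
  then show ?thesis using greater by (simp add: max_def)
next
  case equal
  have "((\<lambda>x::real. max 0 x ^ Suc (Suc n)) has_real_derivative 0) (at 0)"
    unfolding DERIV_def
  proof (rule Lim_null_comparison)
    show "\<forall>\<^sub>F h in at 0. norm ((max 0 (0 + h) ^ Suc (Suc n) - max 0 0 ^ Suc (Suc n)) / h) \<le> \<bar>h\<bar> ^ Suc n"
      by (auto simp: eventually_at_filter max_def abs_mult mult_nonpos_nonneg intro!: always_eventually)
    show "(\<lambda>h::real. \<bar>h\<bar> ^ Suc n) \<midarrow>0\<rightarrow> 0" by (auto intro!: tendsto_eq_intros)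
  qed
  then show ?thesis using equal by simp
qed

lemma DERIV_pos_part_square: "((\<lambda>x. (max 0 x)\<^sup>2) has_real_derivative 2 * max 0 x) (at x)"
  using DERIV_pos_part_power[of 0 x] by (simp add: numeral_2_eq_2)

lemma DERIV_pos_part_cube: "((\<lambda>x. max 0 x ^ 3) has_real_derivative 3 * (max 0 x)\<^sup>2) (at x)"
  using DERIV_pos_part_power[of 1 x] by (simp add: numeral_3_eq_3 numeral_2_eq_2)

text \<open>A \<open>C\<^sup>2\<close> transition from \<open>0\<close> on \<open>{..1}\<close> to \<open>1\<close> on \<open>{2..}\<close>; \<open>cut1\<close> and \<open>cut2\<close> are its derivatives.\<close>

definition cutoff :: "real \<Rightarrow> real" where
  "cutoff s = 1 - max 0 (1 - max 0 (s - 1) ^ 3) ^ 3"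
definition cut1 :: "real \<Rightarrow> real" where
  "cut1 s = 9 * max 0 (1 - max 0 (s - 1) ^ 3) ^ 2 * max 0 (s - 1) ^ 2"
definition cut2 :: "real \<Rightarrow> real" where
  "cut2 s = 18 * max 0 (1 - max 0 (s - 1) ^ 3) ^ 2 * max 0 (s - 1)
    - 54 * max 0 (1 - max 0 (s - 1) ^ 3) * max 0 (s - 1) ^ 4"

lemma DERIV_cut_inner: "((\<lambda>s. 1 - max 0 (s - 1) ^ 3) has_real_derivative - (3 * max 0 (s - 1) ^ 2)) (at s)"
  by (rule derivative_eq_intros DERIV_chain2[OF DERIV_pos_part_cube] refl)+ simp

lemma DERIV_cut: "(cutoff has_real_derivative cut1 s) (at s)"
proof -
  have "((\<lambda>s. max 0 (1 - max 0 (s - 1) ^ 3) ^ 3) has_real_derivative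
     (3 * max 0 (1 - max 0 (s - 1) ^ 3) ^ 2) * - (3 * max 0 (s - 1) ^ 2)) (at s)"
    by (rule DERIV_chain2[OF DERIV_pos_part_cube DERIV_cut_inner])
  from DERIV_diff[OF DERIV_const[of 1] this] show ?thesis
    unfolding cutoff_def[abs_def] cut1_def by (simp add: mult.assoc)
qed

lemma DERIV_cut1: "(cut1 has_real_derivative cut2 s) (at s)"
proof -
  have 1: "((\<lambda>s. max 0 (1 - max 0 (s - 1) ^ 3) ^ 2) has_real_derivative
     (2 * max 0 (1 - max 0 (s - 1) ^ 3)) * - (3 * max 0 (s - 1) ^ 2)) (at s)"
    by (rule DERIV_chain2[OF DERIV_pos_part_square DERIV_cut_inner])
  have 2: "((\<lambda>s. max 0 (s - 1) ^ 2) has_real_derivative 2 * max 0 (s - 1)) (at s)"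
  proof -
    have "((\<lambda>s::real. s - 1) has_real_derivative 1) (at s)" by (auto intro!: derivative_eq_intros)
    from DERIV_chain2[OF DERIV_pos_part_square this] show ?thesis by simp
  qed
  show ?thesis
    unfolding cut1_def[abs_def] cut2_def
    by (rule derivative_eq_intros 1 2 refl)+ (simp add: algebra_simps power4_eq_xxxx power2_eq_square)
qed

lemma cut_low: "s \<le> 1 \<Longrightarrow> cutoff s = 0" "s \<le> 1 \<Longrightarrow> cut1 s = 0" "s \<le> 1 \<Longrightarrow> cut2 s = 0"
  by (auto simp: cutoff_def cut1_def cut2_def)

lemma cut_high: assumes "s \<ge> 2" shows "cutoff s = 1" "cut1 s = 0" "cut2 s = 0"
proof -
  have "(s-1)^3 \<ge> 1" using assms by (intro one_le_power) auto
  moreover have "max 0 (s - 1) = s - 1" using assms by simp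
  ultimately have "max 0 (1 - max 0 (s - 1) ^ 3) = 0" by (metis diff_le_0_iff_le max.absorb1)
  then show "cutoff s = 1" "cut1 s = 0" "cut2 s = 0" by (simp_all add: cutoff_def cut1_def cut2_def)
qed

text \<open>On the transition zone both a and b lie in the unit interval, so the bounds are sums of
  absolute values of coefficients: 9, and 72 = 18 + 54.\<close>

lemma cut_bounds: "0 \<le> cutoff s" "cutoff s \<le> 1" "\<bar>cut1 s\<bar> \<le> 9" "\<bar>cut2 s\<bar> \<le> 72"
proof -
  define b where "b = max 0 (s - 1)"
  define a where "a = max 0 (1 - b^3)"
  have b: "0 \<le> b" by (simp add: b_def)
  have a: "0 \<le> a" "a \<le> 1" using b by (auto simp: a_def)
  have c: "cutoff s = 1 - a^3" "cut1 s = 9 * a^2 * b^2" "cut2 s = 18 * a^2 * b - 54 * a * b^4"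
    by (simp_all add: cutoff_def cut1_def cut2_def a_def b_def)
  show "0 \<le> cutoff s" "cutoff s \<le> 1" using a by (auto simp: c power_le_one)
  show "\<bar>cut1 s\<bar> \<le> 9" "\<bar>cut2 s\<bar> \<le> 72"
  proof -
    consider "s \<ge> 2" | "b \<le> 1" by (force simp: b_def)
    then have "\<bar>cut1 s\<bar> \<le> 9 \<and> \<bar>cut2 s\<bar> \<le> 72"
    proof cases
      case 2
      have "a^2 * b^2 \<le> 1" "a^2 * b \<le> 1" "a * b^4 \<le> 1" using a b 2
        by (auto intro!: mult_le_one power_le_one)
      moreover have "0 \<le> a^2 * b^2" "0 \<le> a^2*b" "0 \<le> a * b^4" using a b by auto
      ultimately show ?thesis unfolding c by (auto simp: abs_le_iff)
    qed (simp add: cut_high)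
    then show "\<bar>cut1 s\<bar> \<le> 9" "\<bar>cut2 s\<bar> \<le> 72" by auto
  qed
qed

section \<open>Taylor remainders measured by the weight\<close>

lemma taylor2:
  fixes p p1 p2 :: "real \<Rightarrow> real"
  assumes "a < b" "\<And>t. a \<le> t \<Longrightarrow> t \<le> b \<Longrightarrow> (p has_real_derivative p1 t) (at t)"
    "\<And>t. a \<le> t \<Longrightarrow> t \<le> b \<Longrightarrow> (p1 has_real_derivative p2 t) (at t)"
  shows "\<exists>t. a < t \<and> t < b \<and> p b = p a + p1 a * (b - a) + p2 t / 2 * (b - a)\<^sup>2"
proof -
  define d where "d = (\<lambda>n::nat. if n = 0 then p else if n = 1 then p1 else p2)"
  have "\<forall>m t. m < 2 \<and> a \<le> t \<and> t \<le> b \<longrightarrow> (d m has_real_derivative d (Suc m) t) (at t)"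
    using assms by (auto simp: d_def less_Suc_eq numeral_2_eq_2)
  from Taylor_up[of 2 d p a b a, OF _ _ this] assms(1)
  show ?thesis by (auto simp: d_def numeral_2_eq_2)
qed

text \<open>Subtracting the initial slope from the convex function p leaves q, nondecreasing on
  [0, 1]. A quarter interval with second derivative at least m contributes m (1/4)^2 / 2 = m/32, and
  nothing is lost elsewhere. Only a quarter is used because the rest of a segment may come close to
  the origin, where a comparable lower bound can fail.\<close>

lemma bregman_lower_1d:
  fixes p p1 p2 :: "real \<Rightarrow> real"
  assumes p: "\<And>t. (p has_real_derivative p1 t) (at t)" "\<And>t. (p1 has_real_derivative p2 t) (at t)"
    and nn: "\<And>t. p2 t \<ge> 0" and a: "0 \<le> a" "a + 1/4 \<le> 1"
    and m: "\<And>t. a \<le> t \<Longrightarrow> t \<le> a + 1/4 \<Longrightarrow> p2 t \<ge> m"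
  shows "p 1 - p 0 - p1 0 \<ge> m / 32"
proof -
  have mono: "p1 s \<le> p1 t" if "s \<le> t" for s t
    using that by (rule DERIV_nonneg_imp_nondecreasing) (use p nn in blast)
  define q where "q = (\<lambda>t. p t - p1 0 * t)"
  have q: "(q has_real_derivative p1 t - p1 0) (at t)" for t
    unfolding q_def by (auto intro!: derivative_eq_intros p)
  have qm: "q s \<le> q t" if "0 \<le> s" "s \<le> t" for s t
    using that(2) by (rule DERIV_nonneg_imp_nondecreasing) (use q mono that in \<open>force\<close>)
  obtain t where t: "a < t" "t < a + 1/4" and
    "p (a+1/4) = p a + p1 a * (a + 1/4 - a) + p2 t / 2 * (a + 1/4 - a)\<^sup>2"
    using taylor2[of a "a+1/4" p p1 p2] p by auto
  then have "p (a+1/4) = p a + p1 a / 4 + p2 t / 32" by (simp add: power2_eq_square)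
  moreover have "p2 t \<ge> m" using m t by auto
  moreover have "p1 a \<ge> p1 0" using mono a by auto
  ultimately have "q (a+1/4) \<ge> q a + m / 32" by (simp add: q_def algebra_simps)
  moreover have "q 1 \<ge> q (a+1/4)" "q a \<ge> q 0" using qm a by auto
  ultimately show ?thesis by (simp add: q_def)
qed

context orlicz begin

text \<open>\<phi>'(t)/t need not be monotone in either direction. On a range of bounded ratio it is
  still comparable with itself, by monotonicity of \<phi>' one way and by doubling the other
  way.\<close>

lemma rate_le:
  assumes "0 < s" "s \<le> S" "S \<le> N * s"
  shows "deriv \<phi> s / s \<le> N * (deriv \<phi> S / S)" "deriv \<phi> S / S \<le> N powr c2 * (deriv \<phi> s / s)"
proof -
  have "deriv \<phi> s / s \<le> deriv \<phi> S / s" using assms deriv_mono[of s S] by (simp add: divide_right_mono)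
  also have "\<dots> \<le> N * (deriv \<phi> S / S)"
  proof -
    have "deriv \<phi> S * S \<le> deriv \<phi> S * (N * s)" using assms pos[of S] by (intro mult_left_mono) auto
    then show ?thesis using assms by (simp add: field_simps)
  qed
  finally show "deriv \<phi> s / s \<le> N * (deriv \<phi> S / S)" .
  have "deriv \<phi> S / S \<le> deriv \<phi> S / s" using assms pos[of S] by (intro divide_left_mono) auto
  also have "\<dots> \<le> N powr c2 * deriv \<phi> s / s" using doubling[OF assms] assms by (intro divide_right_mono) auto
  finally show "deriv \<phi> S / S \<le> N powr c2 * (deriv \<phi> s / s)" by simp
qed

text \<open>Two regimes. If |y| \<le> (1 + |z|)/2, then 1 + norm is comparable to S = 1 + |z| + |y|
  along the whole segment (factor 3) and Taylor's formula with \<open>W2\<close> applies. Otherwise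
  S \<le> 3|y|, there is no cancellation to exploit, and each of the three terms is at most e S
  \<phi>'(S); 27 is three terms times 3^2.\<close>

lemma bregman_upper:
  fixes W :: "'a::real_normed_vector \<Rightarrow> real" and W1 W2 :: "'a \<Rightarrow> 'a \<Rightarrow> real"
  assumes e: "e \<ge> 0"
    and p1: "\<And>z y t. ((\<lambda>t. W (z + t *\<^sub>R y)) has_real_derivative W1 (z + t *\<^sub>R y) y) (at t)"
    and p2: "\<And>z y t. ((\<lambda>t. W1 (z + t *\<^sub>R y) y) has_real_derivative W2 (z + t *\<^sub>R y) y) (at t)"
    and b0: "\<And>z. \<bar>W z\<bar> \<le> e * ((1 + norm z) * deriv \<phi> (1 + norm z))"
    and b1: "\<And>z y. \<bar>W1 z y\<bar> \<le> e * (deriv \<phi> (1 + norm z) * norm y)"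
    and b2: "\<And>z y. \<bar>W2 z y\<bar> \<le> e * (deriv \<phi> (1 + norm z) / (1 + norm z) * (norm y)\<^sup>2)"
  shows "\<bar>W (z + y) - W z - W1 z y\<bar> \<le> 27 * e * weight (1 + norm z) (norm y)"
proof -
  define S where "S = 1 + norm z + norm y"
  have S: "S \<ge> 1" by (simp add: S_def)
  have w: "weight (1 + norm z) (norm y) = (norm y)\<^sup>2 * (deriv \<phi> S / S)" by (simp add: weight_def S_def)
  have wn: "weight (1 + norm z) (norm y) \<ge> 0" by (rule weight_nonneg) (auto simp: add_pos_nonneg)
  show ?thesis
  proof (cases "norm y \<le> (1 + norm z) / 2")
    case True
    obtain t where t: "0 < t" "t < 1" and
      eq: "W (z + y) = W z + W1 z y + W2 (z + t *\<^sub>R y) y / 2"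
      using taylor2[of 0 1 "\<lambda>t. W (z + t *\<^sub>R y)" "\<lambda>t. W1 (z + t *\<^sub>R y) y" "\<lambda>t. W2 (z + t *\<^sub>R y) y"] p1 p2
      by auto
    define s where "s = 1 + norm (z + t *\<^sub>R y)"
    have ty: "norm (t *\<^sub>R y) \<le> norm y" using t by (simp add: mult_left_le_one_le)
    have "s \<le> S" unfolding s_def S_def using norm_triangle_ineq[of z "t *\<^sub>R y"] ty by linarith
    moreover have "s \<ge> 1 + norm z - norm y" unfolding s_def
      using norm_diff_ineq[of z "t *\<^sub>R y"] ty by linarith
    then have "S \<le> 3 * s" using True unfolding S_def by (simp add: field_simps)
    ultimately have "deriv \<phi> s / s \<le> 3 * (deriv \<phi> S / S)"
      by (intro rate_le) (auto simp: s_def add_pos_nonneg)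
    then have "deriv \<phi> s / s * (norm y)\<^sup>2 \<le> 3 * (deriv \<phi> S / S) * (norm y)\<^sup>2" by (intro mult_right_mono) auto
    then have "e * (deriv \<phi> s / s * (norm y)\<^sup>2) \<le> e * (3 * weight (1 + norm z) (norm y))"
      using e by (intro mult_left_mono) (simp_all add: w mult_ac)
    then have "\<bar>W2 (z + t *\<^sub>R y) y\<bar> \<le> e * (3 * weight (1 + norm z) (norm y))"
      using b2[of "z + t *\<^sub>R y" y] by (simp add: s_def)
    then have "\<bar>W (z + y) - W z - W1 z y\<bar> \<le> e * (3 * weight (1 + norm z) (norm y))"
      unfolding eq by simp
    also have "\<dots> \<le> 27 * e * weight (1 + norm z) (norm y)" using e wn by simp
    finally show ?thesis .
  next
    case False
    then have Sy: "S \<le> 3 * norm y" by (simp add: S_def)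
    have m: "s * deriv \<phi> s \<le> S * deriv \<phi> S" if "0 < s" "s \<le> S" for s
      using that pos[of s] by (intro mult_mono deriv_mono) auto
    have "\<bar>W (z+y)\<bar> \<le> e * (S * deriv \<phi> S)"
      by (rule order_trans[OF b0]) (intro mult_left_mono e m, auto simp: S_def add_pos_nonneg norm_triangle_ineq)
    moreover have "\<bar>W z\<bar> \<le> e * (S * deriv \<phi> S)"
      by (rule order_trans[OF b0]) (intro mult_left_mono e m, auto simp: S_def add_pos_nonneg)
    moreover have "deriv \<phi> (1 + norm z) * norm y \<le> S * deriv \<phi> S"
      using pos[of S] S by (subst mult.commute, intro mult_mono deriv_mono) (auto simp: S_def add_pos_nonneg)
    then have "\<bar>W1 z y\<bar> \<le> e * (S * deriv \<phi> S)"
      by (intro order_trans[OF b1] mult_left_mono e)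
    ultimately have "\<bar>W (z + y) - W z - W1 z y\<bar> \<le> 3 * e * (S * deriv \<phi> S)" by linarith
    also have "\<dots> = 3 * e * (S\<^sup>2 * (deriv \<phi> S / S))" using S by (simp add: power2_eq_square)
    also have "\<dots> \<le> 3 * e * ((3 * norm y)\<^sup>2 * (deriv \<phi> S / S))"
      using S Sy e pos[of S] by (intro mult_left_mono mult_right_mono power_mono) auto
    also have "\<dots> = 27 * e * weight (1 + norm z) (norm y)" by (simp add: w power2_eq_square)
    finally show ?thesis .
  qed
qed

lemma bregman_lower:
  fixes W :: "'a::real_normed_vector \<Rightarrow> real" and W1 W2 :: "'a \<Rightarrow> 'a \<Rightarrow> real"
  assumes e: "e \<ge> 0"
    and p1: "\<And>z y t. ((\<lambda>t. W (z + t *\<^sub>R y)) has_real_derivative W1 (z + t *\<^sub>R y) y) (at t)"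
    and p2: "\<And>z y t. ((\<lambda>t. W1 (z + t *\<^sub>R y) y) has_real_derivative W2 (z + t *\<^sub>R y) y) (at t)"
    and b2: "\<And>z y. W2 z y \<ge> e * (deriv \<phi> (1 + norm z) / (1 + norm z) * (norm y)\<^sup>2)"
  shows "W (z + y) - W z - W1 z y \<ge> e / (32 * 6 powr c2) * weight (1 + norm z) (norm y)"
proof -
  define S where "S = 1 + norm z + norm y"
  have S: "S \<ge> 1" by (simp add: S_def)
  have w: "weight (1 + norm z) (norm y) = (norm y)\<^sup>2 * (deriv \<phi> S / S)" by (simp add: weight_def S_def)
  define m where "m = e / 6 powr c2 * weight (1 + norm z) (norm y)"
  \<comment> \<open>The chosen quarter of the segment keeps 1 + |z + ty| above S/6: the first
    quarter when |y| \<le> 2|z|, the last one when y dominates.\<close>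
  define a :: real where "a = (if norm y \<le> 2 * norm z then 0 else 3/4)"
  have "W (z + 1 *\<^sub>R y) - W (z + 0 *\<^sub>R y) - W1 (z + 0 *\<^sub>R y) y \<ge> m / 32"
  proof (rule bregman_lower_1d[OF p1 p2, of _ _ a])
    show "0 \<le> W2 (z + t *\<^sub>R y) y" for t
      by (rule order_trans[OF _ b2]) (use e pos[of "1 + norm (z + t *\<^sub>R y)"] in \<open>simp add: add_pos_nonneg\<close>)
    show "0 \<le> a" "a + 1/4 \<le> 1" by (auto simp: a_def)
    fix t assume t: "a \<le> t" "t \<le> a + 1/4"
    then have t01: "0 \<le> t" "t \<le> 1" by (auto simp: a_def split: if_splits)
    define s where "s = 1 + norm (z + t *\<^sub>R y)"
    have ty: "norm (t *\<^sub>R y) = t * norm y" using t01 by simp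
    have tl: "t * norm y \<le> norm y" using t01 by (simp add: mult_left_le_one_le)
    have sS: "s \<le> S" unfolding s_def S_def using norm_triangle_ineq[of z "t *\<^sub>R y"] ty tl by linarith
    have Ss: "S \<le> 6 * s"
    proof (cases "norm y \<le> 2 * norm z")
      case True
      then have "t * norm y \<le> 1/4 * norm y" using t by (intro mult_right_mono) (auto simp: a_def)
      then have "s \<ge> 1 + norm z - norm y / 4" unfolding s_def
        using norm_diff_ineq[of z "t *\<^sub>R y"] ty by linarith
      then show ?thesis unfolding S_def using True by (simp add: field_simps)
    next
      case False
      then have "t * norm y \<ge> 3/4 * norm y" using t by (intro mult_right_mono) (auto simp: a_def)
      moreover have "norm (z + t *\<^sub>R y) \<ge> t * norm y - norm z"
        using norm_diff_ineq[of "t *\<^sub>R y" z] by (simp only: ty add.commute)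
      ultimately have "norm (z + t *\<^sub>R y) \<ge> norm y / 4" using False by linarith
      then show ?thesis unfolding s_def S_def using False by simp
    qed
    have "deriv \<phi> S / S \<le> 6 powr c2 * (deriv \<phi> s / s)"
      by (rule rate_le[OF _ sS Ss]) (auto simp: s_def add_pos_nonneg)
    then have "(deriv \<phi> S / S) / 6 powr c2 \<le> deriv \<phi> s / s"
      using mult_imp_div_pos_le[of "6 powr c2" "deriv \<phi> S / S" "deriv \<phi> s / s"] by (simp add: mult_ac)
    then have "e * ((deriv \<phi> S / S) / 6 powr c2 * (norm y)\<^sup>2) \<le> e * (deriv \<phi> s / s * (norm y)\<^sup>2)"
      using e by (intro mult_left_mono mult_right_mono) auto
    also have "\<dots> \<le> W2 (z + t *\<^sub>R y) y" using b2[of "z + t *\<^sub>R y" y] by (simp add: s_def)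
    finally show "m \<le> W2 (z + t *\<^sub>R y) y" by (simp add: m_def w ac_simps)
  qed
  then show ?thesis by (simp add: m_def)
qed

end

section \<open>Growth at infinity deduced from second derivatives\<close>

text \<open>Integration along rays that start on the sphere of radius R: both B + h and B - h are
  nondecreasing there.\<close>

lemma radial_growth:
  fixes h :: "'a::real_normed_vector \<Rightarrow> real"
  assumes R: "R > 0"
    and h: "\<And>z. norm z \<ge> R \<Longrightarrow> (h has_derivative h' z) (at z)"
    and B: "\<And>r. r \<ge> R \<Longrightarrow> (B has_real_derivative B' r) (at r)"
    and le: "\<And>z v. norm z \<ge> R \<Longrightarrow> \<bar>h' z v\<bar> \<le> B' (norm z) * norm v"
    and C: "\<And>z. norm z = R \<Longrightarrow> \<bar>h z\<bar> \<le> C"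
    and z: "norm z \<ge> R"
  shows "\<bar>h z\<bar> \<le> C + (B (norm z) - B R)"
proof -
  define v where "v = z /\<^sub>R norm z"
  have nv: "norm v = 1" using z R by (auto simp: v_def field_simps)
  have zv: "norm z *\<^sub>R v = z" using z R by (cases "norm z = 0"; auto simp: v_def divide_inverse[symmetric])
  have d: "((\<lambda>r. h (r *\<^sub>R v)) has_real_derivative h' (r *\<^sub>R v) v) (at r)" if "r \<ge> R" for r
  proof -
    have lin: "linear (h' (r *\<^sub>R v))" using h[of "r *\<^sub>R v"] that R nv by (auto intro!: has_derivative_linear)
    have "((\<lambda>r. h (r *\<^sub>R v)) has_derivative (\<lambda>t. h' (r *\<^sub>R v) (t *\<^sub>R v))) (at r)"
      by (rule has_derivative_compose[of "\<lambda>r. r *\<^sub>R v" "\<lambda>t. t *\<^sub>R v"])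
        (use that R nv in \<open>auto intro!: h derivative_eq_intros\<close>)
    moreover have "(\<lambda>t. h' (r *\<^sub>R v) (t *\<^sub>R v)) = times (h' (r *\<^sub>R v) v)"
      by (auto simp: linear_scale[OF lin])
    ultimately show ?thesis by (simp add: has_field_derivative_def)
  qed
  have l: "\<bar>h' (r *\<^sub>R v) v\<bar> \<le> B' r" if "r \<ge> R" for r
    using le[of "r *\<^sub>R v" v] that R nv by simp
  have "B R - h (R *\<^sub>R v) \<le> B (norm z) - h (norm z *\<^sub>R v)"
    using z by (rule DERIV_nonneg_imp_nondecreasing) (use l in \<open>force intro!: DERIV_diff B d\<close>)
  moreover have "B R + h (R *\<^sub>R v) \<le> B (norm z) + h (norm z *\<^sub>R v)"
    using z by (rule DERIV_nonneg_imp_nondecreasing) (use l in \<open>force intro!: DERIV_add B d\<close>)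
  moreover have "\<bar>h (R *\<^sub>R v)\<bar> \<le> C" using C R nv by simp
  ultimately show ?thesis unfolding zv by linarith
qed

text \<open>Smallness over all directions is reduced to finitely many directions, each of which may
  have its own threshold radius.\<close>

lemma linear_bound_Basis:
  fixes L :: "'a::euclidean_space \<Rightarrow> real"
  assumes "linear L" "\<And>i. i \<in> Basis \<Longrightarrow> \<bar>L i\<bar> \<le> B"
  shows "\<bar>L v\<bar> \<le> real DIM('a) * B * norm v"
proof -
  have "\<bar>L v\<bar> = \<bar>\<Sum>i\<in>Basis. (v \<bullet> i) * L i\<bar>"
    by (subst (1) euclidean_representation[of v, symmetric])
      (simp add: linear_sum[OF assms(1)] linear_scale[OF assms(1)])
  also have "\<dots> \<le> (\<Sum>i\<in>(Basis::'a set). norm v * B)"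
    by (rule order_trans[OF sum_abs]) (intro sum_mono, auto simp: abs_mult Basis_le_norm intro!: mult_mono assms(2))
  finally show ?thesis by (simp add: mult_ac)
qed

lemma has_derivative_line:
  fixes h :: "'a::real_normed_vector \<Rightarrow> real"
  assumes "(h has_derivative h') (at (z + t *\<^sub>R y))"
  shows "((\<lambda>t. h (z + t *\<^sub>R y)) has_real_derivative h' y) (at t)"
proof -
  have "((\<lambda>t. h (z + t *\<^sub>R y)) has_derivative (\<lambda>s. h' (s *\<^sub>R y))) (at t)"
    by (rule has_derivative_compose[where g = h and f = "\<lambda>t. z + t *\<^sub>R y", OF _ assms])
      (auto intro!: derivative_eq_intros)
  moreover have "(\<lambda>s. h' (s *\<^sub>R y)) = times (h' y)"
    using has_derivative_linear[OF assms] by (auto simp: linear_scale)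
  ultimately show ?thesis by (simp add: has_field_derivative_def)
qed

context orlicz begin

lemma eventually_norm_ge: "eventually (\<lambda>z. norm z \<ge> R) at_infinity"
  by (auto simp: eventually_at_infinity)

lemma eventually_deriv_norm_ge: "\<forall>\<^sub>F z in at_infinity. deriv \<phi> (norm z) \<ge> C"
  by (rule filterlim_compose[OF lim filterlim_norm_at_top, unfolded filterlim_at_top, rule_format])

lemma eventually_norm: "\<forall>\<^sub>F z in at_infinity. \<phi> (norm z) \<ge> C"
proof -
  define K where "K = 2 * 2 powr c2"
  have K: "K > 0" by (simp add: K_def)
  show ?thesis
    using eventually_deriv_norm_ge[of "K * \<bar>C\<bar>"] eventually_norm_ge[of 1]
  proof eventually_elim
    case (elim z)
    then have "K * \<bar>C\<bar> \<le> 1 * deriv \<phi> (norm z)" by simp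
    also have "\<dots> \<le> norm z * deriv \<phi> (norm z)" using elim pos[of "norm z"]
      by (intro mult_right_mono) (linarith | force)+
    also have "\<dots> \<le> K * \<phi> (norm z)" unfolding K_def using elim by (intro mult_deriv_le) auto
    finally show ?case using K by simp
  qed
qed

text \<open>The bound on \<open>u2\<close> is integrated twice along rays, turning \<phi>'' into
  \<phi>' and \<phi>' into \<phi>. The first integration is done for one basis vector at a time,
  since its constant on the sphere depends on the direction.\<close>

lemma small_second_derivative:
  fixes u :: "'a::euclidean_space \<Rightarrow> real" and u1 :: "'a \<Rightarrow> 'a \<Rightarrow> real" and u2 :: "'a \<Rightarrow> 'a \<Rightarrow> 'a \<Rightarrow> real"
  assumes u: "\<And>z. norm z > R0 \<Longrightarrow> (u has_derivative u1 z) (at z)"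
    and u1: "\<And>z v. norm z > R0 \<Longrightarrow> ((\<lambda>z. u1 z v) has_derivative u2 z v) (at z)"
    and small: "\<And>e. e > 0 \<Longrightarrow> \<forall>\<^sub>F z in at_infinity. \<forall>v w. \<bar>u2 z v w\<bar> \<le> e * deriv (deriv \<phi>) (norm z) * norm v * norm w"
    and e: "e > 0"
  shows "\<forall>\<^sub>F z in at_infinity. \<forall>v. \<bar>u1 z v\<bar> \<le> e * deriv \<phi> (norm z) * norm v"
    and "\<forall>\<^sub>F z in at_infinity. \<bar>u z\<bar> \<le> e * \<phi> (norm z)"
proof -
  have G1: "\<forall>\<^sub>F z in at_infinity. \<forall>v. \<bar>u1 z v\<bar> \<le> e * deriv \<phi> (norm z) * norm v" if e: "e > 0" for e
  proof -
    \<comment> \<open>The 2 pays for the constant of integration, the dimension for passing from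
      basis vectors to all v.\<close>
    define e' where "e' = e / (2 * real DIM('a))"
    have e': "e' > 0" using e by (simp add: e'_def)
    have one: "\<forall>\<^sub>F z in at_infinity. \<bar>u1 z i\<bar> \<le> 2 * e' * deriv \<phi> (norm z)" if i: "i \<in> Basis" for i
    proof -
      obtain R' where R': "\<And>z v w. norm z \<ge> R' \<Longrightarrow> \<bar>u2 z v w\<bar> \<le> e' * deriv (deriv \<phi>) (norm z) * norm v * norm w"
        using small[OF e'] by (auto simp: eventually_at_infinity)
      define R where "R = max 1 (max R' (R0 + 1))"
      have R: "R > 0" "R \<ge> R'" "R > R0" by (auto simp: R_def)
      have "continuous_on (sphere 0 R) (\<lambda>z. u1 z i)"
        using u1 R by (intro continuous_at_imp_continuous_on ballI has_derivative_continuous) auto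
      then obtain C where C: "\<And>z. norm z = R \<Longrightarrow> \<bar>u1 z i\<bar> \<le> C"
        using compact_imp_bounded[OF compact_continuous_image[OF _ compact_sphere, of 0 R]]
        by (force simp: bounded_iff)
      have b: "\<bar>u1 z i\<bar> \<le> C + (e' * deriv \<phi> (norm z) - e' * deriv \<phi> R)" if "norm z \<ge> R" for z
      proof (rule radial_growth[where h' = "\<lambda>z. u2 z i" and B' = "\<lambda>r. e' * deriv (deriv \<phi>) r", OF R(1) _ _ _ C that])
        show "((\<lambda>z. u1 z i) has_derivative u2 z i) (at z)" if "R \<le> norm z" for z using u1 R that by auto
        show "((\<lambda>r. e' * deriv \<phi> r) has_real_derivative e' * deriv (deriv \<phi>) r) (at r)" if "R \<le> r" for r
          using that R by (intro DERIV_cmult d2) auto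
        show "\<bar>u2 z i v\<bar> \<le> e' * deriv (deriv \<phi>) (norm z) * norm v" if "R \<le> norm z" for z v
          using R'[of z i v] that R i by auto
      qed
      show ?thesis
        using eventually_norm_ge[of R] eventually_deriv_norm_ge[of "(\<bar>C\<bar>+1)/e'"]
      proof eventually_elim
        case (elim z)
        have "\<bar>C\<bar> \<le> e' * deriv \<phi> (norm z)" using elim e' by (simp add: field_simps)
        moreover have "e' * deriv \<phi> R \<ge> 0" using pos[OF R(1)] e' by simp
        ultimately show ?case using b[OF elim(1)] by simp
      qed
    qed
    have "\<forall>\<^sub>F z in at_infinity. \<forall>i\<in>Basis. \<bar>u1 z i\<bar> \<le> 2 * e' * deriv \<phi> (norm z)"
      using one by (intro eventually_ball_finite) auto
    then show ?thesis using eventually_norm_ge[of "\<bar>R0\<bar> + 1"]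
    proof eventually_elim
      case (elim z)
      show ?case
      proof
        fix v
        have "linear (u1 z)" using has_derivative_linear[OF u[of z]] elim by auto
        from linear_bound_Basis[OF this, of "2 * e' * deriv \<phi> (norm z)" v] elim
        have "\<bar>u1 z v\<bar> \<le> real DIM('a) * (2 * e' * deriv \<phi> (norm z)) * norm v" by auto
        then show "\<bar>u1 z v\<bar> \<le> e * deriv \<phi> (norm z) * norm v" by (simp add: e'_def)
      qed
    qed
  qed
  show "\<forall>\<^sub>F z in at_infinity. \<forall>v. \<bar>u1 z v\<bar> \<le> e * deriv \<phi> (norm z) * norm v" by (rule G1[OF e])
  obtain R' where R': "\<And>z v. norm z \<ge> R' \<Longrightarrow> \<bar>u1 z v\<bar> \<le> e/2 * deriv \<phi> (norm z) * norm v"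
    using G1[of "e/2"] e by (auto simp: eventually_at_infinity)
  define R where "R = max 1 (max R' (R0 + 1))"
  have R: "R > 0" "R \<ge> R'" "R > R0" by (auto simp: R_def)
  have "continuous_on (sphere 0 R) u"
    using u R by (intro continuous_at_imp_continuous_on ballI has_derivative_continuous) auto
  then obtain C where C: "\<And>z. norm z = R \<Longrightarrow> \<bar>u z\<bar> \<le> C"
    using compact_imp_bounded[OF compact_continuous_image[OF _ compact_sphere, of 0 R]]
    by (force simp: bounded_iff)
  have b: "\<bar>u z\<bar> \<le> C + (e/2 * \<phi> (norm z) - e/2 * \<phi> R)" if "norm z \<ge> R" for z
  proof (rule radial_growth[where h' = u1 and B' = "\<lambda>r. e/2 * deriv \<phi> r", OF R(1) _ _ _ C that])
    show "(u has_derivative u1 z) (at z)" if "R \<le> norm z" for z using u R that by auto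
    show "((\<lambda>r. e/2 * \<phi> r) has_real_derivative e/2 * deriv \<phi> r) (at r)" if "R \<le> r" for r
      using that R by (intro DERIV_cmult d1) auto
    show "\<bar>u1 z v\<bar> \<le> e/2 * deriv \<phi> (norm z) * norm v" if "R \<le> norm z" for z v
      using R'[of z v] that R by auto
  qed
  show "\<forall>\<^sub>F z in at_infinity. \<bar>u z\<bar> \<le> e * \<phi> (norm z)"
    using eventually_norm_ge[of R] eventually_norm[of "(\<bar>C\<bar>+1)/(e/2)"]
  proof eventually_elim
    case (elim z)
    have "\<bar>C\<bar> \<le> e/2 * \<phi> (norm z)" using elim e by (simp add: field_simps)
    moreover have "e/2 * \<phi> R \<ge> 0" using nonneg[of R] R e by simp
    ultimately show ?case using b[OF elim(1)] by simp
  qed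
qed

text \<open>Each derivative falling on the cut-off costs a factor of order 1/R, and on the
  transition zone |z| is between R and sqrt 2 R, so the factor is of order 1/|z|. The bounds e
  \<phi>, e \<phi>' and e \<phi>'' for u and its derivatives differ by the same factor up to
  constants. Every term of the product rule therefore has the size that \<open>bregman_upper\<close>
  asks for.\<close>

lemma cutoff_small:
  fixes u :: "'a::euclidean_space \<Rightarrow> real" and u1 :: "'a \<Rightarrow> 'a \<Rightarrow> real" and u2 :: "'a \<Rightarrow> 'a \<Rightarrow> 'a \<Rightarrow> real"
  assumes u: "\<And>z. norm z > R0 \<Longrightarrow> (u has_derivative u1 z) (at z)"
    and u1: "\<And>z v. norm z > R0 \<Longrightarrow> ((\<lambda>z. u1 z v) has_derivative u2 z v) (at z)"
    and small: "\<And>e. e > 0 \<Longrightarrow> \<forall>\<^sub>F z in at_infinity. \<forall>v w. \<bar>u2 z v w\<bar> \<le> e * deriv (deriv \<phi>) (norm z) * norm v * norm w"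
    and d: "d > 0"
  shows "\<exists>R>B. \<exists>W1. (\<forall>z. ((\<lambda>z. cutoff ((z \<bullet> z) / R\<^sup>2) * u z) has_derivative W1 z) (at z)) \<and>
    (\<forall>z y. \<bar>cutoff (((z+y) \<bullet> (z+y)) / R\<^sup>2) * u (z+y) - cutoff ((z \<bullet> z) / R\<^sup>2) * u z - W1 z y\<bar>
       \<le> d * weight (1 + norm z) (norm y))"
proof -
  \<comment> \<open>27 comes from \<open>bregman_upper\<close>. In \<open>W2\<close> the terms with
    a differentiated cut-off add up to 1260 = 1152 + 36 + 2 * 36, and c2 belongs to the term with
    \<open>u2\<close>. The 2 is the price of replacing |z| by 1 + |z|.\<close>
  define e where "e = d / (27 * (2 * (1260 + c2)))"
  have e: "e > 0" using d c2 by (simp add: e_def)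
  have "\<forall>\<^sub>F z in at_infinity. (\<forall>v w. \<bar>u2 z v w\<bar> \<le> e * deriv (deriv \<phi>) (norm z) * norm v * norm w) \<and>
     (\<forall>v. \<bar>u1 z v\<bar> \<le> e * deriv \<phi> (norm z) * norm v) \<and> \<bar>u z\<bar> \<le> e * \<phi> (norm z)"
    using small[OF e] small_second_derivative[OF u u1 small e] by (auto intro!: eventually_conj)
  then obtain R' where R': "\<And>z v w. norm z \<ge> R' \<Longrightarrow> \<bar>u2 z v w\<bar> \<le> e * deriv (deriv \<phi>) (norm z) * norm v * norm w"
    "\<And>z v. norm z \<ge> R' \<Longrightarrow> \<bar>u1 z v\<bar> \<le> e * deriv \<phi> (norm z) * norm v"
    "\<And>z. norm z \<ge> R' \<Longrightarrow> \<bar>u z\<bar> \<le> e * \<phi> (norm z)"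
    unfolding eventually_at_infinity by blast
  define R where "R = max 1 (max R' (max (R0 + 1) (B + 1)))"
  have R: "R \<ge> 1" "R \<ge> R'" "R > R0" "R > B" by (auto simp: R_def)
  define q where "q = (\<lambda>z::'a. (z \<bullet> z) / R\<^sup>2)"
  define W where "W = (\<lambda>z. cutoff (q z) * u z)"
  define W1 where "W1 = (\<lambda>z y. cut1 (q z) * (2 * (z \<bullet> y) / R\<^sup>2) * u z + cutoff (q z) * u1 z y)"
  define W2 where "W2 = (\<lambda>z y. cut2 (q z) * (2 * (z \<bullet> y) / R\<^sup>2) * (2 * (z \<bullet> y) / R\<^sup>2) * u z
     + cut1 (q z) * (2 * (y \<bullet> y) / R\<^sup>2) * u z + cut1 (q z) * (2 * (z \<bullet> y) / R\<^sup>2) * u1 z y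
     + cut1 (q z) * (2 * (z \<bullet> y) / R\<^sup>2) * u1 z y + cutoff (q z) * u2 z y y)"
  have qd: "(q has_derivative (\<lambda>y. 2 * (z \<bullet> y) / R\<^sup>2)) (at z)" for z
    unfolding q_def divide_inverse
    by (auto intro!: derivative_eq_intros simp: inner_commute algebra_simps)
  have lo: "cutoff (q z) = 0" "cut1 (q z) = 0" "cut2 (q z) = 0" if "norm z \<le> R" for z
  proof -
    have "q z \<le> 1" using that R power_mono[of "norm z" R 2]
      by (simp add: q_def power2_norm_eq_inner[symmetric] divide_le_eq)
    then show "cutoff (q z) = 0" "cut1 (q z) = 0" "cut2 (q z) = 0" by (simp_all add: cut_low)
  qed
  have Wd: "(W has_derivative W1 z) (at z)" for z
  proof (cases "norm z < R")
    case True
    have "((\<lambda>z::'a. 0::real) has_derivative (\<lambda>y. 0)) (at z)" by simp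
    then have "(W has_derivative (\<lambda>y. 0)) (at z)"
      by (rule has_derivative_transform_within_open[of _ _ _ _ "ball 0 R"]) (use True lo in \<open>auto simp: W_def\<close>)
    then show ?thesis using True lo[of z] by (simp add: W1_def)
  next
    case False
    then have z: "norm z > R0" using R by simp
    have "((\<lambda>z. cutoff (q z)) has_derivative (\<lambda>y. cut1 (q z) * (2 * (z \<bullet> y) / R\<^sup>2))) (at z)"
      using has_derivative_compose[OF qd DERIV_cut[unfolded has_field_derivative_def]] by simp
    from has_derivative_mult[OF this u[OF z]] show ?thesis
      unfolding W_def W1_def by (simp add: algebra_simps)
  qed
  have W1d: "((\<lambda>z. W1 z y) has_derivative (\<lambda>v. cut2 (q z) * (2 * (z \<bullet> v) / R\<^sup>2) * (2 * (z \<bullet> y) / R\<^sup>2) * u z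
      + cut1 (q z) * (2 * (v \<bullet> y) / R\<^sup>2) * u z + cut1 (q z) * (2 * (z \<bullet> y) / R\<^sup>2) * u1 z v
      + cut1 (q z) * (2 * (z \<bullet> v) / R\<^sup>2) * u1 z y + cutoff (q z) * u2 z y v)) (at z)" for z y
  proof (cases "norm z < R")
    case True
    have "((\<lambda>z::'a. 0::real) has_derivative (\<lambda>y. 0)) (at z)" by simp
    then have "((\<lambda>z. W1 z y) has_derivative (\<lambda>y. 0)) (at z)"
      by (rule has_derivative_transform_within_open[of _ _ _ _ "ball 0 R"]) (use True lo in \<open>auto simp: W1_def\<close>)
    then show ?thesis using True lo[of z] by simp
  next
    case False
    then have z: "norm z > R0" using R by simp
    have c0: "((\<lambda>z. cutoff (q z)) has_derivative (\<lambda>y. cut1 (q z) * (2 * (z \<bullet> y) / R\<^sup>2))) (at z)"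
      using has_derivative_compose[OF qd DERIV_cut[unfolded has_field_derivative_def]] by simp
    have c1: "((\<lambda>z. cut1 (q z)) has_derivative (\<lambda>y. cut2 (q z) * (2 * (z \<bullet> y) / R\<^sup>2))) (at z)"
      using has_derivative_compose[OF qd DERIV_cut1[unfolded has_field_derivative_def]] by simp
    have l: "((\<lambda>z. 2 * (z \<bullet> y) / R\<^sup>2) has_derivative (\<lambda>v. 2 * (v \<bullet> y) / R\<^sup>2)) (at z)" unfolding divide_inverse
      by (auto intro!: derivative_eq_intros)
    from has_derivative_add[OF has_derivative_mult[OF has_derivative_mult[OF c1 l] u[OF z]]
        has_derivative_mult[OF c0 u1[OF z, of y]]]
    show ?thesis unfolding W1_def by (simp add: algebra_simps)
  qed
  have lin1: "((\<lambda>t. W (z + t *\<^sub>R y)) has_real_derivative W1 (z + t *\<^sub>R y) y) (at t)" for z y t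
    by (rule has_derivative_line[OF Wd])
  have lin2: "((\<lambda>t. W1 (z + t *\<^sub>R y) y) has_real_derivative W2 (z + t *\<^sub>R y) y) (at t)" for z y t
    unfolding W2_def by (rule has_derivative_line[OF W1d])
  define e2 where "e2 = e * (2 * (1260 + c2))"
  have e2: "e2 \<ge> 0" using e c2 by (simp add: e2_def)
  have bounds: "\<bar>W z\<bar> \<le> e2 * ((1 + norm z) * deriv \<phi> (1 + norm z)) \<and>
     \<bar>W1 z y\<bar> \<le> e2 * (deriv \<phi> (1 + norm z) * norm y) \<and>
     \<bar>W2 z y\<bar> \<le> e2 * (deriv \<phi> (1 + norm z) / (1 + norm z) * (norm y)\<^sup>2)" for z y
  proof (cases "norm z \<le> R")
    case True
    then show ?thesis using lo[OF True] e2 pos[of "1 + norm z"]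
      by (simp add: W_def W1_def W2_def add_pos_nonneg)
  next
    case False
    define r where "r = norm z"
    define D where "D = deriv \<phi> r"
    have r: "r \<ge> R" "r \<ge> 1" using False R by (auto simp: r_def)
    have D: "D > 0" using pos[of r] r by (simp add: D_def)
    have D1: "D \<le> deriv \<phi> (1 + r)" unfolding D_def using r by (intro deriv_mono) auto
    have ub: "\<bar>u z\<bar> \<le> e * (r * D)"
    proof -
      have "\<phi> r \<le> r * D" unfolding D_def using r by (intro le_mult_deriv) auto
      then have "e * \<phi> r \<le> e * (r * D)" using e by (intro mult_left_mono) auto
      then show ?thesis using R'(3)[of z] r R by (simp add: r_def)
    qed
    have u1b: "\<bar>u1 z y\<bar> \<le> e * D * norm y" using R'(2)[of z y] r R unfolding r_def D_def by auto
    have "r * deriv (deriv \<phi>) r \<le> c2 * D" using upper[of r] r by (simp add: D_def)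
    then have dd: "deriv (deriv \<phi>) r \<le> c2 * D / r" using r by (simp add: field_simps)
    have "\<bar>u2 z y y\<bar> \<le> e * deriv (deriv \<phi>) r * norm y * norm y" using R'(1)[of z y y] r R unfolding r_def by auto
    also have "\<dots> \<le> e * (c2 * D / r) * norm y * norm y"
      using dd e by (intro mult_right_mono mult_left_mono) auto
    finally have u2b: "\<bar>u2 z y y\<bar> \<le> e * c2 * (D / r * (norm y)\<^sup>2)" by (simp add: power2_eq_square mult_ac)
    \<comment> \<open>\<open>cut1\<close> and \<open>cut2\<close> vanish from the argument 2 on, so
      wherever they contribute, 1/R^2 may be traded for 2/|z|^2.\<close>
    have small: "r\<^sup>2 \<le> 2 * R\<^sup>2" if "cut1 (q z) \<noteq> 0 \<or> cut2 (q z) \<noteq> 0"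
    proof -
      have "q z < 2" by (rule ccontr) (use that cut_high(2,3)[of "q z"] in auto)
      then show ?thesis using R by (simp add: q_def r_def power2_norm_eq_inner divide_less_eq)
    qed
    define Q where "Q = 4 / r\<^sup>2"
    have Q0: "Q \<ge> 0" by (simp add: Q_def)
    have RQ: "2 / R\<^sup>2 \<le> Q" if "cut1 (q z) \<noteq> 0 \<or> cut2 (q z) \<noteq> 0"
      using small[OF that] R r by (simp add: Q_def field_simps)
    have zy: "\<bar>z \<bullet> y\<bar> \<le> r * norm y" unfolding r_def by (rule Cauchy_Schwarz_ineq2)
    have iz: "\<bar>2 * (z \<bullet> y) / R\<^sup>2\<bar> \<le> 4 / r * norm y" if "cut1 (q z) \<noteq> 0 \<or> cut2 (q z) \<noteq> 0"
    proof -
      have "\<bar>2 * (z \<bullet> y) / R\<^sup>2\<bar> = 2 / R\<^sup>2 * \<bar>z \<bullet> y\<bar>" by (simp add: abs_mult)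
      also have "\<dots> \<le> Q * (r * norm y)" using RQ[OF that] zy Q0 r by (intro mult_mono) auto
      finally show ?thesis using r by (simp add: Q_def power2_eq_square)
    qed
    have yy: "\<bar>2 * (y \<bullet> y) / R\<^sup>2\<bar> \<le> 4 / r\<^sup>2 * (norm y)\<^sup>2" if "cut1 (q z) \<noteq> 0"
      using RQ that mult_right_mono[of "2 / R\<^sup>2" Q "(norm y)\<^sup>2"] by (simp add: Q_def power2_norm_eq_inner)
    have t1: "\<bar>cut1 (q z) * (2 * (z \<bullet> y) / R\<^sup>2) * u z\<bar> \<le> 9 * (4 / r * norm y) * (e * (r * D))"
    proof (cases "cut1 (q z) = 0")
      case False
      then show ?thesis unfolding abs_mult using iz cut_bounds(3)[of "q z"] ub r by (intro mult_mono) auto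
    qed (use e D r in auto)
    have t2: "\<bar>cutoff (q z) * u1 z y\<bar> \<le> 1 * (e * D * norm y)"
      unfolding abs_mult using cut_bounds[of "q z"] u1b by (intro mult_mono) auto
    have s1: "\<bar>cut2 (q z) * (2 * (z \<bullet> y) / R\<^sup>2) * (2 * (z \<bullet> y) / R\<^sup>2) * u z\<bar> \<le> 72 * (4 / r * norm y)\<^sup>2 * (e * (r * D))"
    proof (cases "cut2 (q z) = 0")
      case False
      have "\<bar>(2 * (z \<bullet> y) / R\<^sup>2)\<^sup>2\<bar> \<le> (4 / r * norm y)\<^sup>2"
        using power_mono[OF iz, of 2] False by (simp only: abs_power2 power2_abs) simp
      then have "\<bar>cut2 (q z)\<bar> * \<bar>(2 * (z \<bullet> y) / R\<^sup>2)\<^sup>2\<bar> * \<bar>u z\<bar> \<le> 72 * (4 / r * norm y)\<^sup>2 * (e * (r * D))"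
        using cut_bounds(4)[of "q z"] ub r by (intro mult_mono) auto
      then show ?thesis by (simp only: abs_mult[symmetric] power2_eq_square mult.assoc)
    qed (use e D r in auto)
    have s2: "\<bar>cut1 (q z) * (2 * (y \<bullet> y) / R\<^sup>2) * u z\<bar> \<le> 9 * (4 / r\<^sup>2 * (norm y)\<^sup>2) * (e * (r * D))"
    proof (cases "cut1 (q z) = 0")
      case False
      then show ?thesis unfolding abs_mult using yy cut_bounds(3)[of "q z"] ub r by (intro mult_mono) auto
    qed (use e D r in auto)
    have s3: "\<bar>cut1 (q z) * (2 * (z \<bullet> y) / R\<^sup>2) * u1 z y\<bar> \<le> 9 * (4 / r * norm y) * (e * D * norm y)"
    proof (cases "cut1 (q z) = 0")
      case False
      then show ?thesis unfolding abs_mult using iz cut_bounds(3)[of "q z"] u1b r by (intro mult_mono) auto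
    qed (use e D r in auto)
    have s4: "\<bar>cutoff (q z) * u2 z y y\<bar> \<le> 1 * (e * c2 * (D / r * (norm y)\<^sup>2))"
      unfolding abs_mult using cut_bounds[of "q z"] u2b by (intro mult_mono) auto
    \<comment> \<open>37 = 36 + 1 for the first derivative: 36 from the differentiated cut-off, 1
      from the cut-off times \<open>u1\<close>.\<close>
    have e37: "37 * e \<le> e2" using e c2 by (simp add: e2_def algebra_simps)
    have "\<bar>W z\<bar> \<le> 1 * (e * (r * D))" unfolding W_def abs_mult
      using cut_bounds[of "q z"] ub by (intro mult_mono) auto
    also have "\<dots> \<le> e2 * ((1 + r) * deriv \<phi> (1 + r))"
      using e37 e D D1 r by (simp, intro mult_mono) auto
    finally have w0: "\<bar>W z\<bar> \<le> e2 * ((1 + r) * deriv \<phi> (1 + r))" .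
    have "\<bar>W1 z y\<bar> \<le> 37 * e * (D * norm y)"
    proof -
      have "9 * (4 / r * norm y) * (e * (r * D)) = 36 * e * (D * norm y)" using r by simp
      then have "\<bar>W1 z y\<bar> \<le> 36 * e * (D * norm y) + 1 * (e * D * norm y)"
        unfolding W1_def using t1 t2 by (metis abs_triangle_ineq add_mono order_trans)
      also have "\<dots> = 37 * e * (D * norm y)" by simp
      finally show ?thesis .
    qed
    also have "\<dots> \<le> e2 * (deriv \<phi> (1 + r) * norm y)"
      using e37 D D1 e by (intro mult_mono) auto
    finally have w1: "\<bar>W1 z y\<bar> \<le> e2 * (deriv \<phi> (1 + r) * norm y)" .
    have f1: "72 * (4 / r * norm y)\<^sup>2 * (e * (r * D)) = 1152 * e * (D / r * (norm y)\<^sup>2)"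
      using r by (simp add: power2_eq_square field_simps)
    have f2: "9 * (4 / r\<^sup>2 * (norm y)\<^sup>2) * (e * (r * D)) = 36 * e * (D / r * (norm y)\<^sup>2)"
      using r by (simp add: power2_eq_square field_simps)
    have f3: "9 * (4 / r * norm y) * (e * D * norm y) = 36 * e * (D / r * (norm y)\<^sup>2)"
      using r by (simp add: power2_eq_square field_simps)
    have "\<bar>W2 z y\<bar> \<le> e * (1260 + c2) * (D / r * (norm y)\<^sup>2)"
    proof -
      have gen: "\<bar>a + b + c + c + d\<bar> \<le> A + B + C + C + E"
        if "\<bar>a\<bar> \<le> A" "\<bar>b\<bar> \<le> B" "\<bar>c\<bar> \<le> C" "\<bar>d\<bar> \<le> E" for a b c d A B C E :: real
        using that by linarith
      show ?thesis
        unfolding W2_def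
        by (rule order_trans[OF gen[OF s1[unfolded f1] s2[unfolded f2] s3[unfolded f3] s4]])
          (simp add: algebra_simps)
    qed
    also have "\<dots> \<le> e * (1260 + c2) * (2 * (deriv \<phi> (1 + r) / (1 + r)) * (norm y)\<^sup>2)"
      unfolding D_def using e c2 r by (intro mult_left_mono mult_right_mono rate_le) auto
    finally have w2: "\<bar>W2 z y\<bar> \<le> e2 * (deriv \<phi> (1 + r) / (1 + r) * (norm y)\<^sup>2)"
      by (simp only: e2_def mult_ac)
    show ?thesis using w0 w1 w2 by (simp add: r_def)
  qed
  have "\<bar>W (z + y) - W z - W1 z y\<bar> \<le> 27 * e2 * weight (1 + norm z) (norm y)" for z y
    using bounds by (intro bregman_upper[OF e2 lin1 lin2]) auto
  moreover have "27 * e2 = d" using c2 by (simp add: e2_def e_def field_simps)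
  ultimately show ?thesis using Wd R(4) unfolding W_def q_def by (intro exI[of _ R] conjI exI[of _ W1]) auto
qed

end

section \<open>Averages over the unit ball and test functions\<close>

text \<open>With Borel measurability this makes all averages over z + D\<xi> finite, because the
  gradient of a test function stays in a ball. It covers both continuous functions and the
  discontinuous f of (iv).\<close>

definition bounded_on_balls :: "('a::real_normed_vector \<Rightarrow> real) \<Rightarrow> bool" where
  "bounded_on_balls h \<longleftrightarrow> (\<forall>b. \<exists>C. \<forall>w. norm w \<le> b \<longrightarrow> \<bar>h w\<bar> \<le> C)"

lemma continuous_bounded_on_balls:
  fixes h :: "'a::euclidean_space \<Rightarrow> real"
  assumes "continuous_on UNIV h" shows "bounded_on_balls h"
  unfolding bounded_on_balls_def
proof
  fix b
  have "bounded (h ` cball 0 b)"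
    by (intro compact_imp_bounded compact_continuous_image continuous_on_subset[OF assms]) auto
  then show "\<exists>C. \<forall>w. norm w \<le> b \<longrightarrow> \<bar>h w\<bar> \<le> C" by (force simp: bounded_iff)
qed

lemma emeasure_lborel_ball_less_top [simp]:
  "emeasure lborel (ball (c::'a::euclidean_space) r) < top" "emeasure lborel (cball c r) < top"
  using emeasure_lborel_ball_finite[of c r] emeasure_lborel_cball_finite[of c r] by simp_all

abbreviation ball_integrable :: "(real ^ 'n \<Rightarrow> real) \<Rightarrow> bool" where
  "ball_integrable \<equiv> set_integrable lborel (ball 0 1)"

lemma ball_integrable_bounded:
  assumes "f \<in> borel_measurable borel" "\<And>x. x \<in> ball 0 1 \<Longrightarrow> \<bar>f x\<bar> \<le> C"
  shows "ball_integrable f"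
  unfolding set_integrable_def
  by (rule integrableI_bounded_set_indicator[of _ _ _ C])
    (use assms in auto)

lemma ball_average_mono:
  "ball_integrable f \<Longrightarrow> ball_integrable g \<Longrightarrow> (\<And>x. x \<in> ball 0 1 \<Longrightarrow> f x \<le> g x) \<Longrightarrow>
     ball_average f \<le> ball_average g"
  unfolding ball_average_def by (intro mult_left_mono set_integral_mono) auto

lemma ball_average_const: "ball_average (\<lambda>x::real^'n. c) = c"
proof -
  have "measure lborel (ball (0::real^'n) 1) > 0" using content_ball_pos[of 1 "0::real^'n"] by simp
  moreover have "(LBINT x:ball (0::real^'n) 1. c) = measure lborel (ball (0::real^'n) 1) *\<^sub>R c"
    by (rule set_integral_const) (simp_all add: less_imp_neq)
  ultimately show ?thesis by (simp add: ball_average_def)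
qed

lemma ball_average_add:
  "ball_integrable f \<Longrightarrow> ball_integrable g \<Longrightarrow> ball_average (\<lambda>x. f x + g x) = ball_average f + ball_average g"
  unfolding ball_average_def by (simp add: distrib_left)

lemma ball_average_diff:
  "ball_integrable f \<Longrightarrow> ball_integrable g \<Longrightarrow> ball_average (\<lambda>x. f x - g x) = ball_average f - ball_average g"
  unfolding ball_average_def by (simp add: right_diff_distrib)

lemma ball_average_cmult: "ball_average (\<lambda>x. c * f x) = c * ball_average f"
  unfolding ball_average_def by simp

lemma ball_integrable_const: "ball_integrable (\<lambda>x. c)"
  by (rule ball_integrable_bounded[of _ "\<bar>c\<bar>"]) auto

lemma ball_average_abs_le:
  fixes f :: "real ^ 'n \<Rightarrow> real"
  assumes "ball_integrable f" "\<And>x. x \<in> ball 0 1 \<Longrightarrow> \<bar>f x\<bar> \<le> C"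
  shows "\<bar>ball_average f\<bar> \<le> C"
proof -
  have "ball_average f \<le> ball_average (\<lambda>x::real^'n. C)"
    by (rule ball_average_mono[OF assms(1) ball_integrable_const]) (use assms(2) in \<open>force simp: abs_le_iff\<close>)
  moreover have "ball_average (\<lambda>x::real^'n. - C) \<le> ball_average f"
    by (rule ball_average_mono[OF ball_integrable_const assms(1)])
      (use assms(2) in \<open>force simp: abs_le_iff minus_le_iff\<close>)
  ultimately show ?thesis by (simp add: ball_average_const abs_le_iff)
qed

lemma integrable_comp_bounded:
  fixes D :: "real ^ 'n \<Rightarrow> real ^ 'n ^ 'm"
  assumes D: "continuous_on UNIV D" and h: "h \<in> borel_measurable borel" "bounded_on_balls h"
  shows "ball_integrable (\<lambda>x. h (D x))"
proof -
  have "bounded (D ` cball 0 1)"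
    by (intro compact_imp_bounded compact_continuous_image continuous_on_subset[OF D]) auto
  then obtain b where b: "\<And>x. x \<in> cball 0 1 \<Longrightarrow> norm (D x) \<le> b"
    unfolding bounded_iff by blast
  obtain C where "\<And>w. norm w \<le> b \<Longrightarrow> \<bar>h w\<bar> \<le> C" using h(2) by (auto simp: bounded_on_balls_def)
  then show ?thesis
    by (intro ball_integrable_bounded[of _ C] measurable_compose[OF borel_measurable_continuous_onI[OF D] h(1)])
      (use b in auto)
qed

lemma compact_subset_unit_ball:
  fixes S :: "'a::real_normed_vector set"
  assumes "compact S" "S \<subseteq> ball 0 1"
  shows "\<exists>b\<ge>0. b < 1 \<and> (\<forall>x\<in>S. norm x \<le> b)"
proof (cases "S = {}")
  case True then show ?thesis by (intro exI[of _ 0]) auto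
next
  case False
  then obtain x where "x \<in> S" "\<And>y. y \<in> S \<Longrightarrow> norm y \<le> norm x"
    using continuous_attains_sup[OF assms(1) False, of norm] by (auto intro: continuous_intros)
  then show ?thesis using assms(2) by (intro exI[of _ "norm x"]) auto
qed

text \<open>The gradient vanishes near the unit sphere as well because \<xi> is zero on an open set
  there. If the support lies in the closed ball of radius b < 1, the radius (1 + b)/2 is strictly
  beyond it and still below 1.\<close>

lemma Ckc_ballD:
  fixes \<xi> :: "real ^ 'n \<Rightarrow> real ^ 'm"
  assumes "\<xi> \<in> Ckc_ball 1"
  shows "(\<xi> has_derivative (\<lambda>v. jacobian \<xi> (at x) *v v)) (at x)"
    "continuous_on UNIV (\<lambda>x. jacobian \<xi> (at x))"
    "\<exists>r. 0 < r \<and> r < 1 \<and> (\<forall>x. norm x \<ge> r \<longrightarrow> \<xi> x = 0 \<and> jacobian \<xi> (at x) = 0)"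
proof -
  have diff: "\<xi> differentiable (at x)" for x
    using assms by (auto simp: Ckc_ball_def differentiable_on_def)
  show der: "(\<xi> has_derivative (\<lambda>v. jacobian \<xi> (at x) *v v)) (at x)" for x
    using diff jacobian_works by blast
  have "continuous_on UNIV (\<lambda>x. frechet_derivative \<xi> (at x) v)" for v
    using assms by (auto simp: Ckc_ball_def)
  then show "continuous_on UNIV (\<lambda>x. jacobian \<xi> (at x))"
    unfolding jacobian_def matrix_def by (intro continuous_intros)
  define S where "S = closure {x. \<xi> x \<noteq> 0}"
  have S: "S \<subseteq> ball 0 1" using assms by (auto simp: Ckc_ball_def S_def)
  have cS: "compact S" using S by (auto simp: S_def compact_eq_bounded_closed intro: bounded_subset bounded_ball)
  obtain b where b: "0 \<le> b" "b < 1" "\<And>x. x \<in> S \<Longrightarrow> norm x \<le> b"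
    using compact_subset_unit_ball[OF cS S] by blast
  have "\<xi> x = 0 \<and> jacobian \<xi> (at x) = 0" if "norm x \<ge> (1 + b) / 2" for x
  proof -
    have z: "\<xi> y = 0" if "y \<in> - cball 0 b" for y
      using b(3)[of y] that closure_subset[of "{x. \<xi> x \<noteq> 0}"] by (force simp: S_def)
    have x: "x \<in> - cball 0 b" using that b by auto
    have "((\<lambda>x. 0) has_derivative (\<lambda>v. 0)) (at x)" by simp
    then have "(\<xi> has_derivative (\<lambda>v. 0)) (at x)"
      by (rule has_derivative_transform_within_open[of _ _ _ _ "- cball 0 b"]) (use x z in auto)
    then have "(\<lambda>v. jacobian \<xi> (at x) *v v) = (\<lambda>v. 0)" using der has_derivative_unique by blast
    then have "jacobian \<xi> (at x) = 0" by (metis matrix_eq matrix_vector_mult_0)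
    then show ?thesis using z x by auto
  qed
  then show "\<exists>r. 0 < r \<and> r < 1 \<and> (\<forall>x. norm x \<ge> r \<longrightarrow> \<xi> x = 0 \<and> jacobian \<xi> (at x) = 0)"
    using b by (intro exI[of _ "(1+b)/2"]) auto
qed

lemma jacobian_eqI:
  fixes \<xi> :: "real ^ 'n \<Rightarrow> real ^ 'm"
  assumes "(\<xi> has_derivative (\<lambda>v. J *v v)) (at x)"
  shows "jacobian \<xi> (at x) = J"
  using frechet_derivative_at[OF assms] by (metis jacobian_def matrix_of_matrix_vector_mul)

lemma Ckc_ballI:
  fixes \<xi> :: "real ^ 'n \<Rightarrow> real ^ 'm"
  assumes der: "\<And>x. (\<xi> has_derivative (\<lambda>v. J x *v v)) (at x)" and cont: "continuous_on UNIV J"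
    and supp: "r < 1" "\<And>x. norm x > r \<Longrightarrow> \<xi> x = 0"
  shows "\<xi> \<in> Ckc_ball 1"
proof -
  have "frechet_derivative \<xi> (at x) = (\<lambda>v. J x *v v)" for x
    using frechet_derivative_at[OF der] by simp
  then have "continuous_on UNIV (\<lambda>x. frechet_derivative \<xi> (at x) v)" for v
    using cont by (simp add: matrix_vector_mult_def) (intro continuous_intros)
  moreover have "\<xi> differentiable_on UNIV" using der by (auto simp: differentiable_on_def differentiable_def)
  moreover have "closure {x. \<xi> x \<noteq> 0} \<subseteq> cball 0 r"
    by (rule closure_minimal) (use supp(2) in \<open>force simp: not_le\<close>, simp)
  ultimately show ?thesis using supp(1) by (auto simp: Ckc_ball_def)
qed

lemma Cinfc_subset: "Cinfc_ball \<subseteq> Ckc_ball 1"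
  by (auto simp: Cinfc_ball_def)

lemma zero_Ckc_ball: "(\<lambda>x. 0) \<in> Ckc_ball 1"
  by (rule Ckc_ballI[of _ "\<lambda>x. 0" 0]) auto

lemma jacobian_zero: "jacobian (\<lambda>x. 0 :: real ^ 'm) (at (x :: real ^ 'n)) = 0"
  by (rule jacobian_eqI) simp

text \<open>Translation invariance of Lebesgue measure, differentiated under the integral sign.\<close>

lemma integral_directional_derivative_zero:
  fixes h :: "'a::euclidean_space \<Rightarrow> real"
  assumes der: "\<And>x. (h has_derivative h' x) (at x)" and cont: "continuous_on UNIV (\<lambda>x. h' x v)"
    and bd: "\<And>x. \<bar>h' x v\<bar> \<le> C" and supp: "\<And>x. norm x > r \<Longrightarrow> h x = 0"
  shows "(\<integral>x. h' x v \<partial>lborel) = 0"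
proof -
  have hc: "continuous_on UNIV h" using der by (auto intro!: has_derivative_continuous continuous_at_imp_continuous_on)
  then have hm[measurable]: "h \<in> borel_measurable borel" by (rule borel_measurable_continuous_onI)
  have h'm[measurable]: "(\<lambda>x. h' x v) \<in> borel_measurable borel" by (rule borel_measurable_continuous_onI[OF cont])
  obtain Ch where Ch: "\<And>x. norm x \<le> r \<Longrightarrow> \<bar>h x\<bar> \<le> Ch"
    using continuous_bounded_on_balls[OF hc] unfolding bounded_on_balls_def by blast
  have "integrable lborel (\<lambda>x. indicator (cball 0 r) x *\<^sub>R h x)"
    by (rule integrableI_bounded_set_indicator[of _ _ _ Ch]) (use Ch in auto)
  moreover have "(\<lambda>x. indicator (cball 0 r) x *\<^sub>R h x) = h"
    using supp by (force simp: indicator_def not_le)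
  ultimately have hi: "integrable lborel h" by simp
  define s where "s = (\<lambda>k x. real (Suc k) * (h ((1 / real (Suc k)) *\<^sub>R v + x) - h x))"
  have hi2: "integrable lborel (\<lambda>x. h (c + x))" "(\<integral>x. h (c + x) \<partial>lborel) = (\<integral>x. h x \<partial>lborel)" for c
    using integrable_distr_eq[of "(+) c" lborel borel h] integral_distr[of "(+) c" lborel borel h] hi
    by (simp_all add: lborel_distr_plus)
  have s0: "(\<integral>x. s k x \<partial>lborel) = 0" for k
    unfolding s_def using hi hi2 by simp
  \<comment> \<open>The increments are at most |v| long, so all quotients vanish outside the ball of
    radius r + |v|; inside it the mean value theorem bounds them by C.\<close>
  have "(\<lambda>k. \<integral>x. s k x \<partial>lborel) \<longlonglongrightarrow> (\<integral>x. h' x v \<partial>lborel)"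
  proof (rule integral_dominated_convergence[where w = "\<lambda>x. indicator (cball 0 (r + norm v)) x *\<^sub>R C"])
    show "(\<lambda>x. h' x v) \<in> borel_measurable lborel" by simp
    show "s k \<in> borel_measurable lborel" for k unfolding s_def by measurable
    show "integrable lborel (\<lambda>x. indicator (cball 0 (r + norm v)) x *\<^sub>R C)"
      by (rule integrableI_bounded_set_indicator[of _ _ _ "\<bar>C\<bar>"]) auto
    have line: "((\<lambda>t. h (x + t *\<^sub>R v)) has_real_derivative h' (x + t *\<^sub>R v) v) (at t)" for x t
      by (rule has_derivative_line[OF der])
    show "AE x in lborel. (\<lambda>k. s k x) \<longlonglongrightarrow> h' x v"
    proof (rule AE_I2)
      fix x
      have "((\<lambda>t. (h (x + t *\<^sub>R v) - h x) / t) \<longlongrightarrow> h' x v) (at 0)"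
        using line[of x 0] by (simp add: DERIV_def)
      moreover have "filterlim (\<lambda>k. 1 / real (Suc k)) (at 0) sequentially"
        using LIMSEQ_inverse_real_of_nat by (auto simp: filterlim_at inverse_eq_divide)
      ultimately have "(\<lambda>k. (h (x + (1 / real (Suc k)) *\<^sub>R v) - h x) / (1 / real (Suc k))) \<longlonglongrightarrow> h' x v"
        by (rule filterlim_compose)
      then show "(\<lambda>k. s k x) \<longlonglongrightarrow> h' x v" by (simp add: s_def add.commute mult.commute)
    qed
    show "AE x in lborel. norm (s k x) \<le> indicator (cball 0 (r + norm v)) x *\<^sub>R C" for k
    proof (rule AE_I2)
      fix x
      define t where "t = 1 / real (Suc k)"
      have t: "0 < t" "t \<le> 1" by (auto simp: t_def)
      show "norm (s k x) \<le> indicator (cball 0 (r + norm v)) x *\<^sub>R C"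
      proof (cases "norm x \<le> r + norm v")
        case True
        obtain u where "h (x + t *\<^sub>R v) - h (x + 0 *\<^sub>R v) = (t - 0) * h' (x + u *\<^sub>R v) v"
          using MVT2[of 0 t "\<lambda>t. h (x + t *\<^sub>R v)" "\<lambda>t. h' (x + t *\<^sub>R v) v"] t line by blast
        then have "s k x = h' (x + u *\<^sub>R v) v" by (simp add: s_def t_def add.commute)
        then show ?thesis using bd True by simp
      next
        case False
        have "norm (t *\<^sub>R v) \<le> norm v" using t by (simp add: mult_left_le_one_le)
        then have "norm (t *\<^sub>R v + x) > r" using False norm_diff_ineq[of x "t *\<^sub>R v"] by (simp add: add.commute)
        moreover have "norm x > r" using False norm_ge_zero[of v] by linarith
        ultimately show ?thesis using False supp by (simp add: s_def t_def)
      qed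
    qed
  qed
  then show ?thesis using s0 LIMSEQ_unique[OF _ tendsto_const] by simp
qed

text \<open>Every entry of the Jacobian is a directional derivative of a compactly supported
  function and integrates to zero; L is a linear combination of entries. Integrals over the ball and
  over the whole space agree because the gradient vanishes beyond some r < 1.\<close>

lemma ball_average_linear_jacobian:
  fixes \<xi> :: "real ^ 'n \<Rightarrow> real ^ 'm" and L :: "real ^ 'n ^ 'm \<Rightarrow> real"
  assumes xi: "\<xi> \<in> Ckc_ball 1" and L: "linear L"
  shows "ball_average (\<lambda>x. L (jacobian \<xi> (at x))) = 0"
proof -
  define J where "J = (\<lambda>x. jacobian \<xi> (at x))"
  have D: "(\<xi> has_derivative (\<lambda>v. J x *v v)) (at x)" "continuous_on UNIV J" for x
    unfolding J_def by (rule Ckc_ballD[OF xi])+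
  obtain r where r: "0 < r" "r < 1" "\<And>x. norm x \<ge> r \<Longrightarrow> \<xi> x = 0" "\<And>x. norm x \<ge> r \<Longrightarrow> J x = 0"
    using Ckc_ballD(3)[OF xi] by (auto simp: J_def)
  have entry: "(\<integral>x. J x $ i $ j \<partial>lborel) = 0" and int: "integrable lborel (\<lambda>x. J x $ i $ j)" for i j
  proof -
    have c: "continuous_on UNIV (\<lambda>x. J x $ i $ j)" by (intro continuous_intros D(2))
    obtain C where "\<And>x. norm x \<le> r \<Longrightarrow> \<bar>J x $ i $ j\<bar> \<le> C"
      using continuous_bounded_on_balls[OF c] unfolding bounded_on_balls_def by blast
    then have b: "\<bar>J x $ i $ j\<bar> \<le> max C 0" for x
      using r(4)[of x] by (cases "norm x \<le> r") (auto simp: le_max_iff_disj)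
    have e: "(J x *v axis j 1) $ i = J x $ i $ j" for x
      by (simp add: matrix_vector_mult_basis column_def)
    have d: "((\<lambda>x. \<xi> x $ i) has_derivative (\<lambda>v. (J x *v v) $ i)) (at x)" for x
      by (rule bounded_linear.has_derivative[where f="\<lambda>v. v $ i", OF bounded_linear_vec_nth D(1)])
    show "(\<integral>x. J x $ i $ j \<partial>lborel) = 0"
      using integral_directional_derivative_zero[OF d, of "axis j 1" "max C 0" r] c b r(3)
      by (simp add: e)
    have "integrable lborel (\<lambda>x. indicator (cball 0 1) x *\<^sub>R J x $ i $ j)"
      by (rule integrableI_bounded_set_indicator[of _ _ _ "max C 0"])
        (use b borel_measurable_continuous_onI[OF c] in auto)
    moreover have "(\<lambda>x. indicator (cball 0 1) x *\<^sub>R J x $ i $ j) = (\<lambda>x. J x $ i $ j)"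
      using r by (force simp: indicator_def not_le)
    ultimately show "integrable lborel (\<lambda>x. J x $ i $ j)" by simp
  qed
  have rep: "A = (\<Sum>i\<in>UNIV. \<Sum>j\<in>UNIV. A $ i $ j *\<^sub>R axis i (axis j 1))" for A :: "real ^ 'n ^ 'm"
  proof -
    have "(\<Sum>j\<in>UNIV. A $ i $ j *\<^sub>R axis i (axis j (1::real))) = axis i (A $ i)" for i
    proof -
      have "(\<Sum>j\<in>UNIV. A $ i $ j *\<^sub>R axis j (1::real)) = A $ i"
        using basis_expansion[of "A $ i"] by (simp add: scalar_mult_eq_scaleR)
      then show ?thesis
        by (simp add: vec_eq_iff axis_def if_distrib[of "\<lambda>x. x $ _"])
    qed
    moreover have "(\<Sum>i\<in>UNIV. axis i (A $ i)) = A"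
      by (simp add: vec_eq_iff axis_def)
    ultimately show ?thesis by simp
  qed
  have LA: "L A = (\<Sum>i\<in>UNIV. \<Sum>j\<in>UNIV. A $ i $ j * L (axis i (axis j 1)))" for A
    by (subst rep[of A]) (simp add: linear_sum[OF L] linear_scale[OF L])
  have "(LBINT x:ball 0 1. L (J x)) = (\<integral>x. L (J x) \<partial>lborel)"
    unfolding set_lebesgue_integral_def
    by (intro Bochner_Integration.integral_cong refl) (use r(2,4) linear_0[OF L] in \<open>auto simp: indicator_def not_less\<close>)
  also have "\<dots> = 0" unfolding LA[of "J x" for x] using int entry by simp
  finally show ?thesis by (simp add: ball_average_def J_def)
qed

section \<open>Perturbation of uniformly strictly quasiconvex functions\<close>

lemma comp_integrable:
  fixes \<xi> :: "real ^ 'n \<Rightarrow> real ^ 'm"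
  assumes "g \<in> borel_measurable borel" "bounded_on_balls g" "\<xi> \<in> Ckc_ball 1"
  shows "ball_integrable (\<lambda>x. g (z + jacobian \<xi> (at x)))"
proof (rule integrable_comp_bounded[OF Ckc_ballD(2)[OF assms(3)], of "\<lambda>A. g (z + A)"])
  show "(\<lambda>A. g (z + A)) \<in> borel_measurable borel"
    by (rule measurable_compose[OF _ assms(1)]) auto
  show "bounded_on_balls (\<lambda>A. g (z + A))"
    unfolding bounded_on_balls_def
  proof
    fix b
    obtain C where "\<And>w. norm w \<le> norm z + b \<Longrightarrow> \<bar>g w\<bar> \<le> C"
      using assms(2) unfolding bounded_on_balls_def by blast
    then show "\<exists>C. \<forall>w. norm w \<le> b \<longrightarrow> \<bar>g (z + w)\<bar> \<le> C"
      by (intro exI[of _ C] allI impI) (simp add: norm_triangle_le)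
  qed
qed

lemma comp_integrable_cont:
  fixes \<xi> :: "real ^ 'n \<Rightarrow> real ^ 'm"
  assumes "continuous_on UNIV g" "\<xi> \<in> Ckc_ball 1"
  shows "ball_integrable (\<lambda>x. g (z + jacobian \<xi> (at x)))"
  by (rule comp_integrable[OF borel_measurable_continuous_onI[OF assms(1)] continuous_bounded_on_balls[OF assms(1)] assms(2)])

context orlicz begin

lemma shifted_comp_integrable:
  fixes \<xi> :: "real ^ 'n \<Rightarrow> real ^ 'm"
  assumes "a > 0" "\<xi> \<in> Ckc_ball 1"
  shows "ball_integrable (\<lambda>x. shifted \<phi> a (norm (jacobian \<xi> (at x))))"
proof (rule integrable_comp_bounded[OF Ckc_ballD(2)[OF assms(2)], of "\<lambda>A. shifted \<phi> a (norm A)"])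
  show "(\<lambda>A::real^'n^'m. shifted \<phi> a (norm A)) \<in> borel_measurable borel"
    by (rule measurable_compose[OF _ shifted_measurable[OF assms(1)]]) auto
  show "bounded_on_balls (\<lambda>A::real^'n^'m. shifted \<phi> a (norm A))"
    unfolding bounded_on_balls_def
    by (metis abs_of_nonneg assms(1) shifted_mono shifted_nonneg)
qed

text \<open>The linear part \<open>W1 z\<close> averages to zero, so only the remainder matters, and
  d lets it consume half of k. One d serves all W; this is what permits a cut-off radius to be
  chosen after d.\<close>

lemma unif_strictly_quasiconvex_perturb:
  fixes g :: "real ^ 'n ^ 'm \<Rightarrow> real"
  assumes "unif_strictly_quasiconvex \<phi> g"
  shows "\<exists>d>0. \<forall>(W :: real ^ 'n ^ 'm \<Rightarrow> real) W1. (\<forall>z. (W has_derivative W1 z) (at z)) \<longrightarrow>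
      (\<forall>z y. \<bar>W (z + y) - W z - W1 z y\<bar> \<le> d * weight (1 + norm z) (norm y)) \<longrightarrow>
      unif_strictly_quasiconvex \<phi> (\<lambda>z. g z + W z)"
proof -
  obtain k where g: "continuous_on UNIV g" and k: "k > 0" and q: "\<And>\<xi> z. \<xi> \<in> Ckc_ball 1 \<Longrightarrow>
      ball_average (\<lambda>x. g (z + jacobian \<xi> (at x)))
        \<ge> g z + k * ball_average (\<lambda>x. shifted \<phi> (1 + norm z) (norm (jacobian \<xi> (at x))))"
    using assms unfolding unif_strictly_quasiconvex_def by blast
  define d where "d = k / (2 * (4 * 2 powr c2))"
  have d: "d > 0" using k by (simp add: d_def)
  have "unif_strictly_quasiconvex \<phi> (\<lambda>z. g z + W z)"
    if W: "\<And>z. (W has_derivative W1 z) (at z)"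
      and le: "\<And>z y. \<bar>W (z + y) - W z - W1 z y\<bar> \<le> d * weight (1 + norm z) (norm y)" for W :: "real ^ 'n ^ 'm \<Rightarrow> real" and W1
    unfolding unif_strictly_quasiconvex_def
  proof (intro conjI exI[of _ "k/2"] ballI allI)
    have Wc: "continuous_on UNIV W" using W by (auto intro!: has_derivative_continuous continuous_at_imp_continuous_on)
    show "continuous_on UNIV (\<lambda>z. g z + W z)" by (intro continuous_intros g Wc)
    show "0 < k/2" using k by simp
    fix \<xi> :: "real ^ 'n \<Rightarrow> real ^ 'm" and z :: "real ^ 'n ^ 'm"
    assume xi: "\<xi> \<in> Ckc_ball 1"
    let ?J = "\<lambda>x. jacobian \<xi> (at x)"
    let ?s = "\<lambda>x. shifted \<phi> (1 + norm z) (norm (?J x))"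
    have z1: "1 + norm z > 0" by (simp add: add_pos_nonneg)
    have lin: "linear (W1 z)" using W by (rule has_derivative_linear)
    have iS: "ball_integrable ?s" by (rule shifted_comp_integrable[OF z1 xi])
    have ig: "ball_integrable (\<lambda>x. g (z + ?J x))" by (rule comp_integrable_cont[OF g xi])
    have iW: "ball_integrable (\<lambda>x. W (z + ?J x))" by (rule comp_integrable_cont[OF Wc xi])
    have i1: "ball_integrable (\<lambda>x. W1 z (?J x))"
      using comp_integrable_cont[OF _ xi, of "W1 z" 0] linear_continuous_on[OF lin[unfolded linear_conv_bounded_linear]] by simp
    have pt: "W z + W1 z (?J x) - k/2 * ?s x \<le> W (z + ?J x)" for x
    proof -
      have "d * weight (1 + norm z) (norm (?J x)) \<le> d * (4 * 2 powr c2 * ?s x)"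
        using d by (intro mult_left_mono weight_le_shifted z1) auto
      also have "\<dots> = k / 2 * ?s x" by (simp add: d_def)
      finally show ?thesis using le[of z "?J x"] by linarith
    qed
    have i0: "ball_integrable (\<lambda>x::real^'n. W z)" by (rule ball_integrable_const)
    have i3: "ball_integrable (\<lambda>x. W z + W1 z (?J x))" by (rule set_integral_add(1)[OF i0 i1])
    have i4: "ball_integrable (\<lambda>x. k/2 * ?s x)" using iS by simp
    have i2: "ball_integrable (\<lambda>x. W z + W1 z (?J x) - k/2 * ?s x)" by (rule set_integral_diff(1)[OF i3 i4])
    have "W z - k/2 * ball_average ?s = ball_average (\<lambda>x. W z + W1 z (?J x) - k/2 * ?s x)"
      unfolding ball_average_diff[OF i3 i4] ball_average_add[OF i0 i1] ball_average_cmult ball_average_const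
        ball_average_linear_jacobian[OF xi lin] by simp
    also have "\<dots> \<le> ball_average (\<lambda>x. W (z + ?J x))"
      by (rule ball_average_mono[OF i2 iW pt])
    finally have "W z - k/2 * ball_average ?s \<le> ball_average (\<lambda>x. W (z + ?J x))" .
    then show "g z + W z + k / 2 * ball_average ?s \<le> ball_average (\<lambda>x. g (z + ?J x) + W (z + ?J x))"
      using q[OF xi, of z] by (simp add: ball_average_add[OF ig iW])
  qed
  then show ?thesis using d by blast
qed

text \<open>The additive constant c drops out of every Taylor remainder. It is carried along so that
  a cut-off constant can be turned into a bump supported near the origin.\<close>

lemma unif_strictly_quasiconvex_cutoff:
  fixes g :: "real ^ 'n ^ 'm \<Rightarrow> real"
  assumes g: "unif_strictly_quasiconvex \<phi> g"
    and u: "\<And>z. norm z > R0 \<Longrightarrow> (u has_derivative u1 z) (at z)"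
    and u1: "\<And>z v. norm z > R0 \<Longrightarrow> ((\<lambda>z. u1 z v) has_derivative u2 z v) (at z)"
    and small: "\<And>e. e > 0 \<Longrightarrow> \<forall>\<^sub>F z in at_infinity. \<forall>v w. \<bar>u2 z v w\<bar> \<le> e * deriv (deriv \<phi>) (norm z) * norm v * norm w"
  shows "\<exists>R>B. unif_strictly_quasiconvex \<phi> (\<lambda>z. g z + (cutoff ((z \<bullet> z) / R\<^sup>2) * u z + c))"
proof -
  obtain d where d: "d > 0" and D: "\<And>(W :: real ^ 'n ^ 'm \<Rightarrow> real) W1. (\<And>z. (W has_derivative W1 z) (at z)) \<Longrightarrow>
      (\<And>z y. \<bar>W (z + y) - W z - W1 z y\<bar> \<le> d * weight (1 + norm z) (norm y)) \<Longrightarrow>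
      unif_strictly_quasiconvex \<phi> (\<lambda>z. g z + W z)"
    using unif_strictly_quasiconvex_perturb[OF g] by blast
  obtain R W1 where R: "R > B" "\<And>z. ((\<lambda>z. cutoff ((z \<bullet> z) / R\<^sup>2) * u z) has_derivative W1 z) (at z)"
    "\<And>z y. \<bar>cutoff (((z+y) \<bullet> (z+y)) / R\<^sup>2) * u (z+y) - cutoff ((z \<bullet> z) / R\<^sup>2) * u z - W1 z y\<bar>
       \<le> d * weight (1 + norm z) (norm y)"
    using cutoff_small[where u=u and ?u1.0=u1 and ?u2.0=u2, OF u u1 small d] by blast
  have "unif_strictly_quasiconvex \<phi> (\<lambda>z. g z + (cutoff ((z \<bullet> z) / R\<^sup>2) * u z + c))"
  proof (rule D)
    show "((\<lambda>z. cutoff ((z \<bullet> z) / R\<^sup>2) * u z + c) has_derivative W1 z) (at z)" for z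
      using has_derivative_add[OF R(2) has_derivative_const[of c]] by simp
  qed (use R(3) in simp)
  then show ?thesis using R(1) by blast
qed

text \<open>For u = -c the perturbation is c minus c times the cut-off: it equals c on the ball of
  radius R and 0 far out. Any height of either sign is allowed, at the price of a large R.\<close>

lemma unif_strictly_quasiconvex_bump:
  fixes g :: "real ^ 'n ^ 'm \<Rightarrow> real"
  assumes "unif_strictly_quasiconvex \<phi> g"
  shows "\<exists>R>B. unif_strictly_quasiconvex \<phi> (\<lambda>z. g z + c * (1 - cutoff ((z \<bullet> z) / R\<^sup>2)))"
proof -
  have "\<exists>R>B. unif_strictly_quasiconvex \<phi> (\<lambda>z. g z + (cutoff ((z \<bullet> z) / R\<^sup>2) * - c + c))"
    by (rule unif_strictly_quasiconvex_cutoff[OF assms, of 0 "\<lambda>_. - c" "\<lambda>_ _. 0" "\<lambda>_ _ _. 0"])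
      (auto intro!: mult_nonneg_nonneg less_imp_le[OF second_pos] eventually_mono[OF eventually_norm_ge[of 1]])
  then show ?thesis by (simp add: algebra_simps)
qed

end

section \<open>Second derivatives outside a ball and characterization (i)\<close>

lemma cutoff_inside: "norm z \<le> R \<Longrightarrow> cutoff ((z \<bullet> z) / R\<^sup>2) = 0"
proof -
  assume "norm z \<le> R"
  then have "(z \<bullet> z) / R\<^sup>2 \<le> 1"
    using power_mono[of "norm z" R 2] by (simp add: power2_norm_eq_inner[symmetric] divide_le_eq)
  then show ?thesis by (rule cut_low)
qed

lemma cutoff_outside: "R > 0 \<Longrightarrow> norm z \<ge> 2 * R \<Longrightarrow> cutoff ((z \<bullet> z) / R\<^sup>2) = 1"
proof -
  assume R: "R > 0" "norm z \<ge> 2 * R"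
  then have "(z \<bullet> z) / R\<^sup>2 \<ge> 2"
  proof -
    have "2 * R\<^sup>2 \<le> (2 * R)\<^sup>2" by (simp add: power_mult_distrib)
    also have "\<dots> \<le> z \<bullet> z" using power_mono[OF R(2), of 2] R(1) by (simp add: power2_norm_eq_inner)
    finally show ?thesis using R(1) by (simp add: le_divide_eq)
  qed
  then show ?thesis by (rule cut_high)
qed

text \<open>\<open>frechet_derivative\<close> is a choice among all derivatives; f and g have the
  same candidates at x, so the choices coincide even where no derivative exists.\<close>

lemma frechet_derivative_local:
  assumes "open T" "x \<in> T" "\<And>y. y \<in> T \<Longrightarrow> f y = g y"
  shows "frechet_derivative f (at x) = frechet_derivative g (at x)"
proof -
  have "(f has_derivative D) (at x) \<longleftrightarrow> (g has_derivative D) (at x)" for D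
    using has_derivative_transform_within_open[of f D x UNIV T g]
      has_derivative_transform_within_open[of g D x UNIV T f] assms by auto
  then show ?thesis by (simp add: frechet_derivative_def)
qed

lemma Ck_on_local:
  assumes "Ck_on k f S" "open S" "open T" "T \<subseteq> S" "\<And>x. x \<in> T \<Longrightarrow> f x = g x"
  shows "Ck_on k g T"
  using assms(1,5)
proof (induction k arbitrary: f g)
  case 0
  have "continuous_on S f" using 0(1) by simp
  then have "continuous_on T f" by (rule continuous_on_subset[OF _ assms(4)])
  then have "continuous_on T g" by (rule continuous_on_eq) (rule 0(2))
  then show ?case by simp
next
  case (Suc k)
  have "g differentiable_on T"
    unfolding differentiable_on_def
  proof
    fix x assume x: "x \<in> T"
    then have "f differentiable (at x)"
      using Suc.prems(1) assms(4) by (auto simp: differentiable_on_def at_within_open[OF _ assms(2)])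
    then obtain D where "(f has_derivative D) (at x)" unfolding differentiable_def by blast
    then have "(g has_derivative D) (at x)"
      by (rule has_derivative_transform_within_open[OF _ assms(3) x]) (use Suc.prems(2) in auto)
    then show "g differentiable (at x within T)"
      unfolding differentiable_def using at_within_open[OF x assms(3)] by auto
  qed
  moreover have "Ck_on k (\<lambda>x. frechet_derivative g (at x within T) v) T" for v
  proof (rule Suc.IH)
    show "Ck_on k (\<lambda>x. frechet_derivative f (at x within S) v) S" using Suc.prems by simp
    fix x assume x: "x \<in> T"
    then show "frechet_derivative f (at x within S) v = frechet_derivative g (at x within T) v"
      using frechet_derivative_local[OF assms(3) x, of f g] Suc.prems(2) assms(2-4)
      by (simp add: at_within_open[OF x assms(3)] at_within_open[OF subsetD[OF assms(4) x] assms(2)])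
  qed
  ultimately show ?case by simp
qed

text \<open>The last claim holds because Df(x) is linear for all x in a neighbourhood of z, and
  linear relations between functions near z pass to their derivatives at z. With linearity in the
  other direction it makes the second derivative a bilinear form.\<close>

lemma C2_outside_derivatives:
  fixes f :: "'a::euclidean_space \<Rightarrow> real"
  assumes f: "Ck_on 2 f (- cball 0 R)" and z: "norm z > R"
  shows "(f has_derivative frechet_derivative f (at z)) (at z)"
    and "((\<lambda>x. frechet_derivative f (at x) v) has_derivative
      frechet_derivative (\<lambda>x. frechet_derivative f (at x) v) (at z)) (at z)"
    and "linear (\<lambda>v. frechet_derivative (\<lambda>x. frechet_derivative f (at x) v) (at z) w)"
proof -
  let ?S = "- cball 0 R :: 'a set"
  have S: "open ?S" by auto
  have in_S: "x \<in> ?S \<longleftrightarrow> norm x > R" for x by auto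
  have d: "f differentiable (at x)" if "norm x > R" for x
    using f that unfolding numeral_2_eq_2 by (auto simp: differentiable_on_def at_within_open[OF _ S] in_S)
  then show *: "(f has_derivative frechet_derivative f (at z)) (at z)" using z by (simp add: frechet_derivative_works)
  have "(\<lambda>x. frechet_derivative f (at x) v) differentiable (at z)" for v
  proof -
    have "(\<lambda>x. frechet_derivative f (at x within ?S) v) differentiable (at z)"
      using f z unfolding numeral_2_eq_2 by (auto simp: differentiable_on_def at_within_open[OF _ S] in_S)
    then obtain D where "((\<lambda>x. frechet_derivative f (at x within ?S) v) has_derivative D) (at z)"
      unfolding differentiable_def by blast
    then have "((\<lambda>x. frechet_derivative f (at x) v) has_derivative D) (at z)"
      by (rule has_derivative_transform_within_open[OF _ S]) (use z in \<open>auto simp: at_within_open[OF _ S]\<close>)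
    then show ?thesis unfolding differentiable_def by blast
  qed
  then have dd: "((\<lambda>x. frechet_derivative f (at x) v) has_derivative
      frechet_derivative (\<lambda>x. frechet_derivative f (at x) v) (at z)) (at z)" for v
    by (simp add: frechet_derivative_works)
  then show "((\<lambda>x. frechet_derivative f (at x) v) has_derivative
      frechet_derivative (\<lambda>x. frechet_derivative f (at x) v) (at z)) (at z)" .
  have lin: "linear (frechet_derivative f (at x))" if "norm x > R" for x
    using d[OF that] by (rule linear_frechet_derivative)
  show "linear (\<lambda>v. frechet_derivative (\<lambda>x. frechet_derivative f (at x) v) (at z) w)"
  proof (rule linearI)
    fix a b
    have "frechet_derivative (\<lambda>x. frechet_derivative f (at x) (a + b)) (at z) =
      frechet_derivative (\<lambda>x. frechet_derivative f (at x) a + frechet_derivative f (at x) b) (at z)"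
      by (rule frechet_derivative_local[OF S]) (use z lin in \<open>auto simp: linear_add\<close>)
    also have "\<dots> = (\<lambda>w. frechet_derivative (\<lambda>x. frechet_derivative f (at x) a) (at z) w
        + frechet_derivative (\<lambda>x. frechet_derivative f (at x) b) (at z) w)"
      by (rule frechet_derivative_at[symmetric]) (intro has_derivative_add dd)
    finally show "frechet_derivative (\<lambda>x. frechet_derivative f (at x) (a + b)) (at z) w =
      frechet_derivative (\<lambda>x. frechet_derivative f (at x) a) (at z) w
        + frechet_derivative (\<lambda>x. frechet_derivative f (at x) b) (at z) w" by simp
  next
    fix a and r :: real
    have "frechet_derivative (\<lambda>x. frechet_derivative f (at x) (r *\<^sub>R a)) (at z) =
      frechet_derivative (\<lambda>x. r *\<^sub>R frechet_derivative f (at x) a) (at z)"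
      by (rule frechet_derivative_local[OF S]) (use z lin in \<open>auto simp: linear_scale\<close>)
    also have "\<dots> = (\<lambda>w. r *\<^sub>R frechet_derivative (\<lambda>x. frechet_derivative f (at x) a) (at z) w)"
      by (rule frechet_derivative_at[symmetric]) (intro has_derivative_scaleR_right dd)
    finally show "frechet_derivative (\<lambda>x. frechet_derivative f (at x) (r *\<^sub>R a)) (at z) w =
      r *\<^sub>R frechet_derivative (\<lambda>x. frechet_derivative f (at x) a) (at z) w" by simp
  qed
qed

text \<open>On basis matrices the bilinear form is an entry of the array \<open>D2\<close>, hence
  bounded by the norm of the array. Extending to arbitrary arguments, one slot at a time, costs the
  dimension twice.\<close>

lemma second_derivative_le_D2:
  fixes f g :: "real ^ 'n ^ 'm \<Rightarrow> real"
  assumes f: "Ck_on 2 f (- cball 0 R)" and g: "Ck_on 2 g (- cball 0 R)" and z: "norm z > R"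
  shows "\<bar>frechet_derivative (\<lambda>x. frechet_derivative f (at x) v) (at z) w
      - frechet_derivative (\<lambda>x. frechet_derivative g (at x) v) (at z) w\<bar>
    \<le> (real DIM(real ^ 'n ^ 'm))\<^sup>2 * norm (D2 f z - D2 g z) * norm v * norm w"
proof -
  define u2 where "u2 = (\<lambda>v w. frechet_derivative (\<lambda>x. frechet_derivative f (at x) v) (at z) w
      - frechet_derivative (\<lambda>x. frechet_derivative g (at x) v) (at z) w)"
  have l1: "linear (u2 v)" for v
    unfolding u2_def using C2_outside_derivatives(2)[OF f z] C2_outside_derivatives(2)[OF g z]
    by (intro linear_compose_sub has_derivative_linear) auto
  have l2: "linear (\<lambda>v. u2 v w)" for w
    unfolding u2_def by (intro linear_compose_sub C2_outside_derivatives(3)[OF f z] C2_outside_derivatives(3)[OF g z])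
  let ?N = "norm (D2 f z - D2 g z)"
  have bb: "\<bar>u2 b b'\<bar> \<le> ?N" if "b \<in> Basis" "b' \<in> Basis" for b b'
  proof -
    have "\<exists>i j. a = axis i (axis j 1)" if "a \<in> Basis" for a :: "real ^ 'n ^ 'm"
      using that by (auto simp: Basis_vec_def)
    then obtain i j k l where b: "b = axis i (axis j 1)" "b' = axis k (axis l 1)"
      using \<open>b \<in> Basis\<close> \<open>b' \<in> Basis\<close> by metis
    define X where "X = D2 f z - D2 g z"
    have "u2 b b' = X $ i $ j $ k $ l" by (simp add: u2_def D2_def b X_def)
    moreover have "norm (X $ i $ j $ k $ l) \<le> norm X"
      by (intro order_trans[OF Finite_Cartesian_Product.norm_nth_le] order_refl)
    ultimately show ?thesis by (simp add: X_def)
  qed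
  have "\<bar>u2 b w\<bar> \<le> real DIM(real ^ 'n ^ 'm) * ?N * norm w" if "b \<in> Basis" for b w
    using linear_bound_Basis[OF l1, of b ?N w] bb that by auto
  then have "\<bar>u2 v w\<bar> \<le> real DIM(real ^ 'n ^ 'm) * (real DIM(real ^ 'n ^ 'm) * ?N * norm w) * norm v"
    by (intro linear_bound_Basis[OF l2]) auto
  then show ?thesis by (simp add: u2_def power2_eq_square mult_ac)
qed

context orlicz begin

text \<open>Forward, g inherits its regularity from f where the two agree, and the quotient is
  eventually zero. Backward, the cut-off vanishes where f - g may fail to be differentiable and
  equals 1 beyond norm 2 R, so the perturbed g coincides with f there.\<close>

lemma asymp_quasiconvex_D2:
  fixes f :: "real ^ 'n ^ 'm \<Rightarrow> real"
  assumes f: "C2_outside_large_ball f"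
  shows "asymp_quasiconvex \<phi> f \<longleftrightarrow>
          (\<exists>g. unif_strictly_quasiconvex \<phi> g \<and> C2_outside_large_ball g \<and>
             ((\<lambda>z. norm (D2 f z - D2 g z) / deriv (deriv \<phi>) (norm z)) \<longlongrightarrow> 0) at_infinity)"
proof
  assume "asymp_quasiconvex \<phi> f"
  then obtain M g where M: "M > 0" and g: "unif_strictly_quasiconvex \<phi> g" and eq: "\<And>z. norm z > M \<Longrightarrow> f z = g z"
    unfolding asymp_quasiconvex_def by blast
  obtain R where R: "R > 0" "Ck_on 2 f (- cball 0 R)" using f unfolding C2_outside_large_ball_def by blast
  define T where "T = (- cball 0 (max R M) :: (real ^ 'n ^ 'm) set)"
  have T: "open T" "\<And>z. z \<in> T \<longleftrightarrow> norm z > max R M" by (auto simp: T_def)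
  have "Ck_on 2 g T" by (rule Ck_on_local[OF R(2) _ T(1)]) (use eq T(2) in auto)
  then have C2g: "C2_outside_large_ball g" unfolding C2_outside_large_ball_def T_def
    using R(1) by (intro exI[of _ "max R M"]) auto
  have D2eq: "D2 f z = D2 g z" if "norm z > max R M" for z
  proof -
    have "frechet_derivative f (at w) = frechet_derivative g (at w)" if "w \<in> T" for w
      using that by (intro frechet_derivative_local[OF T(1)]) (use eq T(2) in auto)
    then have "frechet_derivative (\<lambda>w. frechet_derivative f (at w) v) (at z)
       = frechet_derivative (\<lambda>w. frechet_derivative g (at w) v) (at z)" for v
      using that by (intro frechet_derivative_local[OF T(1)]) (use T(2) in auto)
    then show ?thesis by (simp add: D2_def)
  qed
  have "((\<lambda>z. norm (D2 f z - D2 g z) / deriv (deriv \<phi>) (norm z)) \<longlongrightarrow> 0) at_infinity"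
    by (rule tendsto_eventually) (use D2eq in \<open>force simp: eventually_at_infinity intro!: exI[of _ "max R M + 1"]\<close>)
  then show "\<exists>g. unif_strictly_quasiconvex \<phi> g \<and> C2_outside_large_ball g \<and>
     ((\<lambda>z. norm (D2 f z - D2 g z) / deriv (deriv \<phi>) (norm z)) \<longlongrightarrow> 0) at_infinity"
    using g C2g by blast
next
  assume "\<exists>g. unif_strictly_quasiconvex \<phi> g \<and> C2_outside_large_ball g \<and>
     ((\<lambda>z. norm (D2 f z - D2 g z) / deriv (deriv \<phi>) (norm z)) \<longlongrightarrow> 0) at_infinity"
  then obtain g where g: "unif_strictly_quasiconvex \<phi> g" "C2_outside_large_ball g"
     and lim0: "((\<lambda>z. norm (D2 f z - D2 g z) / deriv (deriv \<phi>) (norm z)) \<longlongrightarrow> 0) at_infinity" by blast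
  obtain Rf Rg where Rf: "Ck_on 2 f (- cball 0 Rf)" and Rg: "Ck_on 2 g (- cball 0 Rg)"
    using f g(2) unfolding C2_outside_large_ball_def by blast
  define R0 where "R0 = max Rf Rg"
  have Cf: "Ck_on 2 f (- cball 0 R0)" by (rule Ck_on_local[OF Rf]) (auto simp: R0_def)
  have Cg: "Ck_on 2 g (- cball 0 R0)" by (rule Ck_on_local[OF Rg]) (auto simp: R0_def)
  define K where "K = (real DIM(real ^ 'n ^ 'm))\<^sup>2"
  have K: "K > 0" by (simp add: K_def)
  have "\<exists>R>1. unif_strictly_quasiconvex \<phi> (\<lambda>z. g z + (cutoff ((z \<bullet> z) / R\<^sup>2) * (f z - g z) + 0))"
  proof (rule unif_strictly_quasiconvex_cutoff[OF g(1)])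
    fix z :: "real ^ 'n ^ 'm" assume z: "norm z > R0"
    show "((\<lambda>z. f z - g z) has_derivative (\<lambda>v. frechet_derivative f (at z) v - frechet_derivative g (at z) v)) (at z)"
      by (intro has_derivative_diff C2_outside_derivatives(1)[OF Cf z] C2_outside_derivatives(1)[OF Cg z])
    show "((\<lambda>z. frechet_derivative f (at z) v - frechet_derivative g (at z) v) has_derivative
        (\<lambda>w. frechet_derivative (\<lambda>x. frechet_derivative f (at x) v) (at z) w
          - frechet_derivative (\<lambda>x. frechet_derivative g (at x) v) (at z) w)) (at z)" for v
      by (intro has_derivative_diff C2_outside_derivatives(2)[OF Cf z] C2_outside_derivatives(2)[OF Cg z])
  next
    fix e :: real assume e: "e > 0"
    have "\<forall>\<^sub>F z in at_infinity. norm (D2 f z - D2 g z) / deriv (deriv \<phi>) (norm z) < e / K"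
      using order_tendstoD(2)[OF lim0, of "e / K"] e K by simp
    then show "\<forall>\<^sub>F z in at_infinity. \<forall>v w. \<bar>frechet_derivative (\<lambda>x. frechet_derivative f (at x) v) (at z) w
          - frechet_derivative (\<lambda>x. frechet_derivative g (at x) v) (at z) w\<bar> \<le> e * deriv (deriv \<phi>) (norm z) * norm v * norm w"
      using eventually_norm_ge[of "\<bar>R0\<bar> + 1"]
    proof eventually_elim
      case (elim z)
      have s: "deriv (deriv \<phi>) (norm z) > 0" by (rule second_pos) (use elim in auto)
      have "K * norm (D2 f z - D2 g z) \<le> e * deriv (deriv \<phi>) (norm z)"
        using elim(1) s K by (simp add: field_simps)
      then have 1: "K * norm (D2 f z - D2 g z) * norm v * norm w \<le> e * deriv (deriv \<phi>) (norm z) * norm v * norm w"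
        for v w :: "real ^ 'n ^ 'm" by (intro mult_right_mono) auto
      have "norm z > R0" using elim(2) by linarith
      from second_derivative_le_D2[OF Cf Cg this, folded K_def] 1 show ?case by (blast intro: order_trans)
    qed
  qed
  then obtain R where R: "R > 1" "unif_strictly_quasiconvex \<phi> (\<lambda>z. g z + cutoff ((z \<bullet> z) / R\<^sup>2) * (f z - g z))"
    by auto
  show "asymp_quasiconvex \<phi> f"
    unfolding asymp_quasiconvex_def
    by (intro exI[of _ "2 * R"] conjI exI[of _ "\<lambda>z. g z + cutoff ((z \<bullet> z) / R\<^sup>2) * (f z - g z)"] R(2))
      (use R(1) in \<open>auto simp: cutoff_outside\<close>)
qed

end

section \<open>Characterizations (ii) and (iii)\<close>

lemma locally_bdd_below_cball:
  fixes f :: "'a::euclidean_space \<Rightarrow> real"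
  assumes "locally_bdd_below f"
  shows "\<exists>B. \<forall>z\<in>cball 0 M. f z \<ge> B"
proof -
  obtain e where e: "\<And>z. e z > 0" "\<And>z. bdd_below (f ` ball z (e z))"
    using assms unfolding locally_bdd_below_def by metis
  have "cball 0 M \<subseteq> (\<Union>z\<in>cball 0 M. ball z (e z))" using e(1) by force
  then obtain F where F: "finite F" "cball 0 M \<subseteq> (\<Union>z\<in>F. ball z (e z))"
    by (rule compactE_image[OF compact_cball, rotated]) (simp, blast)
  have "bdd_below (f ` (\<Union>z\<in>F. ball z (e z)))"
    unfolding image_UN using F(1) e(2) by (simp add: bdd_below_UN)
  then obtain B where "\<And>y. y \<in> f ` (\<Union>z\<in>F. ball z (e z)) \<Longrightarrow> B \<le> y" by (auto simp: bdd_below_def)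
  then show ?thesis using F(2) by (intro exI[of _ B]) blast
qed

context orlicz begin

lemma asymp_quasiconvex_below:
  fixes f :: "real ^ 'n ^ 'm \<Rightarrow> real"
  assumes f: "locally_bdd_below f"
  shows "asymp_quasiconvex \<phi> f \<longleftrightarrow>
          (\<exists>M>0. \<exists>g. unif_strictly_quasiconvex \<phi> g \<and>
             (\<forall>z. norm z > M \<longrightarrow> f z = g z) \<and> (\<forall>z. g z \<le> f z))"
proof
  assume "asymp_quasiconvex \<phi> f"
  then obtain M g where M: "M > 0" and g: "unif_strictly_quasiconvex \<phi> g" and eq: "\<And>z. norm z > M \<Longrightarrow> f z = g z"
    unfolding asymp_quasiconvex_def by blast
  obtain B where "\<forall>z\<in>cball 0 M. f z \<ge> B" using locally_bdd_below_cball[OF f] by blast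
  then have B: "f z \<ge> B" if "norm z \<le> M" for z using that by simp
  have "bounded_on_balls g"
    using g by (intro continuous_bounded_on_balls) (simp add: unif_strictly_quasiconvex_def)
  then obtain C where C: "\<And>z. norm z \<le> M \<Longrightarrow> \<bar>g z\<bar> \<le> C" unfolding bounded_on_balls_def by blast
  \<comment> \<open>On the ball of radius M one has g \<le> C and f \<ge> B, so lowering g by c
    pushes it below f there. The bump has height c on the larger ball of radius R, and outside
    radius M, where f = g, lowering g cannot hurt.\<close>
  define c where "c = \<bar>C\<bar> + \<bar>B\<bar>"
  obtain R where R: "R > M" and q: "unif_strictly_quasiconvex \<phi> (\<lambda>z. g z + - c * (1 - cutoff ((z \<bullet> z) / R\<^sup>2)))"
    using unif_strictly_quasiconvex_bump[OF g] by blast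
  have le: "g z + - c * (1 - cutoff ((z \<bullet> z) / R\<^sup>2)) \<le> f z" for z
  proof (cases "norm z \<le> M")
    case True
    then show ?thesis using R B[OF True] C[OF True] by (simp add: cutoff_inside c_def)
  next
    case False
    have "c * (1 - cutoff ((z \<bullet> z) / R\<^sup>2)) \<ge> 0" using cut_bounds(2) by (simp add: c_def)
    then show ?thesis using eq[of z] False by simp
  qed
  have e: "f z = g z + - c * (1 - cutoff ((z \<bullet> z) / R\<^sup>2))" if "norm z > 2 * R" for z
    using eq[of z] that R M by (simp add: cutoff_outside)
  show "\<exists>M>0. \<exists>g. unif_strictly_quasiconvex \<phi> g \<and>
             (\<forall>z. norm z > M \<longrightarrow> f z = g z) \<and> (\<forall>z. g z \<le> f z)"
  proof (intro exI conjI allI impI)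
    show "0 < 2 * R" using R M by simp
  qed (rule q e le; assumption?)+
qed (auto simp: asymp_quasiconvex_def)

lemma asymp_quasiconvex_above:
  fixes f :: "real ^ 'n ^ 'm \<Rightarrow> real"
  assumes f: "locally_bdd_above f"
  shows "asymp_quasiconvex \<phi> f \<longleftrightarrow>
          (\<exists>M>0. \<exists>g. unif_strictly_quasiconvex \<phi> g \<and>
             (\<forall>z. norm z > M \<longrightarrow> f z = g z) \<and> (\<forall>z. g z \<ge> f z))"
proof
  assume "asymp_quasiconvex \<phi> f"
  then obtain M g where M: "M > 0" and g: "unif_strictly_quasiconvex \<phi> g" and eq: "\<And>z. norm z > M \<Longrightarrow> f z = g z"
    unfolding asymp_quasiconvex_def by blast
  \<comment> \<open>The upper bound on a ball is obtained from the covering argument applied to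
    -f.\<close>
  have "locally_bdd_below (\<lambda>z. - f z)"
    unfolding locally_bdd_below_def
  proof
    fix z
    obtain e B where "e > 0" "\<And>x. x \<in> ball z e \<Longrightarrow> f x \<le> B"
      using f unfolding locally_bdd_above_def bdd_above_def by (metis imageI)
    then show "\<exists>e>0. bdd_below ((\<lambda>z. - f z) ` ball z e)"
      by (intro exI[of _ e] conjI bdd_belowI2[of _ "- B"]) auto
  qed
  from locally_bdd_below_cball[OF this] obtain B where "\<forall>z\<in>cball 0 M. - f z \<ge> B" by blast
  then have B: "- f z \<ge> B" if "norm z \<le> M" for z using that by simp
  have "bounded_on_balls g"
    using g by (intro continuous_bounded_on_balls) (simp add: unif_strictly_quasiconvex_def)
  then obtain C where C: "\<And>z. norm z \<le> M \<Longrightarrow> \<bar>g z\<bar> \<le> C" unfolding bounded_on_balls_def by blast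
  define c where "c = \<bar>C\<bar> + \<bar>B\<bar>"
  obtain R where R: "R > M" and q: "unif_strictly_quasiconvex \<phi> (\<lambda>z. g z + c * (1 - cutoff ((z \<bullet> z) / R\<^sup>2)))"
    using unif_strictly_quasiconvex_bump[OF g] by blast
  have le: "g z + c * (1 - cutoff ((z \<bullet> z) / R\<^sup>2)) \<ge> f z" for z
  proof (cases "norm z \<le> M")
    case True
    then show ?thesis using R B[OF True] C[OF True] by (simp add: cutoff_inside c_def)
  next
    case False
    have "c * (1 - cutoff ((z \<bullet> z) / R\<^sup>2)) \<ge> 0" using cut_bounds(2) by (simp add: c_def)
    then show ?thesis using eq[of z] False by simp
  qed
  have e: "f z = g z + c * (1 - cutoff ((z \<bullet> z) / R\<^sup>2))" if "norm z > 2 * R" for z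
    using eq[of z] that R M by (simp add: cutoff_outside)
  show "\<exists>M>0. \<exists>g. unif_strictly_quasiconvex \<phi> g \<and>
             (\<forall>z. norm z > M \<longrightarrow> f z = g z) \<and> (\<forall>z. g z \<ge> f z)"
  proof (intro exI conjI allI impI)
    show "0 < 2 * R" using R M by simp
  qed (rule q e le; assumption?)+
qed (auto simp: asymp_quasiconvex_def)

end

section \<open>Boundary layers and Lipschitz estimates\<close>

text \<open>The rank-one matrix a b^T: the contribution to a Jacobian of a scalar factor with
  gradient b in front of a vector a.\<close>

definition outer :: "real ^ 'm \<Rightarrow> real ^ 'n \<Rightarrow> real ^ 'n ^ 'm" where
  "outer a b = (\<chi> i. a $ i *\<^sub>R b)"

lemma outer_mult_vec: "outer a b *v v = (b \<bullet> v) *\<^sub>R a"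
  by (simp add: vec_eq_iff outer_def matrix_vector_mult_def inner_vec_def sum_distrib_left mult_ac)

lemma norm_outer: "norm (outer a b) = norm a * norm b"
  unfolding outer_def norm_vec_def[of "\<chi> i. a $ i *\<^sub>R b"] norm_vec_def[of a]
  by (simp add: L2_set_left_distrib)

lemma norm_mult_vec_le:
  fixes A :: "real ^ 'n ^ 'm"
  shows "norm (A *v x) \<le> norm A * norm x"
proof -
  have "norm (A *v x) \<le> L2_set (\<lambda>i. norm (A $ i) * norm x) UNIV"
    unfolding norm_vec_def[of "A *v x"]
  proof (rule L2_set_mono)
    fix i
    have "(A *v x) $ i = A $ i \<bullet> x" by (simp add: matrix_vector_mult_def inner_vec_def)
    then show "norm ((A *v x) $ i) \<le> norm (A $ i) * norm x" by (simp add: Cauchy_Schwarz_ineq2)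
  qed auto
  also have "\<dots> = norm A * norm x" unfolding norm_vec_def[of A] by (simp add: L2_set_left_distrib)
  finally show ?thesis .
qed

text \<open>Prescribing the gradient \<open>h + D\<zeta>\<close> on a smaller ball costs a gradient of size
  \<open>\<bar>h\<bar> / (1 - r)\<close> in the remaining layer.\<close>

lemma layer_test_function:
  fixes \<zeta> :: "real ^ 'n \<Rightarrow> real ^ 'm" and h :: "real ^ 'n ^ 'm"
  assumes zeta: "\<zeta> \<in> Ckc_ball 1" and r: "0 < r" "r < 1"
  shows "\<exists>\<xi>\<in>Ckc_ball 1. \<forall>x. (norm x < r \<longrightarrow> jacobian \<xi> (at x) = h + jacobian \<zeta> (at (x /\<^sub>R r))) \<and>
    (norm x \<ge> r \<longrightarrow> norm (jacobian \<xi> (at x)) \<le> 37 * norm h / (1 - r))"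
proof -
  \<comment> \<open>In the variable |x|^2 the cut-off is switched between r^2 and r^2 + d. Half of
    the room up to 1 is left free, which keeps the support inside the open ball.\<close>
  define d where "d = (1 - r\<^sup>2) / 2"
  have d: "d > 0" using r by (simp add: d_def power_less_one_iff abs_square_less_1)
  have d2: "1 - r \<le> 2 * d"
  proof -
    have "r\<^sup>2 \<le> r" using r by (simp add: power2_eq_square mult_left_le)
    then show ?thesis by (simp add: d_def)
  qed
  define s where "s = (\<lambda>x::real^'n. 1 + (x \<bullet> x - r\<^sup>2) / d)"
  \<comment> \<open>The prefactor r in the rescaled copy of \<zeta> cancels when differentiating, so
    its gradient is D\<zeta> at x/r.\<close>
  define \<xi> where "\<xi> = (\<lambda>x. (1 - cutoff (s x)) *\<^sub>R (h *v x) + r *\<^sub>R \<zeta> (x /\<^sub>R r))"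
  define J where "J = (\<lambda>x. (1 - cutoff (s x)) *\<^sub>R h + outer (h *v x) (- (cut1 (s x) * 2 / d) *\<^sub>R x)
      + jacobian \<zeta> (at (x /\<^sub>R r)))"
  have lo: "s x \<le> 1" if "norm x \<le> r" for x
    using that r d power_mono[of "norm x" r 2] by (simp add: s_def power2_norm_eq_inner divide_nonpos_pos)
  have hi: "s x \<ge> 2" if "norm x \<ge> sqrt (r\<^sup>2 + d)" for x
    using power_mono[OF that, of 2] d by (simp add: s_def power2_norm_eq_inner field_simps)
  have sd: "(s has_derivative (\<lambda>v. 2 * (x \<bullet> v) / d)) (at x)" for x
    unfolding s_def divide_inverse by (auto intro!: derivative_eq_intros simp: inner_commute algebra_simps)
  have cd: "((\<lambda>x. 1 - cutoff (s x)) has_derivative (\<lambda>v. - (cut1 (s x) * (2 * (x \<bullet> v) / d)))) (at x)" for x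
    using has_derivative_diff[OF has_derivative_const has_derivative_compose[OF sd DERIV_cut[unfolded has_field_derivative_def]]]
    by simp
  have zd: "((\<lambda>x. \<zeta> (x /\<^sub>R r)) has_derivative (\<lambda>v. jacobian \<zeta> (at (x /\<^sub>R r)) *v (v /\<^sub>R r))) (at x)" for x
    by (rule has_derivative_compose[where f = "\<lambda>x. x /\<^sub>R r" and g = \<zeta>, OF _ Ckc_ballD(1)[OF zeta]])
      (auto intro!: derivative_eq_intros)
  have hd: "((\<lambda>x. h *v x) has_derivative (\<lambda>v. h *v v)) (at x)" for x
    by (rule bounded_linear.has_derivative[where f = "\<lambda>v. h *v v", OF matrix_vector_mul_bounded_linear has_derivative_ident])
  have der: "(\<xi> has_derivative (\<lambda>v. J x *v v)) (at x)" for x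
    unfolding \<xi>_def
    by (rule has_derivative_eq_rhs[OF has_derivative_add[OF has_derivative_scaleR[OF cd hd] has_derivative_scaleR_right[OF zd]]])
      (use r in \<open>simp add: fun_eq_iff J_def matrix_vector_mult_add_rdistrib outer_mult_vec scaleR_matrix_vector_assoc[symmetric]
         matrix_vector_mult_scaleR\<close>)
  obtain r' where r': "r' < 1" "\<And>x. norm x \<ge> r' \<Longrightarrow> \<zeta> x = 0 \<and> jacobian \<zeta> (at x) = 0"
    using Ckc_ballD(3)[OF zeta] by blast
  have z0: "\<zeta> (x /\<^sub>R r) = 0 \<and> jacobian \<zeta> (at (x /\<^sub>R r)) = 0" if "norm x \<ge> r" for x
  proof (rule r'(2))
    have "norm (x /\<^sub>R r) \<ge> 1" using that r by (simp add: field_simps)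
    then show "r' \<le> norm (x /\<^sub>R r)" using r' by linarith
  qed
  have cc: "continuous_on UNIV (\<lambda>x. cutoff (s x))" "continuous_on UNIV (\<lambda>x. cut1 (s x))"
  proof -
    have 1: "continuous_on UNIV cutoff" "continuous_on UNIV cut1"
      using DERIV_cut DERIV_cut1 by (auto intro!: continuous_at_imp_continuous_on DERIV_isCont)
    have 2: "continuous_on UNIV s" unfolding s_def using d by (intro continuous_intros) auto
    show "continuous_on UNIV (\<lambda>x. cutoff (s x))" "continuous_on UNIV (\<lambda>x. cut1 (s x))"
      using continuous_on_compose2[OF 1(1) 2] continuous_on_compose2[OF 1(2) 2] by auto
  qed
  have cont: "continuous_on UNIV J"
  proof -
    have "continuous_on UNIV (\<lambda>x. jacobian \<zeta> (at (x /\<^sub>R r)))"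
      by (rule continuous_on_compose2[OF Ckc_ballD(2)[OF zeta]]) (auto intro!: continuous_intros)
    moreover have "continuous_on UNIV (\<lambda>x. h *v x)"
      using hd by (auto intro!: has_derivative_continuous continuous_at_imp_continuous_on)
    ultimately show ?thesis unfolding J_def outer_def using cc d by (intro continuous_intros) auto
  qed
  have rd: "r\<^sup>2 + d < 1" using d by (simp add: d_def field_simps)
  have rs: "r \<le> sqrt (r\<^sup>2 + d)" using d r by (intro real_le_rsqrt) auto
  have xi: "\<xi> \<in> Ckc_ball 1"
  proof (rule Ckc_ballI[OF der cont, of "sqrt (r\<^sup>2 + d)"])
    show "sqrt (r\<^sup>2 + d) < 1" using rd by simp
    fix x :: "real^'n" assume x: "norm x > sqrt (r\<^sup>2 + d)"
    then show "\<xi> x = 0" using z0[of x] hi[of x] rs by (simp add: \<xi>_def cut_high)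
  qed
  have jac: "jacobian \<xi> (at x) = J x" for x by (rule jacobian_eqI[OF der])
  have "J x = h + jacobian \<zeta> (at (x /\<^sub>R r))" if "norm x < r" for x
    using that lo[of x] by (simp add: J_def cut_low vec_eq_iff outer_def)
  moreover have "norm (J x) \<le> 37 * norm h / (1 - r)" if x: "norm x \<ge> r" for x
  proof (cases "s x \<ge> 2")
    case True
    then have "J x = 0" using z0[OF x] by (simp add: J_def cut_high vec_eq_iff outer_def)
    then show ?thesis using r by simp
  next
    case False
    then have "norm x < sqrt (r\<^sup>2 + d)" using hi[of x] by linarith
    moreover have "sqrt (r\<^sup>2 + d) < 1" using rd by simp
    ultimately have x1: "norm x \<le> 1" by linarith
    have "norm (J x) \<le> norm ((1 - cutoff (s x)) *\<^sub>R h) + norm (outer (h *v x) (- (cut1 (s x) * 2 / d) *\<^sub>R x))"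
      using z0[OF x] norm_triangle_ineq by (simp only: J_def add_0_right)
    \<comment> \<open>18 = 2 * 9, where 9 bounds \<open>cut1\<close>. As 1 - r \<le> 2 d, this turns
      into 36/(1 - r), and the undifferentiated term raises it to 37/(1 - r).\<close>
    also have "\<dots> \<le> norm h + norm h * (18 / d)"
    proof (rule add_mono)
      show "norm ((1 - cutoff (s x)) *\<^sub>R h) \<le> norm h"
        using cut_bounds(1,2)[of "s x"] by (simp add: mult_left_le_one_le)
      have "norm (h *v x) \<le> norm h * 1"
        using norm_mult_vec_le[of h x] x1 by (meson mult_left_mono norm_ge_zero order_trans)
      moreover have "norm (- (cut1 (s x) * 2 / d) *\<^sub>R x) \<le> 18 / d * 1"
        unfolding norm_scaleR using cut_bounds(3)[of "s x"] d x1
        by (intro mult_mono) (auto simp: abs_mult divide_right_mono)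
      ultimately show "norm (outer (h *v x) (- (cut1 (s x) * 2 / d) *\<^sub>R x)) \<le> norm h * (18 / d)"
        unfolding norm_outer using mult_mono by fastforce
    qed
    also have "\<dots> \<le> norm h * (1 / (1 - r)) + norm h * (36 / (1 - r))"
    proof (intro add_mono mult_left_mono)
      show "norm h \<le> norm h * (1 / (1 - r))" using r mult_left_mono[of 1 "1 / (1-r)" "norm h"] by simp
      show "18 / d \<le> 36 / (1 - r)" using d2 d r by (simp add: field_simps)
    qed auto
    also have "\<dots> = 37 * norm h / (1 - r)" by (simp add: add_divide_distrib[symmetric])
    finally show ?thesis .
  qed
  ultimately show ?thesis using xi jac by (intro bexI[of _ \<xi>]) auto
qed

lemma integral_affine:
  fixes f :: "'a::euclidean_space \<Rightarrow> real"
  assumes "f \<in> borel_measurable borel" "r > 0"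
  shows "(\<integral>x. f x \<partial>lborel) = r ^ DIM('a) * (\<integral>x. f (c + r *\<^sub>R x) \<partial>lborel)"
proof -
  have "(\<integral>x. f x \<partial>lborel) = (\<integral>x. f x \<partial>density (distr lborel borel (\<lambda>x. c + r *\<^sub>R x)) (\<lambda>_. \<bar>r\<bar>^DIM('a)))"
    using lborel_affine[of r c] assms by simp
  also have "\<dots> = (\<integral>x. \<bar>r\<bar>^DIM('a) *\<^sub>R f x \<partial>distr lborel borel (\<lambda>x. c + r *\<^sub>R x))"
    using assms by (intro integral_density) auto
  also have "\<dots> = r ^ DIM('a) * (\<integral>x. f (c + r *\<^sub>R x) \<partial>lborel)"
    using assms by (subst integral_distr) auto
  finally show ?thesis .
qed

lemma set_integral_ball_scale:
  fixes H :: "'a::euclidean_space \<Rightarrow> real"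
  assumes "H \<in> borel_measurable borel" "r > 0"
  shows "(LBINT x:ball c r. H ((x - c) /\<^sub>R r)) = r ^ DIM('a) * (LBINT x:ball 0 1. H x)"
proof -
  have [measurable]: "H \<in> borel_measurable borel" by fact
  have "(\<lambda>x. H ((x - c) /\<^sub>R r)) \<in> borel_measurable borel"
    by (rule measurable_compose[OF _ assms(1)]) auto
  then have m: "(\<lambda>x. indicator (ball c r) x *\<^sub>R H ((x - c) /\<^sub>R r)) \<in> borel_measurable borel"
    by (intro borel_measurable_scaleR borel_measurable_indicator) auto
  have "indicator (ball c r) (c + r *\<^sub>R x) = (indicator (ball 0 1) x :: real)" for x
    using assms(2) by (auto simp: indicator_def dist_norm field_simps)
  then show ?thesis
    unfolding set_lebesgue_integral_def using integral_affine[OF m assms(2), of c] assms(2) by simp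
qed

text \<open>Transplants a test function used at z + h to the point z: the ball of radius r
  reproduces its average with weight r^n by scaling, and the layer, of relative volume 1 - r^n, is
  estimated by S alone. The result resembles a convexity inequality and is used as one.\<close>

lemma layer_average:
  fixes \<zeta> :: "real ^ 'n \<Rightarrow> real ^ 'm" and F :: "real ^ 'n ^ 'm \<Rightarrow> real"
  assumes zeta: "\<zeta> \<in> Ckc_ball 1" and r: "0 < r" "r < 1"
    and F: "F \<in> borel_measurable borel" "bounded_on_balls F"
    and S: "\<And>Y. norm Y \<le> 37 * norm h / (1 - r) \<Longrightarrow> F (z + Y) \<le> S"
  shows "\<exists>\<xi>\<in>Ckc_ball 1. ball_average (\<lambda>x. F (z + jacobian \<xi> (at x)))
     \<le> r ^ CARD('n) * ball_average (\<lambda>x. F (z + h + jacobian \<zeta> (at x))) + (1 - r ^ CARD('n)) * S"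
proof -
  obtain \<xi> where xi: "\<xi> \<in> Ckc_ball 1"
    and in_r: "\<And>x. norm x < r \<Longrightarrow> jacobian \<xi> (at x) = h + jacobian \<zeta> (at (x /\<^sub>R r))"
    and out_r: "\<And>x. norm x \<ge> r \<Longrightarrow> norm (jacobian \<xi> (at x)) \<le> 37 * norm h / (1 - r)"
    using layer_test_function[OF zeta r, of h] by blast
  let ?B = "ball (0::real^'n) 1" and ?C = "ball (0::real^'n) r"
  let ?f = "\<lambda>x. F (z + jacobian \<xi> (at x))"
  let ?H = "\<lambda>x. F (z + h + jacobian \<zeta> (at x))"
  define v where "v = measure lborel ?B"
  have v: "v > 0" using content_ball_pos[of 1 "0::real^'n"] by (simp add: v_def)
  have vC: "measure lborel ?C = r ^ CARD('n) * v"
    using content_ball_conv_unit_ball[of r "0::real^'n"] r by (simp add: v_def)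
  have sub: "?C \<subseteq> ?B" using r by auto
  have intf: "set_integrable lborel ?B ?f" by (rule comp_integrable[OF F xi])
  have intC: "set_integrable lborel ?C ?f" by (rule set_integrable_subset[OF intf]) (use sub in auto)
  have intD: "set_integrable lborel (?B - ?C) ?f" by (rule set_integrable_subset[OF intf]) auto
  have mD: "measure lborel (?B - ?C) = (1 - r ^ CARD('n)) * v"
    using measure_Diff[of lborel ?B ?C] sub vC by (simp add: v_def less_imp_neq left_diff_distrib)
  have eD: "emeasure lborel (?B - ?C) < top"
    by (rule le_less_trans[OF emeasure_mono emeasure_lborel_ball_less_top(1)[of "0::real^'n" 1]]) auto
  have Hm: "?H \<in> borel_measurable borel"
    by (rule measurable_compose[OF _ F(1)]) (intro borel_measurable_add borel_measurable_const
        borel_measurable_continuous_onI Ckc_ballD(2)[OF zeta])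
  have "(LBINT x:?C. ?f x) = (LBINT x:?C. ?H ((x - 0) /\<^sub>R r))"
    by (rule set_lebesgue_integral_cong) (auto simp: in_r add.assoc)
  also have "\<dots> = r ^ CARD('n) * (LBINT x:?B. ?H x)"
    using set_integral_ball_scale[OF Hm r(1), of 0] by simp
  finally have iC: "(LBINT x:?C. ?f x) = r ^ CARD('n) * (LBINT x:?B. ?H x)" .
  have "(LBINT x:?B - ?C. ?f x) \<le> (LBINT x:?B - ?C. S)"
  proof (rule set_integral_mono[OF intD])
    show "set_integrable lborel (?B - ?C) (\<lambda>x. S)"
      using eD by (simp add: set_integrable_def)
    show "?f x \<le> S" if "x \<in> ?B - ?C" for x using that out_r[of x] S by auto
  qed
  also have "\<dots> = (1 - r ^ CARD('n)) * v * S"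
    using eD mD by (subst set_integral_const) (auto simp: less_imp_neq)
  finally have iD: "(LBINT x:?B - ?C. ?f x) \<le> (1 - r ^ CARD('n)) * v * S" .
  have "(LBINT x:?B. ?f x) = (LBINT x:?C \<union> (?B - ?C). ?f x)" using sub by (simp add: Un_absorb1)
  also have "\<dots> = (LBINT x:?C. ?f x) + (LBINT x:?B - ?C. ?f x)"
    by (rule set_integral_Un[OF _ intC intD]) auto
  also have "\<dots> \<le> r ^ CARD('n) * (LBINT x:?B. ?H x) + (1 - r ^ CARD('n)) * v * S"
    using iC iD by simp
  finally have "1 / v * (LBINT x:?B. ?f x) \<le> 1 / v * (r ^ CARD('n) * (LBINT x:?B. ?H x) + (1 - r ^ CARD('n)) * v * S)"
    using v by (intro mult_left_mono) auto
  also have "\<dots> = r ^ CARD('n) * (1 / v * (LBINT x:?B. ?H x)) + (1 - r ^ CARD('n)) * S"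
    using v by (simp add: field_simps)
  finally show ?thesis using xi by (intro bexI[of _ \<xi>]) (simp add: ball_average_def v_def)
qed

lemma one_minus_power_le:
  assumes "0 \<le> r" "r \<le> (1::real)" shows "1 - r ^ n \<le> real n * (1 - r)"
  using Bernoulli_inequality[of "r - 1" n] assms by (simp add: algebra_simps)

section \<open>Necessity of the two conditions in (iv)\<close>

context orlicz begin

text \<open>f and g differ only on a ball. For |z| large, z + D\<xi> can enter that ball only where
  |D\<xi>| \<ge> |z|/2, and there the shifted function is so large that half of k times it outweighs
  the bounded difference; the other half of k remains.\<close>

lemma asymp_quasiconvex_imp_strict:
  fixes f :: "real ^ 'n ^ 'm \<Rightarrow> real"
  assumes f: "f \<in> borel_measurable borel" "bounded_on_balls f" and qc: "asymp_quasiconvex \<phi> f"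
  shows "\<exists>M>0. \<exists>k>0. \<forall>z. norm z > M \<longrightarrow> (\<forall>\<xi>\<in>Cinfc_ball.
      ball_average (\<lambda>x. f (z + jacobian \<xi> (at x)))
        \<ge> f z + k * ball_average (\<lambda>x. shifted \<phi> (norm z) (norm (jacobian \<xi> (at x)))))"
proof -
  obtain M g where M: "M > 0" and g: "unif_strictly_quasiconvex \<phi> g" and eq: "\<And>z. norm z > M \<Longrightarrow> f z = g z"
    using qc unfolding asymp_quasiconvex_def by blast
  obtain k where gc: "continuous_on UNIV g" and k: "k > 0" and q: "\<And>\<xi> z. \<xi> \<in> Ckc_ball 1 \<Longrightarrow>
      ball_average (\<lambda>x. g (z + jacobian \<xi> (at x)))
        \<ge> g z + k * ball_average (\<lambda>x. shifted \<phi> (1 + norm z) (norm (jacobian \<xi> (at x))))"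
    using g unfolding unif_strictly_quasiconvex_def by blast
  obtain C1 where C1: "\<And>w. norm w \<le> M \<Longrightarrow> \<bar>f w\<bar> \<le> C1" using f(2) unfolding bounded_on_balls_def by blast
  obtain C2 where C2: "\<And>w. norm w \<le> M \<Longrightarrow> \<bar>g w\<bar> \<le> C2"
    using continuous_bounded_on_balls[OF gc] unfolding bounded_on_balls_def by blast
  define C where "C = \<bar>C1\<bar> + \<bar>C2\<bar>"
  define K where "K = 4 * 2 powr c2"
  have K: "K > 0" by (simp add: K_def)
  obtain R where R: "\<And>z::real^'n^'m. norm z \<ge> R \<Longrightarrow> deriv \<phi> (norm z) \<ge> 16 * K * C / k"
    using eventually_deriv_norm_ge[of "16 * K * C / k"] unfolding eventually_at_infinity by blast
  define M' where "M' = max R (max (2 * M) 2)"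
  \<comment> \<open>For |z| \<ge> 2 the chain gives \<phi>'(|z|) \<le> 8 K
    \<open>shifted \<phi> (1 + norm z) t\<close>, so the threshold 16 K C / k leaves exactly 2 C / k
    as a lower bound for the shifted function.\<close>
  have sh: "C \<le> k / 2 * shifted \<phi> (1 + norm z) t" if z: "norm z > M'" and t: "t \<ge> norm z / 2" for z :: "real^'n^'m" and t
  proof -
    have z2: "norm z \<ge> 2" "norm z \<ge> R" using z by (auto simp: M'_def)
    have "16 * K * C / k \<le> deriv \<phi> (norm z)" by (rule R[OF z2(2)])
    also have "\<dots> \<le> norm z / 2 * deriv \<phi> (norm z)" using z2 pos[of "norm z"] mult_right_mono[of 1 "norm z / 2" "deriv \<phi> (norm z)"] by fastforce
    also have "\<dots> \<le> norm z / 2 * deriv \<phi> (1 + norm z + norm z / 2)"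
      using z2 by (intro mult_left_mono deriv_mono) auto
    also have "\<dots> = 4 * ((norm z / 2)\<^sup>2 * deriv \<phi> (1 + norm z + norm z / 2) / (2 * norm z)) * 1"
      using z2 by (simp add: power2_eq_square field_simps)
    also have "\<dots> \<le> 4 * ((norm z / 2)\<^sup>2 * deriv \<phi> (1 + norm z + norm z / 2) / (1 + norm z + norm z / 2)) * 2"
      using z2 pos[of "1 + norm z + norm z / 2"]
      by (intro mult_mono divide_left_mono mult_pos_pos add_pos_nonneg) (linarith | simp)+
    also have "\<dots> = 8 * weight (1 + norm z) (norm z / 2)" by (simp add: weight_def)
    also have "\<dots> \<le> 8 * (K * shifted \<phi> (1 + norm z) (norm z / 2))"
      unfolding K_def using z2 by (intro mult_left_mono weight_le_shifted) auto
    also have "\<dots> \<le> 8 * (K * shifted \<phi> (1 + norm z) t)"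
      using K t z2 by (intro mult_left_mono shifted_mono) auto
    finally have "16 * K * C \<le> 8 * (K * shifted \<phi> (1 + norm z) t) * k" using k by (simp add: divide_le_eq)
    then have "K * (16 * C) \<le> K * (8 * shifted \<phi> (1 + norm z) t * k)" by (simp add: mult_ac)
    then show ?thesis using K by simp
  qed
  \<comment> \<open>2 K is lost in passing from the shift |z| to 1 + |z|, and another 2 because only
    k/2 is left.\<close>
  define k' where "k' = k / (4 * K)"
  have "ball_average (\<lambda>x. f (z + jacobian \<xi> (at x)))
        \<ge> f z + k' * ball_average (\<lambda>x. shifted \<phi> (norm z) (norm (jacobian \<xi> (at x))))"
    if z: "norm z > M'" and "\<xi> \<in> Cinfc_ball" for z and \<xi> :: "real ^ 'n \<Rightarrow> real ^ 'm"
  proof -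
    have xi: "\<xi> \<in> Ckc_ball 1" using that(2) Cinfc_subset by auto
    have z1: "norm z \<ge> 1" "norm z > 0" "norm z > M" "norm z \<ge> 2 * M" "1 + norm z > 0" using z M by (auto simp: M'_def)
    let ?J = "\<lambda>x. jacobian \<xi> (at x)"
    let ?s = "\<lambda>x. shifted \<phi> (1 + norm z) (norm (?J x))"
    have iS: "ball_integrable ?s" by (rule shifted_comp_integrable[OF z1(5) xi])
    have iS2: "ball_integrable (\<lambda>x. k/2 * ?s x)" using iS by simp
    have ig: "ball_integrable (\<lambda>x. g (z + ?J x))" by (rule comp_integrable_cont[OF gc xi])
    have pt: "g (z + ?J x) - k/2 * ?s x \<le> f (z + ?J x)" for x
    proof (cases "norm (z + ?J x) \<le> M")
      case True
      have "norm (?J x) \<ge> norm z / 2" using norm_diff_ineq[of z "?J x"] True z1 by linarith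
      from sh[OF z this] show ?thesis using C1[OF True] C2[OF True] by (simp add: C_def)
    next
      case False
      then show ?thesis using eq[of "z + ?J x"] k shifted_nonneg[OF z1(5)] by simp
    qed
    have pt2: "k' * shifted \<phi> (norm z) (norm (?J x)) \<le> k/2 * ?s x" for x
    proof -
      have "shifted \<phi> (norm z) (norm (?J x)) \<le> weight (norm z) (norm (?J x))"
        using z1 by (intro shifted_le_weight) auto
      also have "\<dots> \<le> 2 * weight (1 + norm z) (norm (?J x))" using z1 by (intro weight_suc) auto
      also have "\<dots> \<le> 2 * (K * ?s x)"
        unfolding K_def using z1 by (intro mult_left_mono weight_le_shifted) auto
      finally have "k' * shifted \<phi> (norm z) (norm (?J x)) \<le> k' * (2 * (K * ?s x))"
        using k K by (intro mult_left_mono) (auto simp: k'_def)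
      then show ?thesis using K by (simp add: k'_def)
    qed
    have "f z + k' * ball_average (\<lambda>x. shifted \<phi> (norm z) (norm (?J x)))
        = f z + ball_average (\<lambda>x. k' * shifted \<phi> (norm z) (norm (?J x)))" by (simp add: ball_average_cmult)
    also have "\<dots> \<le> f z + ball_average (\<lambda>x. k/2 * ?s x)"
      using shifted_comp_integrable[OF z1(2) xi] by (intro add_left_mono ball_average_mono iS2 pt2) auto
    also have "\<dots> = g z + k * ball_average ?s - ball_average (\<lambda>x. k/2 * ?s x)"
      unfolding ball_average_cmult using eq[OF z1(3)] by simp
    also have "\<dots> \<le> ball_average (\<lambda>x. g (z + ?J x)) - ball_average (\<lambda>x. k/2 * ?s x)"
      using q[OF xi] by simp
    also have "\<dots> = ball_average (\<lambda>x. g (z + ?J x) - k/2 * ?s x)"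
      by (rule ball_average_diff[OF ig iS2, symmetric])
    also have "\<dots> \<le> ball_average (\<lambda>x. f (z + ?J x))"
      by (rule ball_average_mono[OF set_integral_diff(1)[OF ig iS2] comp_integrable[OF f xi] pt])
    finally show ?thesis .
  qed
  moreover have "M' > 0" "k' > 0" using M k K by (auto simp: M'_def k'_def)
  ultimately show ?thesis by blast
qed

lemma growth_bounded_on_balls:
  fixes f :: "'a::real_normed_vector \<Rightarrow> real"
  assumes "\<And>z. \<bar>f z\<bar> \<le> C * (1 + \<phi> (norm z))" "C > 0"
  shows "bounded_on_balls f"
  unfolding bounded_on_balls_def
proof
  fix b
  show "\<exists>B. \<forall>w. norm w \<le> b \<longrightarrow> \<bar>f w\<bar> \<le> B"
    using assms mono by (intro exI[of _ "C * (1 + \<phi> b)"]) (auto intro!: order_trans[OF assms(1)] mult_left_mono)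
qed

text \<open>Carried out for g, which is quasiconvex at every point and inherits the growth of f. A
  layer with \<zeta> = 0 and h = z2 - z1 gives g(z1) \<le> r^n g(z2) + (1 - r^n) S, where S bounds g
  on the values in the layer; Bernoulli's inequality makes 1 - r^n linear in 1 - r.\<close>

lemma quasiconvex_growth_lipschitz:
  fixes f :: "real ^ 'n ^ 'm \<Rightarrow> real"
  assumes growth: "\<And>z. \<bar>f z\<bar> \<le> C * (1 + \<phi> (norm z))" "C > 0" and qc: "asymp_quasiconvex \<phi> f"
  shows "\<exists>M>0. \<exists>L>0. \<forall>z1 z2. norm z1 > M \<and> norm z2 > M \<longrightarrow>
      \<bar>f z2 - f z1\<bar> \<le> L * norm (z1 - z2) * deriv \<phi> (1 + norm z1 + norm z2)"
proof -
  obtain M g where M: "M > 0" and g: "unif_strictly_quasiconvex \<phi> g" and eq: "\<And>z. norm z > M \<Longrightarrow> f z = g z"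
    using qc unfolding asymp_quasiconvex_def by blast
  obtain k where gc: "continuous_on UNIV g" and k: "k > 0" and q: "\<And>\<xi> z. \<xi> \<in> Ckc_ball 1 \<Longrightarrow>
      ball_average (\<lambda>x. g (z + jacobian \<xi> (at x)))
        \<ge> g z + k * ball_average (\<lambda>x. shifted \<phi> (1 + norm z) (norm (jacobian \<xi> (at x))))"
    using g unfolding unif_strictly_quasiconvex_def by blast
  have qc': "ball_average (\<lambda>x. g (z + jacobian \<xi> (at x))) \<ge> g z" if xi: "\<xi> \<in> Ckc_ball 1" for \<xi> :: "real ^ 'n \<Rightarrow> real ^ 'm" and z
  proof -
    have z1: "1 + norm z > 0" by (simp add: add_pos_nonneg)
    have "ball_average (\<lambda>x::real^'n. 0) \<le> ball_average (\<lambda>x. shifted \<phi> (1 + norm z) (norm (jacobian \<xi> (at x))))"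
      by (intro ball_average_mono ball_integrable_const shifted_comp_integrable z1 xi shifted_nonneg)
    then have "0 \<le> k * ball_average (\<lambda>x. shifted \<phi> (1 + norm z) (norm (jacobian \<xi> (at x))))"
      using k by (simp add: ball_average_const)
    then show ?thesis using q[OF xi, of z] by linarith
  qed
  obtain C2 where C2: "\<And>w. norm w \<le> M \<Longrightarrow> \<bar>g w\<bar> \<le> C2"
    using continuous_bounded_on_balls[OF gc] unfolding bounded_on_balls_def by blast
  \<comment> \<open>For b \<ge> 1 one has b \<phi>'(b) \<ge> \<phi>'(1) > 0. Dividing by \<phi>'(1)
    lets this quantity absorb the constant part of the growth bound and the bound for g on the
    ball.\<close>
  define D where "D = (\<bar>C2\<bar> + C) / deriv \<phi> 1 + C"
  have D: "D > 0" using growth(2) pos[of 1] by (simp add: D_def add_nonneg_pos)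
  have gb: "\<bar>g w\<bar> \<le> D * (b * deriv \<phi> b)" if b: "b \<ge> 1" "norm w \<le> b" for w b
  proof -
    have p: "deriv \<phi> 1 > 0" by (rule pos) simp
    have d: "deriv \<phi> 1 \<le> b * deriv \<phi> b"
      using deriv_mono[of 1 b] mult_mono[of 1 b "deriv \<phi> 1" "deriv \<phi> b"] p b by simp
    have n: "\<phi> (norm w) \<le> b * deriv \<phi> b" using mono[of "norm w" b] le_mult_deriv[of b] b by simp
    have "\<bar>g w\<bar> \<le> \<bar>C2\<bar> + C * (1 + \<phi> (norm w))"
    proof (cases "norm w \<le> M")
      case True
      have "C * (1 + \<phi> (norm w)) \<ge> 0" using growth(2) nonneg[of "norm w"] by simp
      then show ?thesis using C2[OF True] by linarith
    next
      case False then show ?thesis using eq[of w] growth(1)[of w] by simp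
    qed
    also have "\<dots> = (\<bar>C2\<bar> + C) / deriv \<phi> 1 * deriv \<phi> 1 + C * \<phi> (norm w)"
      using p by (simp add: field_simps)
    also have "\<dots> \<le> (\<bar>C2\<bar> + C) / deriv \<phi> 1 * (b * deriv \<phi> b) + C * (b * deriv \<phi> b)"
      using growth(2) p n d by (intro add_mono mult_left_mono) auto
    also have "\<dots> = D * (b * deriv \<phi> b)" by (simp add: D_def algebra_simps)
    finally show ?thesis .
  qed
  define L where "L = real CARD('n) * (D * (75 * 75 powr c2))"
  have L: "L > 0" using D by (simp add: L_def)
  have one: "g z1 - g z2 \<le> L * norm (z1 - z2) * deriv \<phi> (1 + norm z1 + norm z2)" for z1 z2
  proof (cases "z1 = z2")
    case False
    define h where "h = z2 - z1"
    define \<rho> where "\<rho> = 1 + norm z1 + norm z2"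
    have rho: "\<rho> \<ge> 1" by (simp add: \<rho>_def)
    have h: "norm h > 0" "norm h \<le> \<rho>" using False norm_triangle_ineq4[of z2 z1] by (auto simp: h_def \<rho>_def)
    \<comment> \<open>With 1 - r proportional to |h| the layer gradient is at most 74 \<rho>,
      independent of |h|. All values then lie in the ball of radius 75 \<rho>, and doubling returns
      from 75 \<rho> to \<rho>.\<close>
    define r where "r = 1 - norm h / (2 * \<rho>)"
    have r: "0 < r" "r < 1" using h rho by (auto simp: r_def field_simps)
    have r1: "37 * norm h / (1 - r) = 74 * \<rho>" using h rho by (simp add: r_def)
    define S where "S = D * (75 * \<rho> * deriv \<phi> (75 * \<rho>))"
    have S: "g (z1 + Y) \<le> S" if "norm Y \<le> 37 * norm h / (1 - r)" for Y
    proof -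
      have "norm (z1 + Y) \<le> 75 * \<rho>" 
      proof -
        have "norm z1 \<le> \<rho>" by (simp add: \<rho>_def)
        then show ?thesis using norm_triangle_ineq[of z1 Y] that unfolding r1 by linarith
      qed
      then show ?thesis using gb[of "75 * \<rho>" "z1 + Y"] rho by (simp add: S_def)
    qed
    obtain \<xi> where xi: "\<xi> \<in> Ckc_ball 1" and le: "ball_average (\<lambda>x. g (z1 + jacobian \<xi> (at x)))
       \<le> r ^ CARD('n) * ball_average (\<lambda>x::real^'n. g (z1 + h + jacobian (\<lambda>x. 0) (at x))) + (1 - r ^ CARD('n)) * S"
      using layer_average[OF zero_Ckc_ball r borel_measurable_continuous_onI[OF gc] continuous_bounded_on_balls[OF gc] S]
      by blast
    define t where "t = r ^ CARD('n)"
    have t: "0 \<le> t" "t \<le> 1" using r by (auto simp: t_def power_le_one)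
    have "g z1 \<le> t * g z2 + (1 - t) * S"
      using qc'[OF xi, of z1] le by (simp add: jacobian_zero ball_average_const h_def t_def)
    then have "g z1 - g z2 \<le> (1 - t) * (S - g z2)" by (simp add: algebra_simps)
    also have "\<dots> \<le> (1 - t) * (2 * S)"
    proof (rule mult_left_mono)
      have "\<bar>g z2\<bar> \<le> S" unfolding S_def by (rule gb) (use rho in \<open>auto simp: \<rho>_def\<close>)
      then show "S - g z2 \<le> 2 * S" by linarith
    qed (use t in auto)
    also have "\<dots> \<le> (real CARD('n) * (1 - r)) * (2 * S)"
      unfolding t_def using r D pos[of "75 * \<rho>"] rho by (intro mult_right_mono one_minus_power_le) (auto simp: S_def)
    also have "\<dots> = real CARD('n) * (D * 75) * norm h * deriv \<phi> (75 * \<rho>)"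
      using rho by (simp add: r_def S_def)
    also have "\<dots> \<le> real CARD('n) * (D * 75) * norm h * (75 powr c2 * deriv \<phi> \<rho>)"
      using rho D by (intro mult_left_mono doubling) auto
    also have "\<dots> = L * norm h * deriv \<phi> \<rho>" by (simp add: L_def mult_ac)
    finally show ?thesis by (simp add: h_def \<rho>_def norm_minus_commute)
  qed simp
  have "\<bar>f z2 - f z1\<bar> \<le> L * norm (z1 - z2) * deriv \<phi> (1 + norm z1 + norm z2)"
    if "norm z1 > M" "norm z2 > M" for z1 z2
    using one[of z1 z2] one[of z2 z1] eq[OF that(1)] eq[OF that(2)]
    by (simp add: abs_le_iff norm_minus_commute add.assoc add.commute[of "norm z1"] del: add.commute)
  then show ?thesis using M L by blast
qed

end

section \<open>A strictly convex potential and the quasiconvex envelope\<close>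

context orlicz begin

text \<open>The regularized radius s is at least 1, which keeps V away from the possible singularity
  of \<phi>'' at 0, and it is comparable to 1 + |z|. The second derivative of V splits into a part
  with factor \<phi>'(s)/s and a part with factor \<phi>''(s); both factors are of the order of
  \<phi>'(s)/s, so upper and lower bounds have the same form.\<close>

lemma strict_potential:
  shows "\<exists>(V::'a::euclidean_space \<Rightarrow> real) V1 cl cu. cl > 0 \<and> cu > 0 \<and> (\<forall>z. (V has_derivative V1 z) (at z)) \<and>
    (\<forall>z y. cl * weight (1 + norm z) (norm y) \<le> V (z + y) - V z - V1 z y \<and>
      V (z + y) - V z - V1 z y \<le> cu * weight (1 + norm z) (norm y))"
proof -
  define s where "s = (\<lambda>z::'a. sqrt (1 + z \<bullet> z))"
  define V where "V = (\<lambda>z::'a. \<phi> (s z))"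
  define V1 where "V1 = (\<lambda>z y::'a. deriv \<phi> (s z) / s z * (z \<bullet> y))"
  define V2 where "V2 = (\<lambda>z y::'a. deriv \<phi> (s z) / s z * ((norm y)\<^sup>2 - ((z \<bullet> y) / s z)\<^sup>2)
     + deriv (deriv \<phi>) (s z) * ((z \<bullet> y) / s z)\<^sup>2)"
  have s1: "s z \<ge> 1" for z by (simp add: s_def)
  have s0: "s z > 0" for z using s1[of z] by linarith
  have ss: "s z * s z = 1 + z \<bullet> z" for z by (simp add: s_def)
  have su: "s z \<le> 1 + norm z" for z
    unfolding s_def by (rule real_le_lsqrt) (auto simp: power2_eq_square dot_square_norm algebra_simps)
  have sl: "norm z \<le> s z" for z
    unfolding s_def by (rule real_le_rsqrt) (simp add: power2_norm_eq_inner)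
  have su2: "1 + norm z \<le> 2 * s z" for z using sl[of z] s1[of z] by linarith
  have sd: "(s has_derivative (\<lambda>v. (z \<bullet> v) / s z)) (at z)" for z
  proof -
    have "((\<lambda>z. 1 + z \<bullet> z) has_derivative (\<lambda>v. 2 * (z \<bullet> v))) (at z)"
      by (auto intro!: derivative_eq_intros simp: inner_commute)
    moreover have "0 < 1 + z \<bullet> z" by (simp add: add_pos_nonneg)
    ultimately show ?thesis
      unfolding s_def by (rule_tac has_derivative_eq_rhs[OF has_derivative_real_sqrt]) (auto simp: fun_eq_iff field_simps)
  qed
  have Vd: "(V has_derivative V1 z) (at z)" for z
    using has_derivative_compose[OF sd[of z] d1[OF s0, of z, unfolded has_field_derivative_def]]
    unfolding V_def V1_def by simp
  have V1d: "((\<lambda>z. V1 z y) has_derivative (\<lambda>v. deriv \<phi> (s z) / s z * ((y \<bullet> v) - ((z \<bullet> y) / s z) * ((z \<bullet> v) / s z))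
      + deriv (deriv \<phi>) (s z) * (((z \<bullet> y) / s z) * ((z \<bullet> v) / s z)))) (at z)" for z y
  proof -
    have "((\<lambda>z. deriv \<phi> (s z)) has_derivative (\<lambda>v. deriv (deriv \<phi>) (s z) * ((z \<bullet> v) / s z))) (at z)"
      using has_derivative_compose[OF sd[of z] d2[OF s0, of z, unfolded has_field_derivative_def]] by simp
    moreover have "((\<lambda>z. z \<bullet> y) has_derivative (\<lambda>v. v \<bullet> y)) (at z)"
      by (auto intro!: derivative_eq_intros)
    ultimately have "((\<lambda>z. deriv \<phi> (s z) * (z \<bullet> y) / s z) has_derivative
      (\<lambda>v. ((deriv \<phi> (s z) * (v \<bullet> y) + deriv (deriv \<phi>) (s z) * ((z \<bullet> v) / s z) * (z \<bullet> y)) * s z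
         - deriv \<phi> (s z) * (z \<bullet> y) * ((z \<bullet> v) / s z)) / (s z * s z))) (at z)"
      using s0[of z] by (intro has_derivative_divide' has_derivative_mult sd) auto
    then show ?thesis
      unfolding V1_def
      by (simp, rule_tac has_derivative_eq_rhs, assumption)
        (use s0[of z] in \<open>auto simp: fun_eq_iff field_simps inner_commute\<close>)
  qed
  have lin1: "((\<lambda>t. V (z + t *\<^sub>R y)) has_real_derivative V1 (z + t *\<^sub>R y) y) (at t)" for z y t
    by (rule has_derivative_line[OF Vd])
  have lin2: "((\<lambda>t. V1 (z + t *\<^sub>R y) y) has_real_derivative V2 (z + t *\<^sub>R y) y) (at t)" for z y t
    unfolding V2_def power2_eq_square power2_norm_eq_inner[unfolded power2_eq_square]
    by (rule has_derivative_line[OF V1d])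
  have split: "min 1 c1 * (deriv \<phi> (s z) / s z * (norm y)\<^sup>2) \<le> V2 z y \<and>
      V2 z y \<le> max 1 c2 * (deriv \<phi> (s z) / s z * (norm y)\<^sup>2)" for z y
  proof -
    \<comment> \<open>b is the part of |y|^2 multiplied by \<phi>''; the remainder a is nonnegative
      by Cauchy-Schwarz and |z| \<le> s.\<close>
    define b where "b = ((z \<bullet> y) / s z)\<^sup>2"
    define a where "a = (norm y)\<^sup>2 - b"
    define P where "P = deriv \<phi> (s z) / s z"
    define Q where "Q = deriv (deriv \<phi>) (s z)"
    have P: "P > 0" using pos[OF s0[of z]] s0[of z] by (simp add: P_def)
    have Q: "c1 * P \<le> Q" "Q \<le> c2 * P"
      using lower[OF s0[of z]] upper[OF s0[of z]] s0[of z] by (auto simp: P_def Q_def field_simps)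
    have "\<bar>z \<bullet> y\<bar> \<le> s z * norm y"
      using Cauchy_Schwarz_ineq2[of z y] mult_right_mono[OF sl[of z], of "norm y"] by simp
    then have "\<bar>(z \<bullet> y) / s z\<bar> \<le> norm y" using s0[of z] by (simp add: field_simps)
    then have a: "a \<ge> 0" 
      unfolding a_def b_def diff_ge_0_iff_ge using power_mono[OF _ abs_ge_zero, of _ "norm y" 2] power2_abs by metis
    have b: "b \<ge> 0" by (simp add: b_def)
    have V2: "V2 z y = P * a + Q * b" by (simp add: V2_def P_def Q_def a_def b_def)
    have n: "(norm y)\<^sup>2 = a + b" by (simp add: a_def)
    have "min 1 c1 * (P * a) \<le> P * a" "P * a \<le> max 1 c2 * (P * a)"
      using mult_right_mono[of "min 1 c1" 1 "P * a"] mult_right_mono[of 1 "max 1 c2" "P * a"] a P by auto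
    moreover have "min 1 c1 * P * b \<le> Q * b" "Q * b \<le> max 1 c2 * P * b"
    proof -
      have "min 1 c1 * P \<le> c1 * P" "c2 * P \<le> max 1 c2 * P" using P by (auto intro!: mult_right_mono)
      then show "min 1 c1 * P * b \<le> Q * b" "Q * b \<le> max 1 c2 * P * b"
        using Q b by (auto intro!: mult_right_mono)
    qed
    ultimately show ?thesis unfolding V2 n P_def[symmetric] by (simp only: distrib_left mult.assoc) linarith
  qed
  define e where "e = 2 * max 1 c2"
  have r: "deriv \<phi> (s z) / s z \<le> 2 * (deriv \<phi> (1 + norm z) / (1 + norm z))"
    "deriv \<phi> (1 + norm z) / (1 + norm z) \<le> 2 powr c2 * (deriv \<phi> (s z) / s z)" for z
    by (rule rate_le[OF s0 su su2])+
  have up: "\<bar>V (z + y) - V z - V1 z y\<bar> \<le> 27 * e * weight (1 + norm z) (norm y)" for z y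
  proof (rule bregman_upper[OF _ lin1 lin2])
    have e2: "e \<ge> 2" by (simp add: e_def)
    show e0: "e \<ge> 0" using e2 by simp
    fix z y :: 'a
    have dm: "deriv \<phi> (s z) \<le> deriv \<phi> (1 + norm z)" by (rule deriv_mono[OF s0 su])
    have "\<bar>V z\<bar> \<le> s z * deriv \<phi> (s z)" using le_mult_deriv[OF s0[of z]] nonneg[of "s z"] s0[of z] by (simp add: V_def)
    also have "\<dots> \<le> 1 * ((1 + norm z) * deriv \<phi> (1 + norm z))"
      using su[of z] dm s0[of z] pos[OF s0[of z]] by (simp add: mult_mono)
    also have "\<dots> \<le> e * ((1 + norm z) * deriv \<phi> (1 + norm z))"
      using e2 pos[of "1 + norm z"] by (intro mult_right_mono) (auto simp: add_pos_nonneg)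
    finally show "\<bar>V z\<bar> \<le> e * ((1 + norm z) * deriv \<phi> (1 + norm z))" .
    have "\<bar>V1 z y\<bar> = deriv \<phi> (s z) / s z * \<bar>z \<bullet> y\<bar>"
      using s0[of z] pos[OF s0[of z]] by (simp add: V1_def abs_mult)
    also have "\<dots> \<le> deriv \<phi> (s z) / s z * (s z * norm y)"
      using Cauchy_Schwarz_ineq2[of z y] mult_right_mono[OF sl[of z], of "norm y"] s0[of z] pos[OF s0[of z]]
      by (intro mult_left_mono) auto
    also have "\<dots> = 1 * (deriv \<phi> (s z) * norm y)" using s0[of z] by simp
    also have "\<dots> \<le> e * (deriv \<phi> (1 + norm z) * norm y)"
      using e2 dm pos[OF s0[of z]] by (intro mult_mono) auto
    finally show "\<bar>V1 z y\<bar> \<le> e * (deriv \<phi> (1 + norm z) * norm y)" .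
    have "V2 z y \<ge> 0"
      by (rule order_trans[OF _ conjunct1[OF split]]) (use c1 s0[of z] pos[OF s0[of z]] in simp)
    then have "\<bar>V2 z y\<bar> \<le> max 1 c2 * (deriv \<phi> (s z) / s z * (norm y)\<^sup>2)" using split[of z y] by simp
    also have "\<dots> \<le> max 1 c2 * (2 * (deriv \<phi> (1 + norm z) / (1 + norm z)) * (norm y)\<^sup>2)"
      by (intro mult_left_mono mult_right_mono r) auto
    finally show "\<bar>V2 z y\<bar> \<le> e * (deriv \<phi> (1 + norm z) / (1 + norm z) * (norm y)\<^sup>2)" by (simp add: e_def mult_ac)
  qed
  define l where "l = min 1 c1 / 2 powr c2"
  have l: "l > 0" using c1 by (simp add: l_def)
  have lo: "V (z + y) - V z - V1 z y \<ge> l / (32 * 6 powr c2) * weight (1 + norm z) (norm y)" for z y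
  proof (rule bregman_lower[OF _ lin1 lin2])
    show "l \<ge> 0" using l by simp
    fix z y :: 'a
    have "l * (deriv \<phi> (1 + norm z) / (1 + norm z) * (norm y)\<^sup>2)
       \<le> l * (2 powr c2 * (deriv \<phi> (s z) / s z) * (norm y)\<^sup>2)"
      using l by (intro mult_left_mono mult_right_mono r) auto
    also have "\<dots> = min 1 c1 * (deriv \<phi> (s z) / s z * (norm y)\<^sup>2)" by (simp add: l_def)
    also have "\<dots> \<le> V2 z y" using split by blast
    finally show "l * (deriv \<phi> (1 + norm z) / (1 + norm z) * (norm y)\<^sup>2) \<le> V2 z y" .
  qed
  show ?thesis
    by (rule exI[of _ V], rule exI[of _ V1], rule exI[of _ "l / (32 * 6 powr c2)"], rule exI[of _ "27 * e"])
      (use l lo up Vd in \<open>auto simp: e_def abs_le_iff\<close>)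
qed

text \<open>After averaging, the first-order term is gone. The upper bound is what subtracting a
  multiple of V costs, the lower bound is what adding it back earns.\<close>

lemma strict_potential_average:
  shows "\<exists>(V::real^'n^'m \<Rightarrow> real) cl cu. cl > 0 \<and> cu > 0 \<and> continuous_on UNIV V \<and>
    (\<forall>\<xi>\<in>Ckc_ball 1. \<forall>z.
      cl * ball_average (\<lambda>x. shifted \<phi> (1 + norm z) (norm (jacobian \<xi> (at x))))
        \<le> ball_average (\<lambda>x. V (z + jacobian \<xi> (at x))) - V z \<and>
      ball_average (\<lambda>x. V (z + jacobian \<xi> (at x))) - V z
        \<le> cu * ball_average (\<lambda>x. shifted \<phi> (1 + norm z) (norm (jacobian \<xi> (at x)))))"
proof -
  obtain V :: "real^'n^'m \<Rightarrow> real" and V1 cl cu where c: "cl > 0" "cu > 0" and Vd: "\<And>z. (V has_derivative V1 z) (at z)"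
    and V: "\<And>z y. cl * weight (1 + norm z) (norm y) \<le> V (z + y) - V z - V1 z y"
      "\<And>z y. V (z + y) - V z - V1 z y \<le> cu * weight (1 + norm z) (norm y)"
    using strict_potential by blast
  have Vc: "continuous_on UNIV V" using Vd by (auto intro!: has_derivative_continuous continuous_at_imp_continuous_on)
  define K where "K = 4 * 2 powr c2"
  have K: "K > 0" by (simp add: K_def)
  have "cl * ball_average (\<lambda>x. shifted \<phi> (1 + norm z) (norm (jacobian \<xi> (at x))))
        \<le> ball_average (\<lambda>x. V (z + jacobian \<xi> (at x))) - V z \<and>
      ball_average (\<lambda>x. V (z + jacobian \<xi> (at x))) - V z
        \<le> (cu * K) * ball_average (\<lambda>x. shifted \<phi> (1 + norm z) (norm (jacobian \<xi> (at x))))"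
    if xi: "\<xi> \<in> Ckc_ball 1" for \<xi> :: "real^'n \<Rightarrow> real^'m" and z
  proof -
    let ?J = "\<lambda>x. jacobian \<xi> (at x)"
    let ?s = "\<lambda>x. shifted \<phi> (1 + norm z) (norm (?J x))"
    have z1: "1 + norm z > 0" by (simp add: add_pos_nonneg)
    have lin: "linear (V1 z)" using Vd by (rule has_derivative_linear)
    have iS: "ball_integrable ?s" by (rule shifted_comp_integrable[OF z1 xi])
    have iV: "ball_integrable (\<lambda>x. V (z + ?J x))" by (rule comp_integrable_cont[OF Vc xi])
    have i1: "ball_integrable (\<lambda>x. V1 z (?J x))"
      using comp_integrable_cont[OF _ xi, of "V1 z" 0] linear_continuous_on[OF lin[unfolded linear_conv_bounded_linear]] by simp
    have i0: "ball_integrable (\<lambda>x::real^'n. V z)" by (rule ball_integrable_const)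
    have i2: "ball_integrable (\<lambda>x. V (z + ?J x) - V z)" by (rule set_integral_diff(1)[OF iV i0])
    have i3: "ball_integrable (\<lambda>x. V (z + ?J x) - V z - V1 z (?J x))" by (rule set_integral_diff(1)[OF i2 i1])
    have av: "ball_average (\<lambda>x. V (z + ?J x) - V z - V1 z (?J x)) = ball_average (\<lambda>x. V (z + ?J x)) - V z"
      unfolding ball_average_diff[OF i2 i1] ball_average_diff[OF iV i0] ball_average_const
        ball_average_linear_jacobian[OF xi lin] by simp
    have i4: "ball_integrable (\<lambda>x. c * ?s x)" for c using iS by (cases "c = 0") (auto simp: ball_integrable_const)
    have "ball_average (\<lambda>x. cl * ?s x) \<le> ball_average (\<lambda>x. V (z + ?J x) - V z - V1 z (?J x))"
    proof (rule ball_average_mono[OF i4 i3])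
      fix x
      have "cl * ?s x \<le> cl * weight (1 + norm z) (norm (?J x))"
        using c by (intro mult_left_mono shifted_le_weight z1) auto
      then show "cl * ?s x \<le> V (z + ?J x) - V z - V1 z (?J x)" using V(1) order_trans by blast
    qed
    moreover have "ball_average (\<lambda>x. V (z + ?J x) - V z - V1 z (?J x)) \<le> ball_average (\<lambda>x. cu * K * ?s x)"
    proof (rule ball_average_mono[OF i3 i4])
      fix x
      have "cu * weight (1 + norm z) (norm (?J x)) \<le> cu * (K * ?s x)"
        unfolding K_def using c by (intro mult_left_mono weight_le_shifted z1) auto
      then show "V (z + ?J x) - V z - V1 z (?J x) \<le> cu * K * ?s x"
        using V(2)[of z "?J x"] by (simp add: mult.assoc)
    qed
    ultimately show ?thesis unfolding av ball_average_cmult by blast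
  qed
  moreover have "cu * K > 0" using c K by simp
  ultimately show ?thesis using c Vc by blast
qed

end

section \<open>The quasiconvex envelope and its local Lipschitz bound\<close>

text \<open>Dacorogna's formula for the envelope. A real infimum is meaningful only for a nonempty
  family bounded below; that bound is established in the locale that follows.\<close>

definition qc_envelope :: "(real ^ 'n ^ 'm \<Rightarrow> real) \<Rightarrow> real ^ 'n ^ 'm \<Rightarrow> real" where
  "qc_envelope F z = (INF \<xi>\<in>Ckc_ball 1. ball_average (\<lambda>x. F (z + jacobian \<xi> (at x))))"

text \<open>The situation after a multiple of V has been subtracted. At points of norm at most M
  there is no inequality, so lower bounds for the averages there must be brought in from outside the
  ball.\<close>

locale quasiconvex_outside =
  fixes F :: "real ^ 'n ^ 'm \<Rightarrow> real" and M :: real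
  assumes cont: "continuous_on UNIV F"
    and qc: "\<And>z \<xi>. norm z > M \<Longrightarrow> \<xi> \<in> Ckc_ball 1 \<Longrightarrow> F z \<le> ball_average (\<lambda>x. F (z + jacobian \<xi> (at x)))"
begin

lemma F_measurable: "F \<in> borel_measurable borel" by (rule borel_measurable_continuous_onI[OF cont])
lemma F_bounded: "bounded_on_balls F" by (rule continuous_bounded_on_balls[OF cont])

text \<open>Fix z0 with |z0| > M. A layer with h = z - z0 and r = 1/2 turns any test function for z
  into one for z0, and quasiconvexity at z0 becomes a lower bound for the average at z that does not
  depend on the test function. 74 = 37 / (1 - 1/2).\<close>

lemma averages_bounded_below:
  "\<exists>C. \<forall>z. norm z \<le> b \<longrightarrow> (\<forall>\<xi>\<in>Ckc_ball 1. C \<le> ball_average (\<lambda>x. F (z + jacobian \<xi> (at x))))"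
proof -
  obtain z0 :: "real ^ 'n ^ 'm" where z0: "norm z0 = \<bar>M\<bar> + 1"
    using vector_choose_size[of "\<bar>M\<bar> + 1"] by auto
  obtain S where S: "\<And>w. norm w \<le> norm z0 + 74 * (b + norm z0) \<Longrightarrow> \<bar>F w\<bar> \<le> S"
    using F_bounded unfolding bounded_on_balls_def by blast
  define r where "r = (1/2::real) ^ CARD('n)"
  have r: "0 < r" "r \<le> 1" by (auto simp: r_def power_le_one)
  have half: "0 < (1/2::real)" "(1/2::real) < 1" by simp_all
  have "(F z0 - \<bar>S\<bar>) / r \<le> ball_average (\<lambda>x. F (z + jacobian \<xi> (at x)))"
    if z: "norm z \<le> b" and xi: "\<xi> \<in> Ckc_ball 1" for z and \<xi> :: "real ^ 'n \<Rightarrow> real ^ 'm"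
  proof -
    have bound: "F (z0 + Y) \<le> \<bar>S\<bar>" if "norm Y \<le> 37 * norm (z - z0) / (1 - 1/2)" for Y
    proof -
      have "norm Y \<le> 74 * (b + norm z0)" using that norm_triangle_ineq4[of z z0] z by simp
      then have "norm (z0 + Y) \<le> norm z0 + 74 * (b + norm z0)" using norm_triangle_ineq[of z0 Y] by linarith
      then show ?thesis using S[of "z0 + Y"] by linarith
    qed
    obtain \<eta> where "\<eta> \<in> Ckc_ball 1" and "ball_average (\<lambda>x. F (z0 + jacobian \<eta> (at x)))
       \<le> (1/2) ^ CARD('n) * ball_average (\<lambda>x. F (z0 + (z - z0) + jacobian \<xi> (at x))) + (1 - (1/2) ^ CARD('n)) * \<bar>S\<bar>"
      using layer_average[OF xi half F_measurable F_bounded bound] by blast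
    then have "F z0 \<le> r * ball_average (\<lambda>x. F (z + jacobian \<xi> (at x))) + (1 - r) * \<bar>S\<bar>"
    proof -
      have "norm z0 > M" using z0 by linarith
      from qc[OF this \<open>\<eta> \<in> Ckc_ball 1\<close>] show ?thesis
        using \<open>ball_average (\<lambda>x. F (z0 + jacobian \<eta> (at x))) \<le> _\<close> by (simp add: r_def)
    qed
    also have "\<dots> \<le> r * ball_average (\<lambda>x. F (z + jacobian \<xi> (at x))) + \<bar>S\<bar>"
      using r by (simp add: mult_left_le_one_le)
    finally show ?thesis using r by (simp add: field_simps)
  qed
  then show ?thesis by blast
qed

lemma averages_bdd_below: "bdd_below ((\<lambda>\<xi>. ball_average (\<lambda>x. F (z + jacobian \<xi> (at x)))) ` Ckc_ball 1)"
proof -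
  obtain C where "\<And>\<xi>. \<xi> \<in> Ckc_ball 1 \<Longrightarrow> C \<le> ball_average (\<lambda>x. F (z + jacobian \<xi> (at x)))"
    using averages_bounded_below[of "norm z"] by blast
  then show ?thesis by (rule bdd_belowI2)
qed

lemma envelope_le: "\<xi> \<in> Ckc_ball 1 \<Longrightarrow> qc_envelope F z \<le> ball_average (\<lambda>x. F (z + jacobian \<xi> (at x)))"
  unfolding qc_envelope_def by (rule cINF_lower[OF averages_bdd_below])

lemma envelope_greatest:
  "(\<And>\<xi>. \<xi> \<in> Ckc_ball 1 \<Longrightarrow> c \<le> ball_average (\<lambda>x. F (z + jacobian \<xi> (at x)))) \<Longrightarrow> c \<le> qc_envelope F z"
  unfolding qc_envelope_def using zero_Ckc_ball by (intro cINF_greatest) auto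

lemma envelope_le_self: "qc_envelope F z \<le> F z"
  using envelope_le[OF zero_Ckc_ball, of z] by (simp add: jacobian_zero ball_average_const)

lemma envelope_eq: "norm z > M \<Longrightarrow> qc_envelope F z = F z"
  using envelope_le_self[of z] envelope_greatest[of "F z" z] qc[of z] by force

lemma envelope_bounded: "bounded_on_balls (qc_envelope F)"
  unfolding bounded_on_balls_def
proof
  fix b
  obtain C where C: "\<And>z \<xi>. norm z \<le> b \<Longrightarrow> \<xi> \<in> Ckc_ball 1 \<Longrightarrow> C \<le> ball_average (\<lambda>x. F (z + jacobian \<xi> (at x)))"
    using averages_bounded_below[of b] by blast
  obtain S where S: "\<And>w. norm w \<le> b \<Longrightarrow> \<bar>F w\<bar> \<le> S" using F_bounded unfolding bounded_on_balls_def by blast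
  have "\<bar>qc_envelope F w\<bar> \<le> \<bar>C\<bar> + \<bar>S\<bar>" if w: "norm w \<le> b" for w
    using S[OF w] envelope_le_self[of w] envelope_greatest[of C w, OF C[OF w]] by linarith
  then show "\<exists>C. \<forall>w. norm w \<le> b \<longrightarrow> \<bar>qc_envelope F w\<bar> \<le> C" by blast
qed

text \<open>The same transplantation between nearby points. With h = w - z and r = 1 - |h| the layer
  gradient is at most 37 whatever h is, and 1 - r^n \<le> n |h| gives the linear rate. The division
  by t isolates the average at w, over which the infimum is then taken.\<close>

lemma envelope_locally_lipschitz:
  "\<exists>K\<ge>0. \<forall>z w. norm z \<le> b \<longrightarrow> norm w \<le> b \<longrightarrow> norm (z - w) < 1 \<longrightarrow>
     \<bar>qc_envelope F z - qc_envelope F w\<bar> \<le> K * norm (z - w)"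
proof -
  obtain S where S: "\<And>w. norm w \<le> b + 37 \<Longrightarrow> \<bar>F w\<bar> \<le> S" using F_bounded unfolding bounded_on_balls_def by blast
  obtain Q where Q: "\<And>w. norm w \<le> b \<Longrightarrow> \<bar>qc_envelope F w\<bar> \<le> Q"
    using envelope_bounded unfolding bounded_on_balls_def by blast
  define K where "K = real CARD('n) * (\<bar>S\<bar> + \<bar>Q\<bar>)"
  have one: "qc_envelope F z - qc_envelope F w \<le> K * norm (z - w)"
    if zw: "norm z \<le> b" "norm w \<le> b" "norm (z - w) < 1" for z w
  proof (cases "z = w")
    case False
    define r where "r = 1 - norm (w - z)"
    have r: "0 < r" "r < 1" using zw False by (auto simp: r_def norm_minus_commute)
    have bound: "F (z + Y) \<le> \<bar>S\<bar>" if "norm Y \<le> 37 * norm (w - z) / (1 - r)" for Y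
    proof -
      have "norm Y \<le> 37" using that False by (simp add: r_def)
      then have "norm (z + Y) \<le> b + 37" using norm_triangle_ineq[of z Y] zw by linarith
      then show ?thesis using S[of "z + Y"] by linarith
    qed
    define t where "t = r ^ CARD('n)"
    have t: "0 < t" "t \<le> 1" using r by (auto simp: t_def power_le_one)
    have "(qc_envelope F z - (1 - t) * \<bar>S\<bar>) / t \<le> qc_envelope F w"
    proof (rule envelope_greatest)
      fix \<zeta> :: "real ^ 'n \<Rightarrow> real ^ 'm" assume zeta: "\<zeta> \<in> Ckc_ball 1"
      obtain \<eta> where "\<eta> \<in> Ckc_ball 1" and "ball_average (\<lambda>x. F (z + jacobian \<eta> (at x)))
         \<le> t * ball_average (\<lambda>x. F (z + (w - z) + jacobian \<zeta> (at x))) + (1 - t) * \<bar>S\<bar>"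
        using layer_average[OF zeta r F_measurable F_bounded bound] unfolding t_def by blast
      then have "qc_envelope F z \<le> t * ball_average (\<lambda>x. F (w + jacobian \<zeta> (at x))) + (1 - t) * \<bar>S\<bar>"
        using envelope_le[of \<eta> z] by simp
      then show "(qc_envelope F z - (1 - t) * \<bar>S\<bar>) / t \<le> ball_average (\<lambda>x. F (w + jacobian \<zeta> (at x)))"
        using t by (simp add: field_simps)
    qed
    then have "qc_envelope F z - qc_envelope F w \<le> (1 - t) * (\<bar>S\<bar> - qc_envelope F w)"
      using t by (simp add: field_simps)
    also have "\<dots> \<le> (real CARD('n) * (1 - r)) * (\<bar>S\<bar> + \<bar>Q\<bar>)"
    proof (rule mult_mono')
      show "1 - t \<le> real CARD('n) * (1 - r)" unfolding t_def using r by (intro one_minus_power_le) auto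
    next
      show "\<bar>S\<bar> - qc_envelope F w \<le> \<bar>S\<bar> + \<bar>Q\<bar>" using Q[OF zw(2)] by linarith
      have "norm w \<le> b + 37" using zw by linarith
      from S[OF this] show "0 \<le> \<bar>S\<bar> - qc_envelope F w" using envelope_le_self[of w] by linarith
    qed (use t in auto)
    also have "\<dots> = K * norm (z - w)" by (simp add: K_def r_def norm_minus_commute)
    finally show ?thesis .
  qed simp
  have "\<bar>qc_envelope F z - qc_envelope F w\<bar> \<le> K * norm (z - w)"
    if "norm z \<le> b" "norm w \<le> b" "norm (z - w) < 1" for z w
    using one[of z w] one[of w z] that by (simp add: abs_le_iff norm_minus_commute)
  moreover have "K \<ge> 0" by (simp add: K_def)
  ultimately show ?thesis by blast
qed

lemma envelope_continuous: "continuous_on UNIV (qc_envelope F)"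
proof (rule continuous_at_imp_continuous_on, rule ballI)
  fix z :: "real ^ 'n ^ 'm"
  obtain K where K: "K \<ge> 0" "\<And>w. norm w \<le> norm z + 1 \<Longrightarrow> norm (w - z) < 1 \<Longrightarrow>
     \<bar>qc_envelope F w - qc_envelope F z\<bar> \<le> K * norm (w - z)"
    using envelope_locally_lipschitz[of "norm z + 1"] by fastforce
  have "((\<lambda>w. qc_envelope F w - qc_envelope F z) \<longlongrightarrow> 0) (at z)"
  proof (rule Lim_null_comparison[where g = "\<lambda>w. K * norm (w - z)"])
    have "norm w \<le> norm z + 1" if "norm (w - z) < 1" for w using that norm_triangle_ineq2[of w z] by linarith
    then show "\<forall>\<^sub>F w in at z. norm (qc_envelope F w - qc_envelope F z) \<le> K * norm (w - z)"
      using K(2) by (auto simp: eventually_at dist_norm intro!: exI[of _ 1])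
    have "((\<lambda>w. K * norm (w - z)) \<longlongrightarrow> K * norm (z - z)) (at z)" by (intro tendsto_intros)
    then show "((\<lambda>w. K * norm (w - z)) \<longlongrightarrow> 0) (at z)" by simp
  qed
  then show "isCont (qc_envelope F) z" unfolding isCont_def by (rule LIM_zero_cancel)
qed

end

section \<open>Gluing near-optimal test functions along a ball packing\<close>

text \<open>Vitali's theorem yields a countable disjoint family that fills the ball up to a null
  set; continuity of the measure from above allows truncation to finitely many balls. The bound
  \<rho> on the radii serves to make a given gradient almost constant on each ball.\<close>

lemma ball_packing:
  fixes \<rho> e :: real
  assumes "\<rho> > 0" "e > 0"
  shows "\<exists>I :: ((real^'n) \<times> real) set. finite I \<and> (\<forall>i\<in>I. 0 < snd i \<and> snd i < \<rho> \<and> ball (fst i) (snd i) \<subseteq> ball 0 1) \<and>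
    disjoint_family_on (\<lambda>i. ball (fst i) (snd i)) I \<and>
    measure lborel (ball 0 1 - (\<Union>i\<in>I. ball (fst i) (snd i))) < e"
proof -
  let ?B = "\<lambda>i::(real^'n) \<times> real. ball (fst i) (snd i)"
  define K where "K = {i. 0 < snd i \<and> snd i < \<rho> \<and> ?B i \<subseteq> ball 0 1}"
  obtain C where C: "countable C" "C \<subseteq> K" "pairwise (\<lambda>i j. disjnt (?B i) (?B j)) C"
    "negligible (ball 0 1 - (\<Union>i\<in>C. ?B i))"
  proof (rule Vitali_covering_theorem_balls[of "ball 0 1" K fst snd])
    fix x :: "real^'n" and d :: real assume x: "x \<in> ball 0 1" and d: "d > 0"
    define r where "r = min (1 - norm x) (min (d/2) (\<rho>/2))"
    have r: "0 < r" "r < d" "r < \<rho>" using x d assms(1) by (auto simp: r_def)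
    have "ball x r \<subseteq> ball 0 1" by (subst ball_subset_ball_iff) (auto simp: r_def)
    then show "\<exists>i. i \<in> K \<and> x \<in> ball (fst i) (snd i) \<and> snd i < d"
      using r by (intro exI[of _ "(x, r)"]) (auto simp: K_def)
  qed blast
  have "C \<noteq> {}"
  proof
    assume "C = {}"
    then have "negligible (ball (0::real^'n) 1)" using C(4) by simp
    then show False using open_not_negligible[of "ball (0::real^'n) 1"] by simp
  qed
  \<comment> \<open>The enumeration repeats elements if C is finite; the final family is an image
    set, in which repetitions disappear.\<close>
  define c where "c = from_nat_into C"
  have ran: "range c = C" unfolding c_def by (rule range_from_nat_into[OF \<open>C \<noteq> {}\<close> C(1)])
  define A where "A = (\<lambda>n. ball 0 1 - (\<Union>i\<in>c ` {..<n}. ?B i))"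
  have "(\<lambda>n. measure lborel (A n)) \<longlonglongrightarrow> measure lborel (\<Inter>n. A n)"
  proof (rule Lim_measure_decseq)
    show "range A \<subseteq> sets lborel" by (auto simp: A_def)
    show "decseq A" unfolding decseq_def A_def by (force intro: less_le_trans)
    show "emeasure lborel (A n) \<noteq> \<infinity>" for n
    proof -
      have "emeasure lborel (A n) < \<infinity>"
        by (rule le_less_trans[OF emeasure_mono emeasure_lborel_ball_finite[of "0::real^'n" 1]]) (auto simp: A_def)
      then show ?thesis by simp
    qed
  qed
  also have "(\<Inter>n. A n) = ball 0 1 - (\<Union>i\<in>C. ?B i)"
    unfolding A_def ran[symmetric] by (force intro: lessI)
  also have "measure lborel (ball 0 1 - (\<Union>i\<in>C. ?B i)) = 0"
  proof -
    have "measure lebesgue (ball 0 1 - (\<Union>i\<in>C. ?B i)) = 0" using C(4) negligible_iff_measure by blast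
    moreover have "ball 0 1 - (\<Union>i\<in>C. ?B i) \<in> sets lborel" by (simp add: borel_open open_UN)
    ultimately show ?thesis by (simp add: measure_completion)
  qed
  finally have "\<forall>\<^sub>F n in sequentially. measure lborel (A n) < e" using assms(2) by (rule order_tendstoD(2))
  then obtain n where n: "measure lborel (A n) < e" by (auto simp: eventually_sequentially)
  have sub: "c ` {..<n} \<subseteq> C" using ran by auto
  show ?thesis
  proof (intro exI[of _ "c ` {..<n}"] conjI ballI)
    show "disjoint_family_on ?B (c ` {..<n})"
      using C(3) sub unfolding disjoint_family_on_def pairwise_def disjnt_def by blast
    show "measure lborel (ball 0 1 - (\<Union>i\<in>c ` {..<n}. ?B i)) < e" using n by (simp add: A_def)
  qed (use sub C(2) in \<open>auto simp: K_def\<close>)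
qed

text \<open>The support of a glued function lies in a union of balls with different centres, hence a
  closed set T in place of a radius.\<close>

lemma Ckc_ballI_closed:
  fixes \<xi> :: "real ^ 'n \<Rightarrow> real ^ 'm"
  assumes der: "\<And>x. (\<xi> has_derivative (\<lambda>v. J x *v v)) (at x)" and cont: "continuous_on UNIV J"
    and supp: "closed T" "T \<subseteq> ball 0 1" "\<And>x. x \<notin> T \<Longrightarrow> \<xi> x = 0"
  shows "\<xi> \<in> Ckc_ball 1"
proof -
  have "compact T" using supp by (auto simp: compact_eq_bounded_closed intro: bounded_subset)
  then obtain b where b: "b < 1" "\<And>x. x \<in> T \<Longrightarrow> norm x \<le> b"
    using compact_subset_unit_ball[OF _ supp(2)] by blast
  show ?thesis by (rule Ckc_ballI[OF der cont b(1)]) (use b(2) supp(3) in force)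
qed

text \<open>The factor r compensates the inner scaling, so D\<zeta> is reproduced at full size. As
  \<zeta> vanishes from some radius r2 < 1 on, the copy lives in a closed ball strictly inside
  \<open>ball a r\<close>.\<close>

lemma add_scaled_bump:
  fixes \<xi> \<zeta> :: "real ^ 'n \<Rightarrow> real ^ 'm"
  assumes xi: "\<xi> \<in> Ckc_ball 1" and zeta: "\<zeta> \<in> Ckc_ball 1" and r: "r > 0" and sub: "ball a r \<subseteq> ball 0 1"
  shows "\<exists>\<eta>\<in>Ckc_ball 1. \<forall>x. jacobian \<eta> (at x) = jacobian \<xi> (at x) + jacobian \<zeta> (at ((x - a) /\<^sub>R r))"
proof -
  define \<eta> where "\<eta> = (\<lambda>x. \<xi> x + r *\<^sub>R \<zeta> ((x - a) /\<^sub>R r))"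
  define J where "J = (\<lambda>x. jacobian \<xi> (at x) + jacobian \<zeta> (at ((x - a) /\<^sub>R r)))"
  have zd: "((\<lambda>x. \<zeta> ((x - a) /\<^sub>R r)) has_derivative (\<lambda>v. jacobian \<zeta> (at ((x - a) /\<^sub>R r)) *v (v /\<^sub>R r))) (at x)" for x
    by (rule has_derivative_compose[where f = "\<lambda>x. (x - a) /\<^sub>R r" and g = \<zeta>, OF _ Ckc_ballD(1)[OF zeta]])
      (auto intro!: derivative_eq_intros)
  have der: "(\<eta> has_derivative (\<lambda>v. J x *v v)) (at x)" for x
    unfolding \<eta>_def
    by (rule has_derivative_eq_rhs[OF has_derivative_add[OF Ckc_ballD(1)[OF xi] has_derivative_scaleR_right[OF zd]]])
      (use r in \<open>simp add: fun_eq_iff J_def matrix_vector_mult_add_rdistrib matrix_vector_mult_scaleR\<close>)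
  have cont: "continuous_on UNIV J"
    unfolding J_def
    by (intro continuous_on_add Ckc_ballD(2)[OF xi] continuous_on_compose2[OF Ckc_ballD(2)[OF zeta]])
      (auto intro!: continuous_intros)
  obtain r1 where r1: "r1 < 1" "\<And>x. norm x \<ge> r1 \<Longrightarrow> \<xi> x = 0" using Ckc_ballD(3)[OF xi] by blast
  obtain r2 where r2: "0 < r2" "r2 < 1" "\<And>x. norm x \<ge> r2 \<Longrightarrow> \<zeta> x = 0" using Ckc_ballD(3)[OF zeta] by blast
  have "\<eta> \<in> Ckc_ball 1"
  proof (rule Ckc_ballI_closed[OF der cont])
    show "closed (cball 0 r1 \<union> cball a (r2 * r))" by auto
    have "r2 * r < r" using r2 r by simp
    then have "cball a (r2 * r) \<subseteq> ball a r" by auto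
    then show "cball 0 r1 \<union> cball a (r2 * r) \<subseteq> ball 0 1" using sub r1(1) by auto
    fix x assume x: "x \<notin> cball 0 r1 \<union> cball a (r2 * r)"
    then have "r2 * r \<le> norm (x - a)" by (simp add: dist_norm norm_minus_commute)
    moreover have "norm ((x - a) /\<^sub>R r) = norm (x - a) / r" using r by (simp add: divide_inverse_commute)
    ultimately have "norm ((x - a) /\<^sub>R r) \<ge> r2" using r by (simp add: pos_le_divide_eq)
    then show "\<eta> x = 0" using x r1(2)[of x] r2(3) by (simp add: \<eta>_def)
  qed
  then show ?thesis using jacobian_eqI[OF der] by (intro bexI[of _ \<eta>]) (auto simp: J_def)
qed

lemma add_scaled_bumps:
  fixes \<xi> :: "real ^ 'n \<Rightarrow> real ^ 'm" and \<zeta> :: "(real ^ 'n) \<times> real \<Rightarrow> real ^ 'n \<Rightarrow> real ^ 'm"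
  assumes "finite I" and xi: "\<xi> \<in> Ckc_ball 1"
    and "\<And>i. i \<in> I \<Longrightarrow> \<zeta> i \<in> Ckc_ball 1" "\<And>i. i \<in> I \<Longrightarrow> 0 < snd i" "\<And>i. i \<in> I \<Longrightarrow> ball (fst i) (snd i) \<subseteq> ball 0 1"
  shows "\<exists>\<eta>\<in>Ckc_ball 1. \<forall>x. jacobian \<eta> (at x) = jacobian \<xi> (at x) + (\<Sum>i\<in>I. jacobian (\<zeta> i) (at ((x - fst i) /\<^sub>R snd i)))"
  using assms(1,3,4,5)
proof (induction I rule: finite_induct)
  case empty
  then show ?case using xi by auto
next
  case (insert i I)
  then obtain \<eta> where eta: "\<eta> \<in> Ckc_ball 1"
    "\<And>x. jacobian \<eta> (at x) = jacobian \<xi> (at x) + (\<Sum>i\<in>I. jacobian (\<zeta> i) (at ((x - fst i) /\<^sub>R snd i)))"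
    by auto
  obtain \<eta>' where "\<eta>' \<in> Ckc_ball 1" "\<And>x. jacobian \<eta>' (at x) = jacobian \<eta> (at x) + jacobian (\<zeta> i) (at ((x - fst i) /\<^sub>R snd i))"
    using add_scaled_bump[OF eta(1), of "\<zeta> i" "snd i" "fst i"] insert.prems by auto
  then show ?case using insert.hyps by (intro bexI[of _ \<eta>']) (auto simp: eta(2))
qed

lemma uniform_continuity_on_balls:
  fixes F :: "real ^ 'n ^ 'm \<Rightarrow> real"
  assumes "continuous_on UNIV F" "e > 0"
  shows "\<exists>t>0. \<forall>X Y. norm X \<le> b \<longrightarrow> norm Y \<le> b \<longrightarrow> norm (X - Y) < t \<longrightarrow> \<bar>F X - F Y\<bar> < e"
proof -
  have "uniformly_continuous_on (cball 0 b) F"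
    by (rule compact_uniformly_continuous[OF continuous_on_subset[OF assms(1)]]) auto
  then obtain t where "t > 0" "\<And>X Y. X \<in> cball 0 b \<Longrightarrow> Y \<in> cball 0 b \<Longrightarrow> dist Y X < t \<Longrightarrow> dist (F Y) (F X) < e"
    unfolding uniformly_continuous_on_def using assms(2) by blast
  then show ?thesis by (intro exI[of _ t]) (auto simp: dist_norm norm_minus_commute abs_minus_commute)
qed

lemma jacobian_bounded:
  assumes "\<xi> \<in> Ckc_ball 1"
  shows "\<exists>b. \<forall>x. norm (jacobian \<xi> (at x)) \<le> b"
proof -
  obtain r where r: "\<And>x. norm x \<ge> r \<Longrightarrow> jacobian \<xi> (at x) = 0" using Ckc_ballD(3)[OF assms] by blast
  have "bounded ((\<lambda>x. jacobian \<xi> (at x)) ` cball 0 r)"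
    by (intro compact_imp_bounded compact_continuous_image continuous_on_subset[OF Ckc_ballD(2)[OF assms]]) auto
  then obtain b where b: "\<forall>x\<in>cball 0 r. norm (jacobian \<xi> (at x)) \<le> b" unfolding bounded_iff by blast
  have "norm (jacobian \<xi> (at x)) \<le> \<bar>b\<bar>" for x
    using b r[of x] by (cases "norm x \<le> r") (force, simp)
  then show ?thesis by blast
qed

text \<open>Makes near-optimality of a fixed test function an open condition on the matrix
  A.\<close>

lemma average_continuous:
  fixes F :: "real ^ 'n ^ 'm \<Rightarrow> real" and \<xi> :: "real ^ 'n \<Rightarrow> real ^ 'm"
  assumes F: "continuous_on UNIV F" and xi: "\<xi> \<in> Ckc_ball 1"
  shows "continuous_on UNIV (\<lambda>A. ball_average (\<lambda>x. F (A + jacobian \<xi> (at x))))"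
  unfolding continuous_on_iff
proof (intro ballI allI impI)
  fix A :: "real ^ 'n ^ 'm" and e :: real assume e: "e > 0"
  obtain L where L: "\<And>x. norm (jacobian \<xi> (at x)) \<le> L" using jacobian_bounded[OF xi] by blast
  obtain t where t: "t > 0" "\<And>X Y. norm X \<le> norm A + 1 + L \<Longrightarrow> norm Y \<le> norm A + 1 + L \<Longrightarrow> norm (X - Y) < t \<Longrightarrow> \<bar>F X - F Y\<bar> < e / 2"
    using uniform_continuity_on_balls[OF F, of "e/2" "norm A + 1 + L"] e by auto
  have "dist (ball_average (\<lambda>x. F (B + jacobian \<xi> (at x)))) (ball_average (\<lambda>x. F (A + jacobian \<xi> (at x)))) < e"
    if B: "dist B A < min t 1" for B
  proof -
    have nB: "norm B \<le> norm A + 1" using B norm_triangle_ineq2[of B A] by (simp add: dist_norm)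
    have iB: "ball_integrable (\<lambda>x. F (B + jacobian \<xi> (at x)))" and iA: "ball_integrable (\<lambda>x. F (A + jacobian \<xi> (at x)))"
      by (rule comp_integrable_cont[OF F xi])+
    have "\<bar>ball_average (\<lambda>x. F (B + jacobian \<xi> (at x)) - F (A + jacobian \<xi> (at x)))\<bar> \<le> e / 2"
    proof (rule ball_average_abs_le[OF set_integral_diff(1)[OF iB iA]])
      fix x
      have "norm (B + jacobian \<xi> (at x)) \<le> norm A + 1 + L" "norm (A + jacobian \<xi> (at x)) \<le> norm A + 1 + L"
        using norm_triangle_ineq[of B "jacobian \<xi> (at x)"] norm_triangle_ineq[of A "jacobian \<xi> (at x)"] L[of x] nB by linarith+
      moreover have "norm ((B + jacobian \<xi> (at x)) - (A + jacobian \<xi> (at x))) < t"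
        using B by (simp add: dist_norm)
      ultimately show "\<bar>F (B + jacobian \<xi> (at x)) - F (A + jacobian \<xi> (at x))\<bar> \<le> e / 2"
        by (rule less_imp_le[OF t(2)])
    qed
    then show ?thesis using e unfolding ball_average_diff[OF iB iA] dist_real_def by linarith
  qed
  then show "\<exists>d>0. \<forall>B\<in>UNIV. dist B A < d \<longrightarrow>
      dist (ball_average (\<lambda>x. F (B + jacobian \<xi> (at x)))) (ball_average (\<lambda>x. F (A + jacobian \<xi> (at x)))) < e"
    using t(1) by (intro exI[of _ "min t 1"]) auto
qed

context quasiconvex_outside begin

text \<open>Near-optimal test functions at the points of a compact set can be taken from a finite family:
  the strict inequality defining near-optimality is an open condition, by continuity of the envelope.\<close>

lemma finite_near_optimal:
  assumes K: "compact K" and e: "e > 0"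
  shows "\<exists>Z. finite Z \<and> Z \<subseteq> Ckc_ball 1 \<and> (\<forall>A\<in>K. \<exists>\<zeta>\<in>Z. ball_average (\<lambda>x. F (A + jacobian \<zeta> (at x))) < qc_envelope F A + e)"
proof -
  define U where "U = (\<lambda>\<zeta>. {B. ball_average (\<lambda>x. F (B + jacobian \<zeta> (at x))) < qc_envelope F B + e})"
  have op: "open (U \<zeta>)" if "\<zeta> \<in> Ckc_ball 1" for \<zeta>
    unfolding U_def by (intro open_Collect_less average_continuous cont that continuous_intros envelope_continuous)
  have cov: "K \<subseteq> (\<Union>\<zeta>\<in>Ckc_ball 1. U \<zeta>)"
  proof
    fix A
    have "(INF \<xi>\<in>Ckc_ball 1. ball_average (\<lambda>x. F (A + jacobian \<xi> (at x)))) < qc_envelope F A + e"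
      using e by (simp add: qc_envelope_def)
    then obtain \<zeta> where "\<zeta> \<in> Ckc_ball 1" "ball_average (\<lambda>x. F (A + jacobian \<zeta> (at x))) < qc_envelope F A + e"
      using cINF_less_iff[OF _ averages_bdd_below] zero_Ckc_ball by blast
    then show "A \<in> (\<Union>\<zeta>\<in>Ckc_ball 1. U \<zeta>)" by (auto simp: U_def)
  qed
  obtain Z where "Z \<subseteq> Ckc_ball 1" "finite Z" "K \<subseteq> (\<Union>\<zeta>\<in>Z. U \<zeta>)"
    by (rule compactE_image[OF K op cov])
  then show ?thesis by (intro exI[of _ Z]) (auto simp: U_def)
qed

end

lemma jacobian_outside:
  assumes "\<xi> \<in> Ckc_ball 1" "norm x \<ge> 1" shows "jacobian \<xi> (at x) = 0"
  using Ckc_ballD(3)[OF assms(1)] assms(2) by force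

context quasiconvex_outside begin

text \<open>On each small ball of a packing D\<xi> is almost constant, and a rescaled near-optimal
  test function for that constant is added to \<xi>. The sum is a competitor at z whose average of
  F(z + D\<eta>) exceeds that of the envelope at z + D\<xi> by little. The order of choices matters:
  test functions first, then the moduli of continuity they require, then the packing.\<close>

lemma envelope_quasiconvex:
  fixes \<xi> :: "real ^ 'n \<Rightarrow> real ^ 'm"
  assumes xi: "\<xi> \<in> Ckc_ball 1"
  shows "qc_envelope F z \<le> ball_average (\<lambda>x. qc_envelope F (z + jacobian \<xi> (at x)))"
proof (rule field_le_epsilon)
  fix e0 :: real assume e0: "e0 > 0"
  \<comment> \<open>On the balls e is spent three times: oscillation of F, near-optimality,
    oscillation of the envelope. The fourth share is for the uncovered set.\<close>
  define e where "e = e0 / 4"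
  have e: "e > 0" using e0 by (simp add: e_def)
  define Q where "Q = qc_envelope F"
  define J where "J = (\<lambda>x. jacobian \<xi> (at x))"
  let ?B = "ball (0::real^'n) 1"
  define v where "v = measure lborel ?B"
  have v: "v > 0" using content_ball_pos[of 1 "0::real^'n"] by (simp add: v_def)
  have Jc: "continuous_on UNIV J" unfolding J_def by (rule Ckc_ballD(2)[OF xi])
  have Qc: "continuous_on UNIV Q" unfolding Q_def by (rule envelope_continuous)
  obtain bJ where bJ: "\<And>x. norm (J x) \<le> bJ" using jacobian_bounded[OF xi] unfolding J_def by blast
  define K where "K = (\<lambda>x. z + J x) ` cball 0 1"
  have K: "compact K" unfolding K_def
    by (intro compact_continuous_image continuous_intros continuous_on_subset[OF Jc]) auto
  obtain Z where Z: "finite Z" "Z \<subseteq> Ckc_ball 1"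
    "\<And>A. A \<in> K \<Longrightarrow> \<exists>\<zeta>\<in>Z. ball_average (\<lambda>x. F (A + jacobian \<zeta> (at x))) < Q A + e"
    using finite_near_optimal[OF K e] unfolding Q_def by blast
  obtain b where b: "\<And>\<zeta> x. \<zeta> \<in> Z \<Longrightarrow> norm (jacobian \<zeta> (at x)) \<le> b \<zeta>"
    using jacobian_bounded Z(2) by (metis subsetD)
  \<comment> \<open>A common bound for the gradients of all candidate corrections, available before
    any ball is chosen because Z is finite. Otherwise the radius of the packing would depend on test
    functions that depend on the packing.\<close>
  define L where "L = Max (insert 0 (b ` Z))"
  have L: "norm (jacobian \<zeta> (at x)) \<le> L" if "\<zeta> \<in> Z" for \<zeta> x
    using b[OF that, of x] Z(1) that unfolding L_def by (meson Max_ge finite_imageI finite_insert imageI insertCI order_trans)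
  have L0: "L \<ge> 0" unfolding L_def using Z(1) by simp
  define R where "R = norm z + bJ + L"
  obtain S0 where S0: "\<And>w. norm w \<le> R \<Longrightarrow> \<bar>F w\<bar> \<le> S0" using F_bounded unfolding bounded_on_balls_def by blast
  obtain S1 where S1: "\<And>w. norm w \<le> R \<Longrightarrow> \<bar>Q w\<bar> \<le> S1" using envelope_bounded unfolding bounded_on_balls_def Q_def by blast
  define S where "S = \<bar>S0\<bar> + \<bar>S1\<bar>"
  have S: "\<bar>F w\<bar> \<le> S" "\<bar>Q w\<bar> \<le> S" if "norm w \<le> R" for w
    using S0[OF that] S1[OF that] by (auto simp: S_def)
  have S_nn: "S \<ge> 0" by (simp add: S_def)
  obtain t where t: "t > 0" "\<And>X Y. norm X \<le> R \<Longrightarrow> norm Y \<le> R \<Longrightarrow> norm (X - Y) < t \<Longrightarrow> \<bar>F X - F Y\<bar> < e"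
    using uniform_continuity_on_balls[OF cont e, of R] by blast
  obtain t' where t': "t' > 0" "\<And>X Y. norm X \<le> R \<Longrightarrow> norm Y \<le> R \<Longrightarrow> norm (X - Y) < t' \<Longrightarrow> \<bar>Q X - Q Y\<bar> < e"
    using uniform_continuity_on_balls[OF Qc e, of R] by blast
  have "uniformly_continuous_on (cball 0 1) J"
    by (rule compact_uniformly_continuous[OF continuous_on_subset[OF Jc]]) auto
  then obtain \<rho> where rho: "\<rho> > 0" "\<And>x y. x \<in> cball 0 1 \<Longrightarrow> y \<in> cball 0 1 \<Longrightarrow> dist y x < \<rho> \<Longrightarrow> dist (J y) (J x) < min t t'"
    unfolding uniformly_continuous_on_def using t(1) t'(1) by (metis min_less_iff_conj)
  \<comment> \<open>The uncovered set contributes at most 2 S times its measure, which this keeps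
    below e v; the summand 1 guards against S = 0.\<close>
  define m where "m = e * v / (2 * S + 1)"
  have m: "m > 0" using e v S_nn by (simp add: m_def)
  obtain I :: "((real^'n) \<times> real) set" where I: "finite I"
    "\<And>i. i \<in> I \<Longrightarrow> 0 < snd i" "\<And>i. i \<in> I \<Longrightarrow> snd i < \<rho>" "\<And>i. i \<in> I \<Longrightarrow> ball (fst i) (snd i) \<subseteq> ?B"
    "disjoint_family_on (\<lambda>i. ball (fst i) (snd i)) I"
    "measure lborel (?B - (\<Union>i\<in>I. ball (fst i) (snd i))) < m"
    using ball_packing[OF rho(1) m] by blast
  let ?Bi = "\<lambda>i::(real^'n) \<times> real. ball (fst i) (snd i)"
  have ctr: "fst i \<in> ?B" if "i \<in> I" for i using I(2)[OF that] I(4)[OF that] centre_in_ball by blast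
  have "\<exists>\<zeta>. \<zeta> \<in> Z \<and> ball_average (\<lambda>x. F (z + J (fst i) + jacobian \<zeta> (at x))) < Q (z + J (fst i)) + e" if "i \<in> I" for i
    using Z(3)[of "z + J (fst i)"] ctr[OF that] unfolding K_def by auto
  then obtain \<zeta> where zeta: "\<And>i. i \<in> I \<Longrightarrow> \<zeta> i \<in> Z"
    "\<And>i. i \<in> I \<Longrightarrow> ball_average (\<lambda>x. F (z + J (fst i) + jacobian (\<zeta> i) (at x))) < Q (z + J (fst i)) + e"
    by metis
  have zC: "\<zeta> i \<in> Ckc_ball 1" if "i \<in> I" for i using zeta(1)[OF that] Z(2) by auto
  obtain \<eta> where eta: "\<eta> \<in> Ckc_ball 1"
    "\<And>x. jacobian \<eta> (at x) = J x + (\<Sum>i\<in>I. jacobian (\<zeta> i) (at ((x - fst i) /\<^sub>R snd i)))"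
    using add_scaled_bumps[of I \<xi> \<zeta>, OF I(1) xi zC I(2) I(4)] unfolding J_def by blast
  have out: "jacobian (\<zeta> i) (at ((x - fst i) /\<^sub>R snd i)) = 0" if "i \<in> I" "x \<notin> ?Bi i" for i x
  proof (rule jacobian_outside[OF zC[OF that(1)]])
    have "snd i \<le> norm (x - fst i)" using that(2) by (simp add: dist_norm norm_minus_commute)
    then show "1 \<le> norm ((x - fst i) /\<^sub>R snd i)" using I(2)[OF that(1)]
      by (simp add: divide_inverse_commute[symmetric] pos_le_divide_eq)
  qed
  \<comment> \<open>The gradient of \<eta> is a sum over all of I; disjointness leaves only the term
    of the ball containing x.\<close>
  have on_ball: "jacobian \<eta> (at x) = J x + jacobian (\<zeta> i) (at ((x - fst i) /\<^sub>R snd i))" if "i \<in> I" "x \<in> ?Bi i" for i x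
  proof -
    have "(\<Sum>j\<in>I. jacobian (\<zeta> j) (at ((x - fst j) /\<^sub>R snd j))) = (\<Sum>j\<in>{i}. jacobian (\<zeta> j) (at ((x - fst j) /\<^sub>R snd j)))"
    proof (rule sum.mono_neutral_right[OF I(1)])
      show "\<forall>j\<in>I - {i}. jacobian (\<zeta> j) (at ((x - fst j) /\<^sub>R snd j)) = 0"
      proof
        fix j assume j: "j \<in> I - {i}"
        then have "?Bi i \<inter> ?Bi j = {}" using I(5) that(1) unfolding disjoint_family_on_def by blast
        then have "x \<notin> ?Bi j" using that(2) by blast
        then show "jacobian (\<zeta> j) (at ((x - fst j) /\<^sub>R snd j)) = 0" using out j by blast
      qed
    qed (use that in auto)
    then show ?thesis unfolding eta(2) by simp
  qed
  have off: "jacobian \<eta> (at x) = J x" if "x \<notin> (\<Union>i\<in>I. ?Bi i)" for x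
    unfolding eta(2) using out that by (simp add: sum.neutral)
  let ?f = "\<lambda>x. F (z + jacobian \<eta> (at x))"
  let ?q = "\<lambda>x. Q (z + J x) + 3 * e"
  let ?U = "\<Union>i\<in>I. ?Bi i"
  let ?D = "?B - ?U"
  have UB: "?U \<subseteq> ?B" using I(4) by blast
  have Um: "?U \<in> sets lborel" "?D \<in> sets lborel" by (auto simp: borel_open open_UN)
  have intf: "set_integrable lborel ?B ?f" by (rule comp_integrable_cont[OF cont eta(1)])
  have intq: "set_integrable lborel ?B ?q"
    using comp_integrable_cont[OF Qc xi, of z] ball_integrable_const[of "3 * e"] unfolding J_def by (intro set_integral_add(1))
  have sub: "set_integrable lborel T g" if "set_integrable lborel ?B g" "T \<in> sets lborel" "T \<subseteq> ?B" for T and g :: "real^'n \<Rightarrow> real"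
    using set_integrable_subset that by blast
  have split: "(LBINT x:?B. g x) = (\<Sum>i\<in>I. LBINT x:?Bi i. g x) + (LBINT x:?D. g x)"
    if g: "set_integrable lborel ?B g" for g :: "real^'n \<Rightarrow> real"
  proof -
    have "(LBINT x:?B. g x) = (LBINT x:?U \<union> ?D. g x)" using UB by (simp add: Un_absorb1)
    also have "\<dots> = (LBINT x:?U. g x) + (LBINT x:?D. g x)"
      by (rule set_integral_Un) (use sub[OF g] Um UB in auto)
    also have "(LBINT x:?U. g x) = (\<Sum>i\<in>I. LBINT x:?Bi i. g x)"
      by (rule set_integral_finite_Union[OF I(1) I(5)]) (use sub[OF g] I(4) in auto)
    finally show ?thesis .
  qed
  have RJ: "norm (z + J x) \<le> R" for x using norm_triangle_ineq[of z "J x"] bJ[of x] L0 unfolding R_def by linarith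
  have RJL: "norm (z + J x + jacobian \<zeta>' (at y)) \<le> R" if "\<zeta>' \<in> Z" for x y \<zeta>'
    using norm_triangle_ineq[of z "J x"] norm_triangle_ineq[of "z + J x" "jacobian \<zeta>' (at y)"] bJ[of x] L[OF that, of y]
    unfolding R_def by linarith
  have piece: "(LBINT x:?Bi i. ?f x) \<le> (LBINT x:?Bi i. ?q x)" if i: "i \<in> I" for i
  proof -
    define a where "a = fst i"
    define r where "r = snd i"
    define H where "H = (\<lambda>y. F (z + J a + jacobian (\<zeta> i) (at y)) + e)"
    have r: "r > 0" using I(2)[OF i] by (simp add: r_def)
    have iH: "set_integrable lborel ?B H"
      unfolding H_def by (intro set_integral_add(1) comp_integrable_cont[OF cont zC[OF i]] ball_integrable_const)
    have Hm: "H \<in> borel_measurable borel"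
      unfolding H_def
      by (intro borel_measurable_add borel_measurable_const measurable_compose[OF _ F_measurable]
          borel_measurable_continuous_onI Ckc_ballD(2)[OF zC[OF i]])
    have near: "dist (J x) (J a) < min t t'" if "x \<in> ball a r" for x
    proof (rule rho(2))
      show "a \<in> cball 0 1" using ctr[OF i] by (simp add: a_def)
      show "x \<in> cball 0 1" using that I(4)[OF i] by (force simp: a_def r_def)
      show "dist x a < \<rho>" using that I(3)[OF i] by (simp add: a_def r_def dist_commute)
    qed
    have iHs: "set_integrable lborel (ball a r) (\<lambda>x. H ((x - a) /\<^sub>R r))"
    proof -
      have "set_integrable lborel ?B (\<lambda>x. H ((x - a) /\<^sub>R r))"
      proof (rule ball_integrable_bounded)
        show "(\<lambda>x. H ((x - a) /\<^sub>R r)) \<in> borel_measurable borel"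
          by (rule measurable_compose[OF _ Hm]) auto
        show "\<bar>H ((x - a) /\<^sub>R r)\<bar> \<le> S + e" for x
          unfolding H_def using S(1)[OF RJL[OF zeta(1)[OF i]], of a "(x - a) /\<^sub>R r"] e by linarith
      qed
      then show ?thesis by (rule sub) (use I(4)[OF i] in \<open>auto simp: a_def r_def\<close>)
    qed
    have vi: "measure lborel (ball a r) = r ^ CARD('n) * v"
      using content_ball_conv_unit_ball[of r a] r by (simp add: v_def)
    have "(LBINT x:ball a r. ?f x) \<le> (LBINT x:ball a r. H ((x - a) /\<^sub>R r))"
    proof (rule set_integral_mono[OF _ iHs])
      show "set_integrable lborel (ball a r) ?f" by (rule sub[OF intf]) (use I(4)[OF i] in \<open>auto simp: a_def r_def\<close>)
      fix x assume x: "x \<in> ball a r"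
      let ?y = "(x - a) /\<^sub>R r"
      have "?f x = F (z + J x + jacobian (\<zeta> i) (at ?y))"
        using on_ball[OF i, of x] x by (simp add: a_def r_def add.assoc)
      moreover have "\<bar>F (z + J x + jacobian (\<zeta> i) (at ?y)) - F (z + J a + jacobian (\<zeta> i) (at ?y))\<bar> < e"
        by (rule t(2)[OF RJL[OF zeta(1)[OF i]] RJL[OF zeta(1)[OF i]]]) (use near[OF x] in \<open>simp add: dist_norm\<close>)
      ultimately show "?f x \<le> H ?y" by (simp add: H_def)
    qed
    also have "\<dots> = r ^ CARD('n) * (LBINT x:?B. H x)" using set_integral_ball_scale[OF Hm r, of a] by simp
    also have "(LBINT x:?B. H x) = v * ball_average H" using v by (simp add: ball_average_def v_def)
    also have "ball_average H = ball_average (\<lambda>y. F (z + J a + jacobian (\<zeta> i) (at y))) + e"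
      unfolding H_def
      by (subst ball_average_add[OF comp_integrable_cont[OF cont zC[OF i]] ball_integrable_const]) (simp add: ball_average_const)
    also have "r ^ CARD('n) * (v * (ball_average (\<lambda>y. F (z + J a + jacobian (\<zeta> i) (at y))) + e))
        \<le> r ^ CARD('n) * (v * (Q (z + J a) + 2 * e))"
      using zeta(2)[OF i] r v by (intro mult_left_mono) (auto simp: a_def)
    also have "\<dots> = (LBINT x:ball a r. Q (z + J a) + 2 * e)"
      by (subst set_integral_const) (auto simp: vi less_imp_neq)
    also have "\<dots> \<le> (LBINT x:ball a r. ?q x)"
    proof (rule set_integral_mono)
      show "set_integrable lborel (ball a r) ?q" by (rule sub[OF intq]) (use I(4)[OF i] in \<open>auto simp: a_def r_def\<close>)
      show "set_integrable lborel (ball a r) (\<lambda>x. Q (z + J a) + 2 * e)"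
        by (rule sub[OF ball_integrable_const]) (use I(4)[OF i] in \<open>auto simp: a_def r_def\<close>)
      fix x assume "x \<in> ball a r"
      from near[OF this] have "norm ((z + J x) - (z + J a)) < t'" by (simp add: dist_norm)
      from t'(2)[OF RJ RJ this] show "Q (z + J a) + 2 * e \<le> ?q x" by linarith
    qed
    finally show ?thesis by (simp add: a_def r_def)
  qed
  have Dfin: "emeasure lborel ?D < \<infinity>"
    by (rule le_less_trans[OF emeasure_mono emeasure_lborel_ball_finite[of "0::real^'n" 1]]) auto
  have Dconst: "(LBINT x:?D. c) = measure lborel ?D * c" for c :: real
    using set_integral_const[of ?D lborel c] Um(2) Dfin by simp
  have Dint: "set_integrable lborel ?D (\<lambda>x. c)" for c :: real
    by (rule sub[OF ball_integrable_const]) (use Um in auto)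
  \<comment> \<open>On the uncovered set there is no comparison of \<open>?f\<close> with
    \<open>?q\<close>, only \<open>?f\<close> \<le> S and \<open>?q\<close> \<ge> -S.\<close>
  have d1: "(LBINT x:?D. ?f x) \<le> measure lborel ?D * S"
    unfolding Dconst[symmetric]
  proof (rule set_integral_mono[OF sub[OF intf] Dint])
    fix x assume "x \<in> ?D"
    then have "jacobian \<eta> (at x) = J x" by (intro off) auto
    then show "?f x \<le> S" using S(1)[OF RJ[of x]] by simp
  qed (use Um in auto)
  have d2: "measure lborel ?D * (- S) \<le> (LBINT x:?D. ?q x)"
    unfolding Dconst[symmetric]
  proof (rule set_integral_mono[OF Dint sub[OF intq]])
    fix x assume "x \<in> ?D"
    then show "- S \<le> ?q x" using S(2)[OF RJ[of x]] e by simp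
  qed (use Um in auto)
  have "v * Q z \<le> v * ball_average ?f"
    using envelope_le[OF eta(1), of z] v by (simp add: Q_def)
  also have "\<dots> = (LBINT x:?B. ?f x)" using v by (simp add: ball_average_def v_def)
  also have "\<dots> \<le> (\<Sum>i\<in>I. LBINT x:?Bi i. ?q x) + measure lborel ?D * S"
    unfolding split[OF intf] by (intro add_mono sum_mono piece d1)
  also have "\<dots> \<le> (LBINT x:?B. ?q x) + 2 * S * measure lborel ?D"
    unfolding split[OF intq] using d2 by (simp add: algebra_simps)
  also have "\<dots> \<le> (LBINT x:?B. ?q x) + e * v"
  proof -
    have "2 * S * measure lborel ?D \<le> (2 * S + 1) * m"
      using I(6) S_nn by (intro mult_mono) (auto simp: less_imp_le)
    also have "\<dots> = e * v" using S_nn by (simp add: m_def)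
    finally show ?thesis by simp
  qed
  also have "(LBINT x:?B. ?q x) = v * ball_average ?q" using v by (simp add: ball_average_def v_def)
  also have "ball_average ?q = ball_average (\<lambda>x. Q (z + J x)) + 3 * e"
    using comp_integrable_cont[OF Qc xi, of z] ball_integrable_const[of "3 * e"] unfolding J_def
    by (subst ball_average_add) (auto simp: ball_average_const)
  also have "v * (ball_average (\<lambda>x. Q (z + J x)) + 3 * e) + e * v = v * (ball_average (\<lambda>x. Q (z + J x)) + e0)"
    by (simp add: e_def algebra_simps)
  finally have "Q z \<le> ball_average (\<lambda>x. Q (z + J x)) + e0" using v by simp
  then show "qc_envelope F z \<le> ball_average (\<lambda>x. qc_envelope F (z + jacobian \<xi> (at x))) + e0"
    by (simp add: Q_def J_def)
qed

end

section \<open>Mollification\<close>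

lemma Ck_on_SucI:
  assumes "\<And>x. (f has_derivative f' x) (at x)" "\<And>v. Ck_on k (\<lambda>x. f' x v) UNIV"
  shows "Ck_on (Suc k) f UNIV"
proof -
  have "frechet_derivative f (at x) = f' x" for x using frechet_derivative_at[OF assms(1)] by simp
  then show ?thesis using assms by (auto simp: differentiable_on_def differentiable_def)
qed

lemma Ck_on_SucD:
  assumes "Ck_on (Suc k) f UNIV"
  shows "(f has_derivative frechet_derivative f (at x)) (at x)" "Ck_on k (\<lambda>x. frechet_derivative f (at x) v) UNIV"
  using assms by (auto simp: differentiable_on_def frechet_derivative_works[symmetric])

text \<open>Not immediate from the definition: level k + 1 asks for level k of the derivatives, not
  of the function itself.\<close>

lemma Ck_on_pred: "Ck_on (Suc k) f UNIV \<Longrightarrow> Ck_on k f UNIV"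
proof (induction k arbitrary: f)
  case 0
  then show ?case using differentiable_imp_continuous_on by auto
next
  case (Suc k)
  note D = Ck_on_SucD[OF Suc.prems]
  show ?case by (rule Ck_on_SucI[OF D(1)]) (rule Suc.IH[OF D(2)])
qed

lemma Ck_on_const: "Ck_on k (\<lambda>x. c) UNIV"
proof (induction k arbitrary: c)
  case (Suc k)
  show ?case by (rule Ck_on_SucI[of _ "\<lambda>x v. 0"]) (auto intro: Suc)
qed simp

lemma Ck_on_inner: "Ck_on k (\<lambda>x. x \<bullet> v) UNIV"
proof (cases k)
  case 0
  then show ?thesis by (auto intro!: continuous_intros)
next
  case (Suc k)
  show ?thesis unfolding Suc
    by (rule Ck_on_SucI[of _ "\<lambda>x w. w \<bullet> v"]) (auto intro!: derivative_eq_intros Ck_on_const)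
qed

lemma Ck_on_add: "Ck_on k f UNIV \<Longrightarrow> Ck_on k g UNIV \<Longrightarrow> Ck_on k (\<lambda>x. f x + g x) UNIV"
proof (induction k arbitrary: f g)
  case 0
  then show ?case by (auto intro!: continuous_intros)
next
  case (Suc k)
  note D = Ck_on_SucD[OF Suc.prems(1)] Ck_on_SucD[OF Suc.prems(2)]
  show ?case by (rule Ck_on_SucI[OF has_derivative_add[OF D(1) D(3)]]) (rule Suc.IH[OF D(2) D(4)])
qed

lemma Ck_on_mult:
  fixes f g :: "'a::euclidean_space \<Rightarrow> real"
  shows "Ck_on k f UNIV \<Longrightarrow> Ck_on k g UNIV \<Longrightarrow> Ck_on k (\<lambda>x. f x * g x) UNIV"
proof (induction k arbitrary: f g)
  case 0
  then show ?case by (auto intro!: continuous_intros)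
next
  case (Suc k)
  note D = Ck_on_SucD[OF Suc.prems(1)] Ck_on_SucD[OF Suc.prems(2)]
  show ?case
    by (rule Ck_on_SucI[OF has_derivative_mult[OF D(1) D(3)]])
      (rule Ck_on_add[OF Suc.IH[OF Ck_on_pred[OF Suc.prems(1)] D(4)] Suc.IH[OF D(2) Ck_on_pred[OF Suc.prems(2)]]])
qed

text \<open>The derivatives of \<open>exp (-1/t)\<close> stay in the linear span of this family.\<close>

definition flat :: "nat \<Rightarrow> real \<Rightarrow> real" where
  "flat j t = (if t > 0 then exp (- 1 / t) / t ^ j else 0)"

lemma power_le_fact_exp:
  assumes "x \<ge> (0::real)" shows "x ^ n \<le> fact n * exp x"
proof -
  have "(\<Sum>k\<in>{n}. x ^ k /\<^sub>R fact k) \<le> (\<Sum>k. x ^ k /\<^sub>R fact k)"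
    by (rule sum_le_suminf[OF summable_exp_generic]) (use assms in auto)
  then have "x ^ n / fact n \<le> exp x" by (simp add: exp_def divide_inverse mult.commute)
  then show ?thesis by (simp add: field_simps)
qed

text \<open>The quadratic bound forces the difference quotient at 0 to vanish in the limit. It stems
  from the term of order j + 2 in the exponential series at 1/t.\<close>

lemma flat_bounds: "0 \<le> flat j t" "flat j t \<le> fact (j + 2) * t\<^sup>2"
proof -
  show "0 \<le> flat j t" by (simp add: flat_def)
  show "flat j t \<le> fact (j + 2) * t\<^sup>2"
  proof (cases "t > 0")
    case True
    have "(1 / t) ^ (j + 2) \<le> fact (j + 2) * exp (1 / t)" using True by (intro power_le_fact_exp) auto
    then have "exp (- (1 / t)) * (1 / t) ^ (j + 2) \<le> exp (- (1 / t)) * (fact (j + 2) * exp (1 / t))"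
      by (intro mult_left_mono) auto
    also have "\<dots> = fact (j + 2) * (exp (- (1 / t)) * exp (1 / t))" by simp
    also have "\<dots> = fact (j + 2)" by (subst mult_exp_exp) simp
    finally have "exp (- (1 / t)) * (1 / t) ^ (j + 2) * t\<^sup>2 \<le> fact (j + 2) * t\<^sup>2" by (intro mult_right_mono) auto
    moreover have "exp (- (1 / t)) * (1 / t) ^ (j + 2) * t\<^sup>2 = flat j t"
      using True by (simp add: flat_def power_add power_one_over field_simps power2_eq_square)
    ultimately show ?thesis by simp
  qed (simp add: flat_def)
qed

lemma DERIV_flat: "(flat j has_real_derivative - real j * flat (j+1) t + flat (j+2) t) (at t)"
proof (cases t "0::real" rule: linorder_cases)
  case less
  have "((\<lambda>x. 0::real) has_real_derivative 0) (at t)" by simp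
  then have "(flat j has_real_derivative 0) (at t)"
    by (rule has_field_derivative_transform_within_open[of _ _ _ "{..<0}"]) (use less in \<open>auto simp: flat_def\<close>)
  then show ?thesis using less by (simp add: flat_def)
next
  case greater
  have "((\<lambda>t. exp (- 1 / t) * (inverse t) ^ j) has_real_derivative
      exp (- 1 / t) * (real j * (inverse t) ^ (j - 1) * - (inverse t * inverse t)) + exp (- 1 / t) * (inverse t * inverse t) * (inverse t) ^ j) (at t)"
  proof -
    have "((\<lambda>t. exp (- 1 / t)) has_real_derivative exp (- 1 / t) * (inverse t * inverse t)) (at t)"
      using greater by (auto intro!: derivative_eq_intros simp: field_simps)
    moreover have "((\<lambda>t. inverse t ^ j) has_real_derivative real j * (- (inverse t ^ Suc (Suc 0)) * inverse t ^ (j - Suc 0))) (at t)"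
      using greater by (intro DERIV_power DERIV_inverse) auto
    ultimately show ?thesis by (rule DERIV_cong[OF DERIV_mult]) (simp add: algebra_simps)
  qed
  moreover have "exp (- 1 / t) * (real j * (inverse t) ^ (j - 1) * - (inverse t * inverse t)) + exp (- 1 / t) * (inverse t * inverse t) * (inverse t) ^ j
     = - real j * flat (j+1) t + flat (j+2) t"
    using greater by (cases j) (auto simp: flat_def field_simps power_inverse)
  ultimately have "((\<lambda>t. exp (- 1 / t) * (inverse t) ^ j) has_real_derivative - real j * flat (j+1) t + flat (j+2) t) (at t)"
    by simp
  then show ?thesis
    by (rule has_field_derivative_transform_within_open[of _ _ _ "{0<..}"])
      (use greater in \<open>auto simp: flat_def divide_inverse power_inverse\<close>)
next
  case equal
  have "(flat j has_real_derivative 0) (at 0)"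
    unfolding DERIV_def
  proof (rule Lim_null_comparison)
    show "\<forall>\<^sub>F h in at 0. norm ((flat j (0 + h) - flat j 0) / h) \<le> fact (j + 2) * \<bar>h\<bar>"
    proof (rule always_eventually, rule allI)
      fix h :: real
      have "\<bar>flat j h\<bar> \<le> fact (j + 2) * \<bar>h\<bar> * \<bar>h\<bar>"
        using flat_bounds[of j h] by (simp add: power2_eq_square mult.assoc)
      then show "norm ((flat j (0 + h) - flat j 0) / h) \<le> fact (j + 2) * \<bar>h\<bar>"
        by (cases "h = 0") (auto simp: flat_def[of j 0] pos_divide_le_eq)
    qed
    show "(\<lambda>h::real. fact (j + 2) * \<bar>h\<bar>) \<midarrow>0\<rightarrow> 0" by (auto intro!: tendsto_eq_intros)
  qed
  then show ?thesis using equal by (simp add: flat_def)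
qed

text \<open>The index j has to vary in the induction, since differentiation raises it by 1 and by
  2.\<close>

lemma Ck_on_bump: "Ck_on k (\<lambda>x::'a::euclidean_space. flat j (e - x \<bullet> x)) UNIV"
proof (induction k arbitrary: j)
  case 0
  have "continuous_on UNIV (flat j)" using DERIV_flat by (auto intro!: continuous_at_imp_continuous_on DERIV_isCont)
  then have "continuous_on UNIV (\<lambda>x::'a. flat j (e - x \<bullet> x))"
    by (rule continuous_on_compose2) (auto intro!: continuous_intros)
  then show ?case by simp
next
  case (Suc k)
  have "((\<lambda>x::'a. e - x \<bullet> x) has_derivative (\<lambda>v. - 2 * (x \<bullet> v))) (at x)" for x
    by (auto intro!: derivative_eq_intros simp: inner_commute)
  from has_derivative_compose[OF this DERIV_flat[unfolded has_field_derivative_def]]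
  have d: "((\<lambda>x::'a. flat j (e - x \<bullet> x)) has_derivative
     (\<lambda>v. (- real j * flat (j+1) (e - x \<bullet> x) + flat (j+2) (e - x \<bullet> x)) * (- 2 * (x \<bullet> v)))) (at x)" for x by simp
  show ?case
    by (rule Ck_on_SucI[OF d]) (intro Ck_on_mult Ck_on_add Ck_on_const Ck_on_inner Suc.IH)
qed

section \<open>Convolutions and approximation by smooth test functions\<close>

text \<open>In finite dimension continuity of every directional derivative gives continuity of the
  derivative as a bounded operator, which is the form in which Leibniz's rule is applied.\<close>

lemma has_derivative_param_integral:
  fixes g :: "'a::euclidean_space \<Rightarrow> 'a \<Rightarrow> 'c::euclidean_space"
  assumes der: "\<And>x y. ((\<lambda>x. g x y) has_derivative g' x y) (at x)"
    and cont: "\<And>x. continuous_on UNIV (g x)"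
    and cont': "\<And>v. continuous_on UNIV (\<lambda>(x, y). g' x y v)"
  shows "((\<lambda>x. integral (cbox a b) (g x)) has_derivative (\<lambda>v. integral (cbox a b) (\<lambda>y. g' x y v))) (at x)"
proof -
  have app: "blinfun_apply (Blinfun (g' x y)) = g' x y" for x y
    using has_derivative_bounded_linear[OF der] by (rule bounded_linear_Blinfun_apply)
  have c: "continuous_on UNIV (\<lambda>(x, y). Blinfun (g' x y))"
    by (rule continuous_on_blinfun_componentwise) (use cont' in \<open>simp add: app split_beta\<close>)
  have "((\<lambda>x. integral (cbox a b) (g x)) has_derivative integral (cbox a b) (\<lambda>y. Blinfun (g' x y))) (at x within UNIV)"
  proof (rule leibniz_rule)
    show "((\<lambda>x. g x y) has_derivative blinfun_apply (Blinfun (g' x y))) (at x within UNIV)" for x y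
      using der by (simp add: app)
    show "g x integrable_on cbox a b" for x
      by (rule integrable_continuous) (rule continuous_on_subset[OF cont], simp)
    show "continuous_on (UNIV \<times> cbox a b) (\<lambda>(x, y). Blinfun (g' x y))"
      by (rule continuous_on_subset[OF c]) simp
  qed auto
  moreover have "blinfun_apply (integral (cbox a b) (\<lambda>y. Blinfun (g' x y))) = (\<lambda>v. integral (cbox a b) (\<lambda>y. g' x y v))"
  proof
    fix v
    have "continuous_on UNIV (\<lambda>y::'a. (x, y))" by (intro continuous_on_Pair continuous_on_const continuous_on_id)
    from continuous_on_compose2[OF c this] have "continuous_on UNIV (\<lambda>y. Blinfun (g' x y))" by simp
    then have "(\<lambda>y. Blinfun (g' x y)) integrable_on cbox a b"
      by (intro integrable_continuous) (rule continuous_on_subset, auto)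
    then show "blinfun_apply (integral (cbox a b) (\<lambda>y. Blinfun (g' x y))) v = integral (cbox a b) (\<lambda>y. g' x y v)"
      by (simp add: blinfun_apply_integral app)
  qed
  ultimately show ?thesis by simp
qed

text \<open>All derivatives are placed on the kernel, so \<xi> contributes only its continuity; the
  box of integration does not move with x.\<close>

lemma Ck_on_convolution:
  fixes \<rho> :: "'a::euclidean_space \<Rightarrow> real" and \<xi> :: "'a \<Rightarrow> 'c::euclidean_space"
  assumes xi: "continuous_on UNIV \<xi>"
  shows "Ck_on k \<rho> UNIV \<Longrightarrow> Ck_on k (\<lambda>x. integral (cbox a b) (\<lambda>y. \<rho> (x - y) *\<^sub>R \<xi> y)) UNIV"
proof (induction k arbitrary: \<rho>)
  case 0
  then have rho: "continuous_on UNIV \<rho>" by simp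
  have "continuous_on (UNIV \<times> cbox a b) (\<lambda>(x, y). \<rho> (x - y) *\<^sub>R \<xi> y)"
    unfolding split_beta
    by (intro continuous_on_scaleR continuous_on_compose2[OF rho] continuous_on_compose2[OF xi]) (auto intro!: continuous_intros)
  then show ?case using integral_continuous_on_param by auto
next
  case (Suc k)
  note D = Ck_on_SucD[OF Suc.prems]
  have cD: "continuous_on UNIV (\<lambda>x. frechet_derivative \<rho> (at x) v)" for v
    using D(2)[of v] Ck_on_pred by (induction k) auto
  have rho: "continuous_on UNIV \<rho>" using D(1) by (auto intro!: has_derivative_continuous continuous_at_imp_continuous_on)
  have d: "((\<lambda>x. \<rho> (x - y) *\<^sub>R \<xi> y) has_derivative (\<lambda>v. frechet_derivative \<rho> (at (x - y)) v *\<^sub>R \<xi> y)) (at x)" for x y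
  proof -
    have "((\<lambda>x. \<rho> (x - y)) has_derivative frechet_derivative \<rho> (at (x - y))) (at x)"
      by (rule has_derivative_compose[where f = "\<lambda>x. x - y" and g = \<rho>, OF _ D(1)]) (auto intro!: derivative_eq_intros)
    then show ?thesis by (rule has_derivative_scaleR_left)
  qed
  have "((\<lambda>x. integral (cbox a b) (\<lambda>y. \<rho> (x - y) *\<^sub>R \<xi> y)) has_derivative
     (\<lambda>v. integral (cbox a b) (\<lambda>y. frechet_derivative \<rho> (at (x - y)) v *\<^sub>R \<xi> y))) (at x)" for x
  proof (rule has_derivative_param_integral[OF d])
    show "continuous_on UNIV (\<lambda>y. \<rho> (x - y) *\<^sub>R \<xi> y)" for x
      by (intro continuous_on_scaleR continuous_on_compose2[OF rho] xi) (auto intro!: continuous_intros)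
    show "continuous_on UNIV (\<lambda>(x, y). frechet_derivative \<rho> (at (x - y)) v *\<^sub>R \<xi> y)" for v
      unfolding split_beta
      by (intro continuous_on_scaleR continuous_on_compose2[OF cD] continuous_on_compose2[OF xi]) (auto intro!: continuous_intros)
  qed
  then show ?case by (rule Ck_on_SucI) (rule Suc.IH[OF D(2)])
qed

text \<open>The box is not invariant under y \<mapsto> x - y. Since both integrands vanish off the
  box, the substitution can be made on the whole space.\<close>

lemma integral_reflect_shift:
  fixes f :: "'a::euclidean_space \<Rightarrow> 'c::euclidean_space"
  assumes f: "continuous_on UNIV f" and a: "\<And>y. y \<notin> cbox a b \<Longrightarrow> f y = 0" and b: "\<And>y. y \<notin> cbox a b \<Longrightarrow> f (x - y) = 0"
  shows "integral (cbox a b) f = integral (cbox a b) (\<lambda>u. f (x - u))"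
proof -
  have L: "integral (cbox a b) h = (\<integral>y. h y \<partial>lborel)"
    if h: "continuous_on UNIV h" "\<And>y. y \<notin> cbox a b \<Longrightarrow> h y = 0" for h :: "'a \<Rightarrow> 'c"
  proof -
    have "set_integrable lborel (cbox a b) h"
      unfolding set_integrable_def
      by (rule borel_integrable_compact[OF compact_cbox continuous_on_subset[OF h(1)]]) simp
    then have "integral (cbox a b) h = (LBINT y:cbox a b. h y)" by (simp add: set_borel_integral_eq_integral)
    also have "\<dots> = (\<integral>y. h y \<partial>lborel)"
      unfolding set_lebesgue_integral_def
      by (intro Bochner_Integration.integral_cong refl) (use h(2) in \<open>auto simp: indicator_def\<close>)
    finally show ?thesis .
  qed
  have fm: "f \<in> borel_measurable borel" by (rule borel_measurable_continuous_onI[OF f])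
  have fx: "continuous_on UNIV (\<lambda>u. f (x - u))"
    by (intro continuous_on_compose2[OF f]) (auto intro!: continuous_intros)
  have "(\<integral>y. f y \<partial>lborel) = (\<integral>y. f y \<partial>density (distr lborel borel (\<lambda>u. x + (- 1) *\<^sub>R u)) (\<lambda>_. \<bar>- 1 :: real\<bar>^DIM('a)))"
    by (rule arg_cong[where f = "\<lambda>M. integral\<^sup>L M f", OF lborel_affine]) simp
  also have "\<dots> = (\<integral>u. f (x + (- 1) *\<^sub>R u) \<partial>lborel)"
    using fm by (subst integral_density) (auto simp: integral_distr)
  finally have "(\<integral>y. f y \<partial>lborel) = (\<integral>u. f (x - u) \<partial>lborel)" by simp
  then show ?thesis using L[OF f a] L[OF fx b] by simp
qed

text \<open>Mollification: uniform convergence of the gradients follows by writing the convolution in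
  the form \<open>\<integral> \<rho>(u) \<xi>(x - u) du\<close>, smoothness by writing it as \<open>\<integral> \<rho>(x - y) \<xi>(y) dy\<close>.\<close>

lemma smooth_approximation:
  fixes \<xi> :: "real ^ 'n \<Rightarrow> real ^ 'm"
  assumes xi: "\<xi> \<in> Ckc_ball 1" and d: "d > 0"
  shows "\<exists>\<eta>\<in>Cinfc_ball. \<forall>x. norm (jacobian \<eta> (at x) - jacobian \<xi> (at x)) \<le> d"
proof -
  define J where "J = (\<lambda>x. jacobian \<xi> (at x))"
  have D: "(\<xi> has_derivative (\<lambda>v. J x *v v)) (at x)" "continuous_on UNIV J" for x
    unfolding J_def by (rule Ckc_ballD[OF xi])+
  have xic: "continuous_on UNIV \<xi>" using D(1) by (auto intro!: has_derivative_continuous continuous_at_imp_continuous_on)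
  obtain r where r: "0 < r" "r < 1" "\<And>x. norm x \<ge> r \<Longrightarrow> \<xi> x = 0" "\<And>x. norm x \<ge> r \<Longrightarrow> J x = 0"
    using Ckc_ballD(3)[OF xi] by (auto simp: J_def)
  have "uniformly_continuous_on (cball 0 2) J"
    by (rule compact_uniformly_continuous[OF continuous_on_subset[OF D(2)]]) auto
  then obtain t where t: "t > 0" "\<And>x y. x \<in> cball 0 2 \<Longrightarrow> y \<in> cball 0 2 \<Longrightarrow> dist y x < t \<Longrightarrow> dist (J y) (J x) < d"
    unfolding uniformly_continuous_on_def using d by blast
  \<comment> \<open>t/2 keeps shifts within the modulus of continuity of the gradient; (1 - r)/2
    keeps the mollified support, of radius at most r + e, inside the unit ball.\<close>
  define e where "e = min (t / 2) ((1 - r) / 2)"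
  have e: "e > 0" "e < t" "r + e < 1" "e < 1" using t r by (auto simp: e_def field_simps min_def)
  have close: "norm (J (x - u) - J x) \<le> d" if u: "norm u \<le> e" for x u
  proof (cases "norm x \<le> 1")
    case True
    have "norm (x - u) \<le> 2" using norm_triangle_ineq4[of x u] u e True by linarith
    then have "dist (J (x - u)) (J x) < d" using u e True by (intro t(2)) (simp_all add: mem_cball_0 dist_norm del: mem_cball)
    then show ?thesis by (simp add: dist_norm)
  next
    case False
    moreover have "norm (x - u) \<ge> r" using norm_triangle_ineq2[of x u] u e False by linarith
    ultimately show ?thesis using r d by simp
  qed
  \<comment> \<open>The box with half-width 2 contains the supports of both \<xi> and the kernel, so
    one fixed domain of integration serves both forms of the convolution.\<close>
  define b :: "real^'n" where "b = (\<chi> i. 2)"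
  let ?C = "cbox (- b) b"
  have inC: "x \<in> ?C" if "norm x < 2" for x
  proof -
    have "\<bar>x $ i\<bar> \<le> 2" for i using component_le_norm_cart[of x i] that by linarith
    then show ?thesis by (auto simp: mem_box_cart b_def abs_le_iff minus_le_iff)
  qed
  define \<rho>0 where "\<rho>0 = (\<lambda>x::real^'n. flat 0 (e\<^sup>2 - x \<bullet> x))"
  have rho0_zero: "\<rho>0 x = 0" if "norm x \<ge> e" for x
    using power_mono[OF that, of 2] e by (simp add: \<rho>0_def flat_def power2_norm_eq_inner)
  have rho0_nn: "\<rho>0 x \<ge> 0" for x unfolding \<rho>0_def by (rule flat_bounds)
  have rho0c: "continuous_on UNIV \<rho>0" using Ck_on_bump[of 0 0 "e\<^sup>2"] by (simp add: \<rho>0_def)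
  define c where "c = integral ?C \<rho>0"
  have int0: "\<rho>0 integrable_on ?C" by (rule integrable_continuous[OF continuous_on_subset[OF rho0c]]) simp
  have c: "c > 0"
  proof -
    have "c \<ge> 0" unfolding c_def by (rule integral_nonneg[OF int0]) (rule rho0_nn)
    moreover have "c \<noteq> 0"
    proof
      assume "c = 0"
      then have "(\<rho>0 has_integral 0) ?C" using int0 unfolding c_def by (simp add: has_integral_iff)
      moreover have "0 \<in> box (- b) b" by (simp add: mem_box_cart b_def)
      ultimately have "\<rho>0 0 = 0"
        using inC[of 0] by (intro has_integral_0_cbox_imp_0[OF continuous_on_subset[OF rho0c] rho0_nn]) auto
      then show False using e by (simp add: \<rho>0_def flat_def)
    qed
    ultimately show ?thesis by simp
  qed
  define \<rho> where "\<rho> = (\<lambda>x. \<rho>0 x * (1 / c))"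
  have rhoCk: "Ck_on k \<rho> UNIV" for k unfolding \<rho>_def \<rho>0_def by (intro Ck_on_mult Ck_on_bump Ck_on_const)
  have rho_c: "continuous_on UNIV \<rho>" using rhoCk[of 0] by simp
  have rho_zero: "\<rho> x = 0" if "norm x \<ge> e" for x using rho0_zero[OF that] by (simp add: \<rho>_def)
  have rho_nn: "\<rho> x \<ge> 0" for x using rho0_nn[of x] c by (simp add: \<rho>_def)
  have rho_int: "\<rho> integrable_on ?C" by (rule integrable_continuous[OF continuous_on_subset[OF rho_c]]) simp
  have rho1: "integral ?C \<rho> = 1" using c unfolding \<rho>_def by (simp add: c_def)
  define \<eta> where "\<eta> = (\<lambda>x. integral ?C (\<lambda>y. \<rho> (x - y) *\<^sub>R \<xi> y))"
  have eta2: "\<eta> x = integral ?C (\<lambda>u. \<rho> u *\<^sub>R \<xi> (x - u))" for x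
  proof -
    have "integral ?C (\<lambda>y. \<rho> (x - y) *\<^sub>R \<xi> y) = integral ?C (\<lambda>u. \<rho> (x - (x - u)) *\<^sub>R \<xi> (x - u))"
    proof (rule integral_reflect_shift)
      show "continuous_on UNIV (\<lambda>y. \<rho> (x - y) *\<^sub>R \<xi> y)"
        by (intro continuous_on_scaleR continuous_on_compose2[OF rho_c] xic) (auto intro!: continuous_intros)
      show "\<rho> (x - y) *\<^sub>R \<xi> y = 0" if "y \<notin> ?C" for y
        using r(3)[of y] inC[of y] that r(2) by fastforce
      show "\<rho> (x - (x - y)) *\<^sub>R \<xi> (x - y) = 0" if "y \<notin> ?C" for y
        using rho_zero[of y] inC[of y] that e(4) by fastforce
    qed
    then show ?thesis by (simp add: \<eta>_def)
  qed
  define M where "M = (\<lambda>x. integral ?C (\<lambda>u. \<rho> u *\<^sub>R J (x - u)))"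
  have intM: "(\<lambda>u. \<rho> u *\<^sub>R J (x - u)) integrable_on ?C" for x
  proof (rule integrable_continuous, rule continuous_on_subset)
    show "continuous_on UNIV (\<lambda>u. \<rho> u *\<^sub>R J (x - u))"
      by (intro continuous_on_scaleR rho_c continuous_on_compose2[OF D(2)]) (auto intro!: continuous_intros)
  qed simp
  have eta_d: "(\<eta> has_derivative (\<lambda>v. M x *v v)) (at x)" for x
  proof -
    have d1: "((\<lambda>x. \<rho> u *\<^sub>R \<xi> (x - u)) has_derivative (\<lambda>v. \<rho> u *\<^sub>R (J (x - u) *v v))) (at x)" for x u
      by (intro has_derivative_scaleR_right has_derivative_compose[where f = "\<lambda>x. x - u" and g = \<xi>, OF _ D(1)])
        (auto intro!: derivative_eq_intros)
    have "((\<lambda>x. integral ?C (\<lambda>u. \<rho> u *\<^sub>R \<xi> (x - u))) has_derivative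
        (\<lambda>v. integral ?C (\<lambda>u. \<rho> u *\<^sub>R (J (x - u) *v v)))) (at x)"
    proof (rule has_derivative_param_integral[OF d1])
      show "continuous_on UNIV (\<lambda>u. \<rho> u *\<^sub>R \<xi> (x - u))" for x
        by (intro continuous_on_scaleR rho_c continuous_on_compose2[OF xic]) (auto intro!: continuous_intros)
      have Jv: "continuous_on UNIV (\<lambda>x. J x *v v)" for v
        unfolding matrix_vector_mult_def by (intro continuous_intros D(2))
      show "continuous_on UNIV (\<lambda>(x, u). \<rho> u *\<^sub>R (J (x - u) *v v))" for v
        unfolding split_beta
        by (intro continuous_on_scaleR continuous_on_compose2[OF rho_c] continuous_on_compose2[OF Jv]) (auto intro!: continuous_intros)
    qed
    moreover have "integral ?C (\<lambda>u. \<rho> u *\<^sub>R (J (x - u) *v v)) = M x *v v" for v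
    proof -
      have bl: "bounded_linear (\<lambda>A::real^'n^'m. A *v v)"
        by (intro linear_conv_bounded_linear[THEN iffD1] linearI)
          (simp_all add: matrix_vector_mult_add_rdistrib scaleR_matrix_vector_assoc)
      show ?thesis using integral_linear[OF intM[of x] bl] by (simp add: o_def M_def scaleR_matrix_vector_assoc)
    qed
    ultimately show ?thesis unfolding eta2[abs_def] by simp
  qed
  have "norm (jacobian \<eta> (at x) - jacobian \<xi> (at x)) \<le> d" for x
  proof -
    \<comment> \<open>The kernel has integral 1, so J x is its own average; the error becomes an
      average of J(x - u) - J(x) over |u| \<le> e.\<close>
    have Jx: "J x = integral ?C (\<lambda>u. \<rho> u *\<^sub>R J x)" 
      using integral_linear[OF rho_int bounded_linear_scaleR_left, of "J x"] rho1 by (simp add: o_def)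
    have intJ: "(\<lambda>u. \<rho> u *\<^sub>R J x) integrable_on ?C"
      using integrable_linear[OF rho_int bounded_linear_scaleR_left[of "J x"]] by (simp add: o_def)
    have "M x - J x = integral ?C (\<lambda>u. \<rho> u *\<^sub>R J (x - u)) - integral ?C (\<lambda>u. \<rho> u *\<^sub>R J x)"
      by (subst Jx) (simp add: M_def)
    also have "\<dots> = integral ?C (\<lambda>u. \<rho> u *\<^sub>R J (x - u) - \<rho> u *\<^sub>R J x)"
      by (rule integral_diff[symmetric, OF intM intJ])
    finally have "norm (M x - J x) \<le> integral ?C (\<lambda>u. \<rho> u * d)"
    proof (simp only:, intro integral_norm_bound_integral)
      show "(\<lambda>u. \<rho> u *\<^sub>R J (x - u) - \<rho> u *\<^sub>R J x) integrable_on ?C"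
        by (rule integrable_diff[OF intM intJ])
      show "(\<lambda>u. \<rho> u * d) integrable_on ?C" using rho_int by (rule integrable_on_mult_left)
      fix u
      show "norm (\<rho> u *\<^sub>R J (x - u) - \<rho> u *\<^sub>R J x) \<le> \<rho> u * d"
      proof (cases "norm u \<le> e")
        case True
        then show ?thesis using mult_left_mono[OF close[OF True, of x] rho_nn[of u]] rho_nn[of u]
          by (simp add: scaleR_diff_right[symmetric])
      qed (simp add: rho_zero)
    qed
    also have "\<dots> = d" using rho1 by simp
    finally show ?thesis unfolding jacobian_eqI[OF eta_d] J_def .
  qed
  moreover have "\<eta> \<in> Cinfc_ball"
  proof -
    have "\<eta> x = 0" if x: "norm x > r + e" for x
    proof -
      have "\<rho> (x - y) *\<^sub>R \<xi> y = 0" for y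
      proof (cases "norm y \<ge> r")
        case False
        then have "norm (x - y) \<ge> e" using norm_triangle_ineq2[of x y] x by linarith
        then show ?thesis by (simp add: rho_zero)
      qed (simp add: r(3))
      then have "(\<lambda>y. \<rho> (x - y) *\<^sub>R \<xi> y) = (\<lambda>y. 0)" by (rule ext)
      then show ?thesis by (simp add: \<eta>_def)
    qed
    then have "closure {x. \<eta> x \<noteq> 0} \<subseteq> cball 0 (r + e)"
      by (intro closure_minimal) (force simp: not_le, simp)
    also have "\<dots> \<subseteq> ball 0 1" using e by auto
    finally show ?thesis
      unfolding Cinfc_ball_def Ckc_ball_def \<eta>_def using Ck_on_convolution[OF xic rhoCk] by auto
  qed
  ultimately show ?thesis by blast
qed

text \<open>The condition in (iv) speaks of smooth test functions, the envelope and uniform strict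
  quasiconvexity of C^1 ones. Uniform convergence of gradients suffices because all arguments of F
  stay in a fixed ball, where F is uniformly continuous.\<close>

lemma quasiconvex_smooth_imp_C1:
  fixes F :: "real ^ 'n ^ 'm \<Rightarrow> real" and \<xi> :: "real ^ 'n \<Rightarrow> real ^ 'm"
  assumes F: "continuous_on UNIV F"
    and qc: "\<And>\<xi>. \<xi> \<in> Cinfc_ball \<Longrightarrow> F z \<le> ball_average (\<lambda>x. F (z + jacobian \<xi> (at x)))"
    and xi: "\<xi> \<in> Ckc_ball 1"
  shows "F z \<le> ball_average (\<lambda>x. F (z + jacobian \<xi> (at x)))"
proof (rule field_le_epsilon)
  fix e :: real assume e: "e > 0"
  obtain L where L: "\<And>x. norm (jacobian \<xi> (at x)) \<le> L" using jacobian_bounded[OF xi] by blast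
  define R where "R = norm z + L + 1"
  obtain t where t: "t > 0" "\<And>X Y. norm X \<le> R \<Longrightarrow> norm Y \<le> R \<Longrightarrow> norm (X - Y) < t \<Longrightarrow> \<bar>F X - F Y\<bar> < e"
    using uniform_continuity_on_balls[OF F e] by blast
  obtain \<eta> where eta: "\<eta> \<in> Cinfc_ball" "\<And>x. norm (jacobian \<eta> (at x) - jacobian \<xi> (at x)) \<le> min (t/2) 1"
    using smooth_approximation[OF xi, of "min (t/2) 1"] t(1) by auto
  have eta1: "\<eta> \<in> Ckc_ball 1" using eta(1) Cinfc_subset by auto
  have iE: "ball_integrable (\<lambda>x. F (z + jacobian \<eta> (at x)))" by (rule comp_integrable_cont[OF F eta1])
  have iX: "ball_integrable (\<lambda>x. F (z + jacobian \<xi> (at x)))" by (rule comp_integrable_cont[OF F xi])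
  have "F z \<le> ball_average (\<lambda>x. F (z + jacobian \<eta> (at x)))" by (rule qc[OF eta(1)])
  also have "\<dots> \<le> ball_average (\<lambda>x. F (z + jacobian \<xi> (at x)) + e)"
  proof (rule ball_average_mono[OF iE set_integral_add(1)[OF iX ball_integrable_const]])
    fix x
    define A where "A = jacobian \<xi> (at x)"
    define B where "B = jacobian \<eta> (at x)"
    have BA: "norm (B - A) \<le> min (t/2) 1" using eta(2)[of x] by (simp add: A_def B_def)
    have "norm A \<le> L" using L by (simp add: A_def)
    moreover have "norm B \<le> norm A + 1" using norm_triangle_ineq2[of B A] BA by simp
    ultimately have "norm (z + A) \<le> R" "norm (z + B) \<le> R"
      using norm_triangle_ineq[of z A] norm_triangle_ineq[of z B] unfolding R_def by linarith+
    moreover have "norm ((z + B) - (z + A)) < t" using BA t(1) by simp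
    ultimately have "\<bar>F (z + B) - F (z + A)\<bar> < e" using t(2) by blast
    then show "F (z + jacobian \<eta> (at x)) \<le> F (z + jacobian \<xi> (at x)) + e" unfolding A_def B_def by linarith
  qed
  also have "\<dots> = ball_average (\<lambda>x. F (z + jacobian \<xi> (at x))) + e"
    using ball_average_add[OF iX ball_integrable_const[of e]] by (simp add: ball_average_const)
  finally show "F z \<le> ball_average (\<lambda>x. F (z + jacobian \<xi> (at x))) + e" .
qed

section \<open>The characterizations\<close>

context orlicz begin

text \<open>f may be discontinuous inside the ball, so it is replaced there by something larger.
  Raising is the safe direction: for |z| > M1 + 2 the value at z is unchanged while the averages
  cannot decrease, so the given inequality survives.\<close>

lemma strict_imp_asymp_quasiconvex:
  fixes f :: "real ^ 'n ^ 'm \<Rightarrow> real"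
  assumes f: "f \<in> borel_measurable borel" "bounded_on_balls f"
    and pos: "k > 0" "L > 0"
    and qc: "\<And>z \<xi>. norm z > M \<Longrightarrow> \<xi> \<in> Cinfc_ball \<Longrightarrow>
       ball_average (\<lambda>x. f (z + jacobian \<xi> (at x)))
         \<ge> f z + k * ball_average (\<lambda>x. shifted \<phi> (norm z) (norm (jacobian \<xi> (at x))))"
    and lip: "\<And>z1 z2. norm z1 > M \<Longrightarrow> norm z2 > M \<Longrightarrow>
       \<bar>f z2 - f z1\<bar> \<le> L * norm (z1 - z2) * deriv \<phi> (1 + norm z1 + norm z2)"
  shows "asymp_quasiconvex \<phi> f"
proof -
  obtain V :: "real^'n^'m \<Rightarrow> real" and cl cu where c: "cl > 0" "cu > 0" and Vc: "continuous_on UNIV V" and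
    V: "\<And>\<xi> z. \<xi> \<in> Ckc_ball 1 \<Longrightarrow> cl * ball_average (\<lambda>x. shifted \<phi> (1 + norm z) (norm (jacobian \<xi> (at x))))
        \<le> ball_average (\<lambda>x. V (z + jacobian \<xi> (at x))) - V z"
     "\<And>\<xi> z. \<xi> \<in> Ckc_ball 1 \<Longrightarrow> ball_average (\<lambda>x. V (z + jacobian \<xi> (at x))) - V z
        \<le> cu * ball_average (\<lambda>x. shifted \<phi> (1 + norm z) (norm (jacobian \<xi> (at x))))"
    using strict_potential_average by blast
  define M1 where "M1 = max M 1"
  have M1: "M1 \<ge> M" "M1 \<ge> 1" by (auto simp: M1_def)
  obtain B where B: "\<And>w. norm w \<le> M1 + 2 \<Longrightarrow> \<bar>f w\<bar> \<le> B" using f(2) unfolding bounded_on_balls_def by blast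
  \<comment> \<open>The ramp runs between norms M1 + 1 and M1 + 2, where the Lipschitz bound already
    makes f continuous; nearer the origin \<open>ft\<close> is the constant |B|.\<close>
  define \<theta> where "\<theta> = (\<lambda>z::real^'n^'m. max 0 (min 1 (norm z - (M1 + 1))))"
  define ft where "ft = (\<lambda>z. \<theta> z * f z + (1 - \<theta> z) * \<bar>B\<bar>)"
  have th: "0 \<le> \<theta> z" "\<theta> z \<le> 1" for z by (auto simp: \<theta>_def)
  have ft_eq: "ft z = f z" if "norm z \<ge> M1 + 2" for z using that by (simp add: ft_def \<theta>_def)
  have ft_ge: "f z \<le> ft z" for z
  proof (cases "norm z \<le> M1 + 2")
    case True
    have "(1 - \<theta> z) * f z \<le> (1 - \<theta> z) * \<bar>B\<bar>" using th B[OF True] by (intro mult_left_mono) auto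
    then show ?thesis by (simp add: ft_def algebra_simps)
  qed (simp add: ft_eq)
  have fc: "continuous_on (- cball 0 M1) f"
  proof (rule continuous_at_imp_continuous_on, rule ballI)
    fix z :: "real^'n^'m" assume "z \<in> - cball 0 M1"
    then have z: "norm z > M1" by simp
    have "((\<lambda>w. f w - f z) \<longlongrightarrow> 0) (at z)"
    proof (rule Lim_null_comparison[where g = "\<lambda>w. L * norm (w - z) * deriv \<phi> (2 + 2 * norm z)"])
      show "\<forall>\<^sub>F w in at z. norm (f w - f z) \<le> L * norm (w - z) * deriv \<phi> (2 + 2 * norm z)"
        unfolding eventually_at
      proof (intro exI[of _ "min 1 (norm z - M1)"] conjI ballI impI)
        show "0 < min 1 (norm z - M1)" using z by simp
        fix w assume w: "w \<noteq> z \<and> dist w z < min 1 (norm z - M1)"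
        have nw: "norm w > M" "norm w \<le> norm z + 1"
          using w M1 norm_triangle_ineq2[of z w] norm_triangle_ineq2[of w z] by (auto simp: dist_norm norm_minus_commute)
        have nz: "norm z > M" using z M1 by simp
        have "deriv \<phi> (1 + norm z + norm w) \<le> deriv \<phi> (2 + 2 * norm z)"
          using nw by (intro deriv_mono) (auto simp: add_pos_nonneg)
        then have "L * norm (z - w) * deriv \<phi> (1 + norm z + norm w) \<le> L * norm (z - w) * deriv \<phi> (2 + 2 * norm z)"
          using pos by (intro mult_left_mono) auto
        then show "norm (f w - f z) \<le> L * norm (w - z) * deriv \<phi> (2 + 2 * norm z)"
          using lip[OF nz nw(1)] by (simp add: norm_minus_commute)
      qed
      have "((\<lambda>w. L * norm (w - z) * deriv \<phi> (2 + 2 * norm z)) \<longlongrightarrow> L * norm (z - z) * deriv \<phi> (2 + 2 * norm z)) (at z)"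
        by (intro tendsto_intros)
      then show "((\<lambda>w. L * norm (w - z) * deriv \<phi> (2 + 2 * norm z)) \<longlongrightarrow> 0) (at z)" by simp
    qed
    then show "isCont f z" unfolding isCont_def by (rule LIM_zero_cancel)
  qed
  have ftc: "continuous_on UNIV ft"
  proof -
    have thc: "continuous_on S \<theta>" for S unfolding \<theta>_def by (intro continuous_intros)
    have "continuous_on (- cball 0 M1) ft" unfolding ft_def by (intro continuous_intros thc fc)
    moreover have "continuous_on (ball 0 (M1 + 1)) ft"
      by (rule continuous_on_eq[of _ "\<lambda>z. \<bar>B\<bar>"]) (auto simp: ft_def \<theta>_def)
    ultimately have "continuous_on (- cball 0 M1 \<union> ball 0 (M1 + 1)) ft"
      by (intro continuous_on_open_Un) auto
    moreover have "- cball 0 M1 \<union> ball 0 (M1 + 1) = (UNIV :: (real^'n^'m) set)" by auto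
    ultimately show ?thesis by simp
  qed
  define K where "K = 4 * 2 powr c2"
  have K: "K > 0" by (simp add: K_def)
  \<comment> \<open>The multiple of V that uses up k: cu bounds what V gains on average, and
    \<open>2 powr c2 * K\<close> changes the shift from 1 + |z| to |z|.\<close>
  define d where "d = k / (cu * (2 powr c2 * K))"
  have d: "d > 0" using pos c K by (simp add: d_def)
  define F where "F = (\<lambda>z. ft z - d * V z)"
  have Fc: "continuous_on UNIV F" unfolding F_def by (intro continuous_intros ftc Vc)
  have Fqc: "F z \<le> ball_average (\<lambda>x. F (z + jacobian \<xi> (at x)))"
    if z: "norm z > M1 + 2" and "\<xi> \<in> Cinfc_ball" for z and \<xi> :: "real^'n \<Rightarrow> real^'m"
  proof -
    have xi: "\<xi> \<in> Ckc_ball 1" using that(2) Cinfc_subset by auto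
    have z1: "norm z \<ge> 1" "norm z > 0" "1 + norm z > 0" "norm z > M" using z M1 by auto
    let ?J = "\<lambda>x. jacobian \<xi> (at x)"
    have iV: "ball_integrable (\<lambda>x. d * V (z + ?J x))" using comp_integrable_cont[OF Vc xi] by simp
    have ift: "ball_integrable (\<lambda>x. ft (z + ?J x))" by (rule comp_integrable_cont[OF ftc xi])
    have s1: "ball_integrable (\<lambda>x. shifted \<phi> (1 + norm z) (norm (?J x)))" by (rule shifted_comp_integrable[OF z1(3) xi])
    have s0: "ball_integrable (\<lambda>x. shifted \<phi> (norm z) (norm (?J x)))" by (rule shifted_comp_integrable[OF z1(2) xi])
    have "ball_average (\<lambda>x. shifted \<phi> (1 + norm z) (norm (?J x)))
        \<le> ball_average (\<lambda>x. (2 powr c2 * K) * shifted \<phi> (norm z) (norm (?J x)))"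
    proof (rule ball_average_mono[OF s1])
      show "ball_integrable (\<lambda>x. (2 powr c2 * K) * shifted \<phi> (norm z) (norm (?J x)))" using s0 by simp
      fix x
      have "shifted \<phi> (1 + norm z) (norm (?J x)) \<le> weight (1 + norm z) (norm (?J x))"
        using z1 by (intro shifted_le_weight) auto
      also have "\<dots> \<le> 2 powr c2 * weight (norm z) (norm (?J x))" using z1 by (intro weight_suc) auto
      also have "\<dots> \<le> 2 powr c2 * (K * shifted \<phi> (norm z) (norm (?J x)))"
        unfolding K_def using z1 by (intro mult_left_mono weight_le_shifted) auto
      finally show "shifted \<phi> (1 + norm z) (norm (?J x)) \<le> (2 powr c2 * K) * shifted \<phi> (norm z) (norm (?J x))" by simp
    qed
    then have "d * cu * ball_average (\<lambda>x. shifted \<phi> (1 + norm z) (norm (?J x)))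
        \<le> d * cu * ((2 powr c2 * K) * ball_average (\<lambda>x. shifted \<phi> (norm z) (norm (?J x))))"
      using d c unfolding ball_average_cmult by (intro mult_left_mono) auto
    also have "\<dots> = k * ball_average (\<lambda>x. shifted \<phi> (norm z) (norm (?J x)))"
      using c K by (simp add: d_def)
    finally have sh: "d * cu * ball_average (\<lambda>x. shifted \<phi> (1 + norm z) (norm (?J x)))
       \<le> k * ball_average (\<lambda>x. shifted \<phi> (norm z) (norm (?J x)))" .
    have "d * (ball_average (\<lambda>x. V (z + ?J x)) - V z) \<le> d * (cu * ball_average (\<lambda>x. shifted \<phi> (1 + norm z) (norm (?J x))))"
      using d by (intro mult_left_mono V(2)[OF xi]) auto
    then have 1: "d * ball_average (\<lambda>x. V (z + ?J x)) \<le> d * V z + k * ball_average (\<lambda>x. shifted \<phi> (norm z) (norm (?J x)))"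
      using sh by (simp add: algebra_simps)
    have 2: "ball_average (\<lambda>x. f (z + ?J x)) \<le> ball_average (\<lambda>x. ft (z + ?J x))"
      by (rule ball_average_mono[OF comp_integrable[OF f xi] ift ft_ge])
    have "F z = f z - d * V z" using ft_eq[of z] z by (simp add: F_def)
    also have "\<dots> \<le> ball_average (\<lambda>x. ft (z + ?J x)) - ball_average (\<lambda>x. d * V (z + ?J x))"
      unfolding ball_average_cmult using 1 2 qc[OF z1(4) that(2)] by linarith
    also have "\<dots> = ball_average (\<lambda>x. F (z + ?J x))"
      unfolding F_def by (rule ball_average_diff[OF ift iV, symmetric])
    finally show ?thesis .
  qed
  interpret quasiconvex_outside F "M1 + 2"
    by unfold_locales (rule Fc, rule quasiconvex_smooth_imp_C1[OF Fc Fqc])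
  \<comment> \<open>Far out the envelope equals F, so adding d V undoes the subtraction and returns
    f; at every z the term d V supplies strictness with constant \<open>d * cl\<close>.\<close>
  define g where "g = (\<lambda>z. qc_envelope F z + d * V z)"
  have "unif_strictly_quasiconvex \<phi> g"
    unfolding unif_strictly_quasiconvex_def
  proof (intro conjI exI[of _ "d * cl"] ballI allI)
    show "continuous_on UNIV g" unfolding g_def by (intro continuous_intros envelope_continuous Vc)
    show "0 < d * cl" using d c by simp
    fix \<xi> :: "real^'n \<Rightarrow> real^'m" and z :: "real^'n^'m" assume xi: "\<xi> \<in> Ckc_ball 1"
    let ?J = "\<lambda>x. jacobian \<xi> (at x)"
    have iV: "ball_integrable (\<lambda>x. d * V (z + ?J x))" using comp_integrable_cont[OF Vc xi] by simp
    have iQ: "ball_integrable (\<lambda>x. qc_envelope F (z + ?J x))" by (rule comp_integrable_cont[OF envelope_continuous xi])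
    have "d * (cl * ball_average (\<lambda>x. shifted \<phi> (1 + norm z) (norm (?J x)))) \<le> d * (ball_average (\<lambda>x. V (z + ?J x)) - V z)"
      using d by (intro mult_left_mono V(1)[OF xi]) auto
    then show "g z + d * cl * ball_average (\<lambda>x. shifted \<phi> (1 + norm z) (norm (?J x))) \<le> ball_average (\<lambda>x. g (z + ?J x))"
      using envelope_quasiconvex[OF xi, of z] unfolding g_def ball_average_add[OF iQ iV] ball_average_cmult
      by (simp add: algebra_simps)
  qed
  moreover have "f z = g z" if "norm z > M1 + 2" for z
    using envelope_eq[OF that] ft_eq[of z] that by (simp add: g_def F_def)
  ultimately show ?thesis unfolding asymp_quasiconvex_def using M1 by (intro exI[of _ "M1 + 2"]) auto
qed

lemma asymp_quasiconvex_growth: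
  fixes f :: "real ^ 'n ^ 'm \<Rightarrow> real"
  assumes f: "f \<in> borel_measurable borel" and growth: "C > 0" "\<And>z. \<bar>f z\<bar> \<le> C * (1 + \<phi> (norm z))"
  shows "asymp_quasiconvex \<phi> f \<longleftrightarrow>
          (\<exists>M>0. \<exists>k>0. \<exists>L>0.
             (\<forall>z. norm z > M \<longrightarrow> (\<forall>\<xi>\<in>Cinfc_ball.
                ball_average (\<lambda>x. f (z + jacobian \<xi> (at x)))
                  \<ge> f z + k * ball_average (\<lambda>x. shifted \<phi> (norm z) (norm (jacobian \<xi> (at x)))))) \<and>
             (\<forall>z1 z2. norm z1 > M \<and> norm z2 > M \<longrightarrow>
                \<bar>f z2 - f z1\<bar> \<le> L * norm (z1 - z2) * deriv \<phi> (1 + norm z1 + norm z2)))"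
    (is "?A \<longleftrightarrow> ?B")
proof
  have fb: "bounded_on_balls f" by (rule growth_bounded_on_balls[OF growth(2,1)])
  {
    assume A: ?A
    obtain M1 k where 1: "M1 > 0" "k > 0" "\<And>z \<xi>. norm z > M1 \<Longrightarrow> \<xi> \<in> Cinfc_ball \<Longrightarrow>
        ball_average (\<lambda>x. f (z + jacobian \<xi> (at x)))
          \<ge> f z + k * ball_average (\<lambda>x. shifted \<phi> (norm z) (norm (jacobian \<xi> (at x))))"
      using asymp_quasiconvex_imp_strict[OF f fb A] by blast
    obtain M2 L where 2: "M2 > 0" "L > 0" "\<And>z1 z2. norm z1 > M2 \<Longrightarrow> norm z2 > M2 \<Longrightarrow>
        \<bar>f z2 - f z1\<bar> \<le> L * norm (z1 - z2) * deriv \<phi> (1 + norm z1 + norm z2)"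
      using quasiconvex_growth_lipschitz[OF growth(2,1) A] by blast
    show ?B
      by (intro exI[of _ "max M1 M2"] exI[of _ k] exI[of _ L] conjI allI impI ballI) (use 1 2 in auto)
  }
  assume ?B
  then show ?A using strict_imp_asymp_quasiconvex[OF f fb] by blast
qed

end

theorem theorem4p1:
  fixes \<phi> :: "real \<Rightarrow> real" and f :: "real ^ 'n ^ 'm \<Rightarrow> real"
  assumes "CARD('n) \<ge> 2"
    and "N_function \<phi>"
    and "Ck_on 1 \<phi> {0..}" and "Ck_on 2 \<phi> {0<..}"
    and "comparable_on {0<..} (deriv \<phi>) (\<lambda>t. t * deriv (deriv \<phi>) t)"
  shows
    "(C2_outside_large_ball f \<longrightarrow>
        (asymp_quasiconvex \<phi> f \<longleftrightarrow>
          (\<exists>g. unif_strictly_quasiconvex \<phi> g \<and> C2_outside_large_ball g \<and>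
             ((\<lambda>z. norm (D2 f z - D2 g z) / deriv (deriv \<phi>) (norm z)) \<longlongrightarrow> 0) at_infinity)))
   \<and> (locally_bdd_below f \<longrightarrow>
        (asymp_quasiconvex \<phi> f \<longleftrightarrow>
          (\<exists>M>0. \<exists>g. unif_strictly_quasiconvex \<phi> g \<and>
             (\<forall>z. norm z > M \<longrightarrow> f z = g z) \<and> (\<forall>z. g z \<le> f z))))
   \<and> (locally_bdd_above f \<longrightarrow>
        (asymp_quasiconvex \<phi> f \<longleftrightarrow>
          (\<exists>M>0. \<exists>g. unif_strictly_quasiconvex \<phi> g \<and>
             (\<forall>z. norm z > M \<longrightarrow> f z = g z) \<and> (\<forall>z. g z \<ge> f z))))
   \<and> (f \<in> borel_measurable borel \<and> (\<exists>C>0. \<forall>z. \<bar>f z\<bar> \<le> C * (1 + \<phi> (norm z))) \<longrightarrow>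
        (asymp_quasiconvex \<phi> f \<longleftrightarrow>
          (\<exists>M>0. \<exists>k>0. \<exists>L>0.
             (\<forall>z. norm z > M \<longrightarrow> (\<forall>\<xi>\<in>Cinfc_ball.
                ball_average (\<lambda>x. f (z + jacobian \<xi> (at x)))
                  \<ge> f z + k * ball_average (\<lambda>x. shifted \<phi> (norm z) (norm (jacobian \<xi> (at x)))))) \<and>
             (\<forall>z1 z2. norm z1 > M \<and> norm z2 > M \<longrightarrow>
                \<bar>f z2 - f z1\<bar> \<le> L * norm (z1 - z2) * deriv \<phi> (1 + norm z1 + norm z2)))))"
proof -
  obtain c1 c2 where "orlicz \<phi> c1 c2" using N_function_orlicz[OF assms(2,4,5)] by blast
  then interpret orlicz \<phi> c1 c2 .
  show ?thesis
    by (intro conjI impI)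
      (erule asymp_quasiconvex_D2, erule asymp_quasiconvex_below, erule asymp_quasiconvex_above,
        elim conjE exE, erule (1) asymp_quasiconvex_growth, blast)
qed

end
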